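(* Let $M$ be a countable transitive model of $\mathrm{ZFC}+\mathrm{CH}$. There exists an almost disjoint family $\mathcal A\in M$ that is an indestructible MAD family for Cohen extensions (i.e. for every infinite cardinal $\kappa$ of $M$ and every $\mathbb C_\kappa$-generic filter $G$ over $M$, $\mathcal A$ is MAD in $M[G]$) and such that in every Cohen extension of $M$ (i.e. in every such $M[G]$), $\operatorname{CL}(\Psi(\mathcal A))$ is pseudocompact.
   Context: An almost disjoint family is an infinite collection of infinite subsets of $\omega$ whose pairwise intersections are finite; it is MAD if it is maximal under inclusion among almost disjoint families. For an almost disjoint family $\mathcal A$, the Isbell-Mrówka space $\Psi(\mathcal A)$ is the set $\mathcal A\cup\omega$ topologized so that $\omega$ is open and discrete and $\{\{A\}\cup(A\setminus n): n\in\omega\}$ is a local base at $A\in\mathcal A$. For a topological space $X$, $\operatorname{CL}(X)$ is the set of nonempty closed subsets of $X$ with the Vietoris topology, whose base consists of the sets $\langle U_0,\dots,U_n\rangle=\{F\in \operatorname{CL}(X): F\subseteq\bigcup_{i\le n}U_i \text{ and } F\cap U_i\ne\emptyset \text{ for all } i\le n\}$, with $U_0,\dots,U_n$ open in $X$. A space is pseudocompact if every continuous function from it to $\mathbb R$ is bounded. For an infinite cardinal $\kappa$, $\mathbb C_\kappa=\mathrm{Fn}(\kappa,2)$ is the set of finite partial functions from $\kappa$ to $2$, ordered by reverse inclusion. *)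

theory Defs
  imports Complex_Main "HOL-Library.Countable_Set_Type"
begin

section \<open>Hereditarily countable sets\<close>

text \<open>
  A countable transitive model consists of hereditarily countable sets, and so does each of its
  generic extensions. The datatype below is the initial algebra of the countable powerset functor,
  that is, the universe of well-founded hereditarily countable sets. Sets are elements of type
  \<open>V\<close>; models, posets and generic filters are classes, of type \<open>V set\<close>.
\<close>

datatype V = VSet (members: "V cset")

definition elts :: "V \<Rightarrow> V set" where
  "elts x = rcset (members x)"

text \<open>\<open>vset X\<close> is the set with elements \<open>X\<close>; it is only meaningful for countable \<open>X\<close>.\<close>

definition vset :: "V set \<Rightarrow> V" where
  "vset X = VSet (acset X)"

lemma countable_elts [simp, intro]: "countable (elts x)"
  by (simp add: elts_def)

lemma elts_vset [simp]: "countable X \<Longrightarrow> elts (vset X) = X"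
  by (simp add: elts_def vset_def)

lemma vset_elts [simp]: "vset (elts x) = x"
  by (simp add: elts_def vset_def)

lemma vset_eq_iff [simp]: "countable X \<Longrightarrow> countable Y \<Longrightarrow> vset X = vset Y \<longleftrightarrow> X = Y"
  by (metis elts_vset)

lemma V_eq_iff: "x = y \<longleftrightarrow> elts x = elts y"
  by (metis vset_elts)

lemma V_induct [case_names elts]:
  assumes "\<And>x. (\<And>y. y \<in> elts x \<Longrightarrow> P y) \<Longrightarrow> P x"
  shows "P x"
proof (induction x)
  case (VSet X)
  show ?case
    by (rule assms) (use VSet in \<open>simp add: elts_def\<close>)
qed

lemma wf_elts: "wf {(y, x). y \<in> elts x}"
proof (rule wfUNIVI)
  fix P :: "V \<Rightarrow> bool" and x
  assume step: "\<forall>x. (\<forall>y. (y, x) \<in> {(y, x). y \<in> elts x} \<longrightarrow> P y) \<longrightarrow> P x"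
  show "P x"
  proof (induction x rule: V_induct)
    case (elts x)
    then show ?case
      using step[rule_format, of x] by blast
  qed
qed

definition pair :: "V \<Rightarrow> V \<Rightarrow> V" where
  "pair a b = vset {vset {a}, vset {a, b}}"

lemma pair_eq_iff [simp]: "pair a b = pair c d \<longleftrightarrow> a = c \<and> b = d"
  by (auto simp: pair_def doubleton_eq_iff)

fun nat_code :: "nat \<Rightarrow> V" where
  "nat_code 0 = vset {}"
| "nat_code (Suc n) = vset (insert (nat_code n) (elts (nat_code n)))"

definition omega :: V where
  "omega = vset (range nat_code)"

definition ordinal :: "V \<Rightarrow> bool" where
  "ordinal x \<longleftrightarrow>
     (\<forall>y\<in>elts x. elts y \<subseteq> elts x) \<and> (\<forall>y\<in>elts x. \<forall>z\<in>elts y. elts z \<subseteq> elts y)"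

section \<open>Countable transitive models of ZFC and CH\<close>

text \<open>First-order formulas of set theory with variables \<open>0, 1, 2, \<dots>\<close>, needed for the schemes.\<close>

datatype fm = Mem nat nat | Eq nat nat | Neg fm | Conj fm fm | All nat fm

primrec sat :: "V set \<Rightarrow> (nat \<Rightarrow> V) \<Rightarrow> fm \<Rightarrow> bool" where
  "sat M e (Mem i j) \<longleftrightarrow> e i \<in> elts (e j)"
| "sat M e (Eq i j) \<longleftrightarrow> e i = e j"
| "sat M e (Neg \<phi>) \<longleftrightarrow> \<not> sat M e \<phi>"
| "sat M e (Conj \<phi> \<psi>) \<longleftrightarrow> sat M e \<phi> \<and> sat M e \<psi>"
| "sat M e (All i \<phi>) \<longleftrightarrow> (\<forall>x\<in>M. sat M (e(i := x)) \<phi>)"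

text \<open>
  The axioms are relativised to \<open>M\<close>. In the two schemes the variables \<open>0\<close> and \<open>1\<close> are the
  arguments of the formula, and the assignment \<open>e\<close> supplies the parameters.
\<close>

definition extensionality_in :: "V set \<Rightarrow> bool" where
  "extensionality_in M \<longleftrightarrow>
     (\<forall>x\<in>M. \<forall>y\<in>M. (\<forall>z\<in>M. z \<in> elts x \<longleftrightarrow> z \<in> elts y) \<longrightarrow> x = y)"

definition foundation_in :: "V set \<Rightarrow> bool" where
  "foundation_in M \<longleftrightarrow>
     (\<forall>x\<in>M. (\<exists>y\<in>M. y \<in> elts x) \<longrightarrow>
        (\<exists>y\<in>M. y \<in> elts x \<and> \<not> (\<exists>z\<in>M. z \<in> elts x \<and> z \<in> elts y)))"

definition pairing_in :: "V set \<Rightarrow> bool" where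
  "pairing_in M \<longleftrightarrow>
     (\<forall>x\<in>M. \<forall>y\<in>M. \<exists>z\<in>M. \<forall>w\<in>M. w \<in> elts z \<longleftrightarrow> w = x \<or> w = y)"

definition union_in :: "V set \<Rightarrow> bool" where
  "union_in M \<longleftrightarrow>
     (\<forall>x\<in>M. \<exists>u\<in>M. \<forall>z\<in>M. z \<in> elts u \<longleftrightarrow> (\<exists>y\<in>M. y \<in> elts x \<and> z \<in> elts y))"

definition power_set_in :: "V set \<Rightarrow> bool" where
  "power_set_in M \<longleftrightarrow>
     (\<forall>x\<in>M. \<exists>p\<in>M. \<forall>z\<in>M. z \<in> elts p \<longleftrightarrow> (\<forall>w\<in>M. w \<in> elts z \<longrightarrow> w \<in> elts x))"

definition infinity_in :: "V set \<Rightarrow> bool" where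
  "infinity_in M \<longleftrightarrow>
     (\<exists>x\<in>M. (\<exists>y\<in>M. y \<in> elts x \<and> (\<forall>z\<in>M. z \<notin> elts y)) \<and>
        (\<forall>y\<in>M. y \<in> elts x \<longrightarrow>
           (\<exists>s\<in>M. s \<in> elts x \<and> (\<forall>z\<in>M. z \<in> elts s \<longleftrightarrow> z \<in> elts y \<or> z = y))))"

definition separation_in :: "V set \<Rightarrow> bool" where
  "separation_in M \<longleftrightarrow>
     (\<forall>\<phi> e. range e \<subseteq> M \<longrightarrow>
        (\<forall>a\<in>M. \<exists>b\<in>M. \<forall>x\<in>M. x \<in> elts b \<longleftrightarrow> x \<in> elts a \<and> sat M (e(0 := x)) \<phi>))"

definition replacement_in :: "V set \<Rightarrow> bool" where
  "replacement_in M \<longleftrightarrow>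
     (\<forall>\<phi> e. range e \<subseteq> M \<longrightarrow>
        (\<forall>a\<in>M.
           (\<forall>x\<in>M. x \<in> elts a \<longrightarrow> (\<exists>!y. y \<in> M \<and> sat M (e(0 := x, 1 := y)) \<phi>)) \<longrightarrow>
           (\<exists>b\<in>M. \<forall>y\<in>M. y \<in> elts b \<longleftrightarrow>
              (\<exists>x\<in>M. x \<in> elts a \<and> sat M (e(0 := x, 1 := y)) \<phi>))))"

definition choice_in :: "V set \<Rightarrow> bool" where
  "choice_in M \<longleftrightarrow>
     (\<forall>x\<in>M.
        (\<forall>y\<in>M. y \<in> elts x \<longrightarrow> (\<exists>z\<in>M. z \<in> elts y)) \<and>
        (\<forall>y\<in>M. \<forall>y'\<in>M. y \<in> elts x \<and> y' \<in> elts x \<and> y \<noteq> y' \<longrightarrow>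
           \<not> (\<exists>z\<in>M. z \<in> elts y \<and> z \<in> elts y')) \<longrightarrow>
        (\<exists>c\<in>M. \<forall>y\<in>M. y \<in> elts x \<longrightarrow> (\<exists>!z. z \<in> M \<and> z \<in> elts y \<and> z \<in> elts c)))"

definition ZFC_in :: "V set \<Rightarrow> bool" where
  "ZFC_in M \<longleftrightarrow>
     extensionality_in M \<and> foundation_in M \<and> pairing_in M \<and> union_in M \<and> power_set_in M \<and>
     infinity_in M \<and> separation_in M \<and> replacement_in M \<and> choice_in M"

definition transitive_class :: "V set \<Rightarrow> bool" where
  "transitive_class M \<longleftrightarrow> (\<forall>x\<in>M. elts x \<subseteq> M)"

text \<open>
  From here on, a predicate with first argument \<open>N\<close> expresses the corresponding notion inside the
  transitive model \<open>N\<close> of ZFC: quantifiers over arbitrary sets range over \<open>N\<close>. Notions that are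
  absolute for such models (finiteness, \<open>\<omega>\<close>, ordinals, ordered pairs) are used
  without relativisation. \<open>fun_in N X g\<close> says that the restriction of \<open>g\<close> to \<open>X\<close> belongs to \<open>N\<close>.
\<close>

definition fun_in :: "V set \<Rightarrow> V set \<Rightarrow> (V \<Rightarrow> V) \<Rightarrow> bool" where
  "fun_in N X g \<longleftrightarrow> (\<exists>f\<in>N. elts f = (\<lambda>x. pair x (g x)) ` X)"

definition equipotent_in :: "V set \<Rightarrow> V set \<Rightarrow> V set \<Rightarrow> bool" where
  "equipotent_in N X Y \<longleftrightarrow> (\<exists>g. fun_in N X g \<and> bij_betw g X Y)"

definition cardinal_in :: "V set \<Rightarrow> V \<Rightarrow> bool" where
  "cardinal_in N \<kappa> \<longleftrightarrow>
     \<kappa> \<in> N \<and> ordinal \<kappa> \<and> (\<forall>\<alpha>\<in>elts \<kappa>. \<not> equipotent_in N (elts \<alpha>) (elts \<kappa>))"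

definition infinite_cardinal_in :: "V set \<Rightarrow> V \<Rightarrow> bool" where
  "infinite_cardinal_in N \<kappa> \<longleftrightarrow> cardinal_in N \<kappa> \<and> infinite (elts \<kappa>)"

definition aleph1_in :: "V set \<Rightarrow> V \<Rightarrow> bool" where
  "aleph1_in N \<kappa> \<longleftrightarrow>
     infinite_cardinal_in N \<kappa> \<and> {\<mu> \<in> elts \<kappa>. infinite_cardinal_in N \<mu>} = {omega}"

definition CH_in :: "V set \<Rightarrow> bool" where
  "CH_in N \<longleftrightarrow> (\<exists>\<kappa>. aleph1_in N \<kappa> \<and> equipotent_in N (elts \<kappa>) {x \<in> N. elts x \<subseteq> elts omega})"

definition ctm_ZFC_CH :: "V set \<Rightarrow> bool" where
  "ctm_ZFC_CH M \<longleftrightarrow> countable M \<and> transitive_class M \<and> ZFC_in M \<and> CH_in M"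

section \<open>Cohen forcing and generic extensions\<close>

definition Fn2 :: "V \<Rightarrow> V set" where
  "Fn2 \<kappa> = {p. finite (elts p) \<and>
     elts p \<subseteq> (\<Union>\<alpha>\<in>elts \<kappa>. {pair \<alpha> (nat_code 0), pair \<alpha> (nat_code 1)}) \<and>
     (\<forall>\<alpha> b c. pair \<alpha> b \<in> elts p \<and> pair \<alpha> c \<in> elts p \<longrightarrow> b = c)}"

definition rev_incl :: "V \<Rightarrow> V \<Rightarrow> bool" where
  "rev_incl p q \<longleftrightarrow> elts q \<subseteq> elts p"

definition filter_on :: "V set \<Rightarrow> (V \<Rightarrow> V \<Rightarrow> bool) \<Rightarrow> V set \<Rightarrow> bool" where
  "filter_on P le G \<longleftrightarrow>
     G \<subseteq> P \<and> G \<noteq> {} \<and>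
     (\<forall>p\<in>G. \<forall>q\<in>P. le p q \<longrightarrow> q \<in> G) \<and>
     (\<forall>p\<in>G. \<forall>q\<in>G. \<exists>r\<in>G. le r p \<and> le r q)"

definition dense_in :: "V set \<Rightarrow> (V \<Rightarrow> V \<Rightarrow> bool) \<Rightarrow> V set \<Rightarrow> bool" where
  "dense_in P le D \<longleftrightarrow> D \<subseteq> P \<and> (\<forall>p\<in>P. \<exists>d\<in>D. le d p)"

definition generic_over :: "V set \<Rightarrow> V set \<Rightarrow> (V \<Rightarrow> V \<Rightarrow> bool) \<Rightarrow> V set \<Rightarrow> bool" where
  "generic_over M P le G \<longleftrightarrow>
     filter_on P le G \<and> (\<forall>D\<in>M. dense_in P le (elts D) \<longrightarrow> G \<inter> elts D \<noteq> {})"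

inductive is_name :: "V set \<Rightarrow> V \<Rightarrow> bool" for P where
  "(\<And>x. x \<in> elts \<tau> \<Longrightarrow> \<exists>\<sigma> p. x = pair \<sigma> p \<and> is_name P \<sigma> \<and> p \<in> P) \<Longrightarrow> is_name P \<tau>"

lemma wf_name_order: "wf ({(y, x). y \<in> elts x}\<^sup>+)"
  by (rule wf_trancl[OF wf_elts])

lemma name_order: "pair \<sigma> p \<in> elts \<tau> \<Longrightarrow> (\<sigma>, \<tau>) \<in> {(y, x). y \<in> elts x}\<^sup>+"
proof -
  assume "pair \<sigma> p \<in> elts \<tau>"
  moreover have "\<sigma> \<in> elts (vset {\<sigma>})" "vset {\<sigma>} \<in> elts (pair \<sigma> p)"
    by (simp_all add: pair_def)
  ultimately show ?thesis
    by (intro trancl_into_trancl[OF trancl_into_trancl[OF r_into_trancl]]) simp_all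
qed

function val :: "V set \<Rightarrow> V \<Rightarrow> V" where
  "val G \<tau> = vset (val G ` {\<sigma>. \<exists>p\<in>G. pair \<sigma> p \<in> elts \<tau>})"
  by auto
termination
proof (relation "inv_image ({(y, x). y \<in> elts x}\<^sup>+) snd")
  show "wf (inv_image ({(y, x). y \<in> elts x}\<^sup>+) snd)"
    by (rule wf_inv_image[OF wf_name_order])
next
  fix G \<tau> \<sigma>
  assume "\<sigma> \<in> {\<sigma>. \<exists>p\<in>G. pair \<sigma> p \<in> elts \<tau>}"
  then obtain p where "pair \<sigma> p \<in> elts \<tau>"
    by blast
  from name_order[OF this]
  show "((G, \<sigma>), (G, \<tau>)) \<in> inv_image ({(y, x). y \<in> elts x}\<^sup>+) snd"
    unfolding inv_image_def by simp
qed

declare val.simps [simp del]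

lemma elts_val: "elts (val G \<tau>) = val G ` {\<sigma>. \<exists>p\<in>G. pair \<sigma> p \<in> elts \<tau>}"
proof -
  have "countable {\<sigma>. \<exists>p\<in>G. pair \<sigma> p \<in> elts \<tau>}"
  proof (rule countable_subset)
    show "{\<sigma>. \<exists>p\<in>G. pair \<sigma> p \<in> elts \<tau>} \<subseteq> (\<Union>x\<in>elts \<tau>. \<Union>y\<in>elts x. elts y)"
    proof
      fix \<sigma>
      assume "\<sigma> \<in> {\<sigma>. \<exists>p\<in>G. pair \<sigma> p \<in> elts \<tau>}"
      then obtain p where "pair \<sigma> p \<in> elts \<tau>"
        by blast
      moreover have "vset {\<sigma>} \<in> elts (pair \<sigma> p)" "\<sigma> \<in> elts (vset {\<sigma>})"
        by (simp_all add: pair_def)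
      ultimately show "\<sigma> \<in> (\<Union>x\<in>elts \<tau>. \<Union>y\<in>elts x. elts y)"
        by blast
    qed
    show "countable (\<Union>x\<in>elts \<tau>. \<Union>y\<in>elts x. elts y)"
      by (intro countable_UN countable_elts)
  qed
  then show ?thesis
    by (simp only: val.simps[of G \<tau>] elts_vset countable_image)
qed

definition gen_ext :: "V set \<Rightarrow> V set \<Rightarrow> V set \<Rightarrow> V set" where
  "gen_ext M P G = val G ` {\<tau> \<in> M. is_name P \<tau>}"

definition Cohen_extension :: "V set \<Rightarrow> V set \<Rightarrow> bool" where
  "Cohen_extension M N \<longleftrightarrow>
     (\<exists>\<kappa> G. infinite_cardinal_in M \<kappa> \<and> generic_over M (Fn2 \<kappa>) rev_incl G \<and>
        N = gen_ext M (Fn2 \<kappa>) G)"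

section \<open>Almost disjoint families\<close>

definition almost_disjoint_family :: "V \<Rightarrow> bool" where
  "almost_disjoint_family A \<longleftrightarrow>
     infinite (elts A) \<and>
     (\<forall>a\<in>elts A. elts a \<subseteq> elts omega \<and> infinite (elts a)) \<and>
     (\<forall>a\<in>elts A. \<forall>b\<in>elts A. a \<noteq> b \<longrightarrow> finite (elts a \<inter> elts b))"

definition MAD_in :: "V set \<Rightarrow> V \<Rightarrow> bool" where
  "MAD_in N A \<longleftrightarrow>
     A \<in> N \<and> almost_disjoint_family A \<and>
     (\<forall>B\<in>N. almost_disjoint_family B \<and> elts A \<subseteq> elts B \<longrightarrow> B = A)"

definition Cohen_indestructible_MAD :: "V set \<Rightarrow> V \<Rightarrow> bool" where
  "Cohen_indestructible_MAD M A \<longleftrightarrow> (\<forall>N. Cohen_extension M N \<longrightarrow> MAD_in N A)"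

section \<open>Topological spaces inside a model\<close>

text \<open>
  A topological space of \<open>N\<close> is given by its set \<open>X\<close> of points and the class \<open>T\<close> of those
  members of \<open>N\<close> that are its open sets. Points of \<open>\<Psi>(A)\<close> are literally the elements of
  \<open>A \<union> \<omega>\<close>: the union is disjoint since natural numbers are finite sets.
\<close>

definition Psi_points :: "V \<Rightarrow> V set" where
  "Psi_points A = elts A \<union> elts omega"

definition Psi_opens :: "V set \<Rightarrow> V \<Rightarrow> V set" where
  "Psi_opens N A = {U \<in> N. elts U \<subseteq> Psi_points A \<and>
     (\<forall>a\<in>elts A \<inter> elts U. \<exists>n\<in>elts omega. insert a (elts a - elts n) \<subseteq> elts U)}"

definition CL_points :: "V set \<Rightarrow> V set \<Rightarrow> V set \<Rightarrow> V set" where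
  "CL_points N X T =
     {F \<in> N. elts F \<noteq> {} \<and> elts F \<subseteq> X \<and> (\<exists>U\<in>T. elts U = X - elts F)}"

definition Vietoris_basic :: "V set \<Rightarrow> V set \<Rightarrow> V set \<Rightarrow> V set \<Rightarrow> V set" where
  "Vietoris_basic N X T \<U> =
     {F \<in> CL_points N X T. elts F \<subseteq> (\<Union>U\<in>\<U>. elts U) \<and> (\<forall>U\<in>\<U>. elts F \<inter> elts U \<noteq> {})}"

text \<open>Finite subsets of a transitive model belong to it, so \<open>\<U>\<close> need not be relativised.\<close>

definition Vietoris_opens :: "V set \<Rightarrow> V set \<Rightarrow> V set \<Rightarrow> V set" where
  "Vietoris_opens N X T = {W \<in> N. elts W \<subseteq> CL_points N X T \<and>
     (\<forall>F\<in>elts W. \<exists>\<U>. finite \<U> \<and> \<U> \<noteq> {} \<and> \<U> \<subseteq> T \<and>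
        F \<in> Vietoris_basic N X T \<U> \<and> Vietoris_basic N X T \<U> \<subseteq> elts W)}"

text \<open>
  Reals are coded as lower Dedekind cuts of rationals, rationals as reduced fractions. The coding of
  rationals and the property of being a cut are absolute, so the real line of \<open>N\<close> consists of the
  reals whose code belongs to \<open>N\<close>. It contains the rationals, hence its open sets in the sense of
  \<open>N\<close> are its relatively open subsets (with respect to the usual topology) that belong to \<open>N\<close>.
\<close>

definition int_code :: "int \<Rightarrow> V" where
  "int_code i = pair (nat_code (if i < 0 then 1 else 0)) (nat_code (nat \<bar>i\<bar>))"

definition rat_code :: "rat \<Rightarrow> V" where
  "rat_code q = pair (int_code (fst (quotient_of q))) (int_code (snd (quotient_of q)))"

definition real_code :: "real \<Rightarrow> V" where
  "real_code r = vset (rat_code ` {q. real_of_rat q < r})"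

definition reals_in :: "V set \<Rightarrow> real set" where
  "reals_in N = {r. real_code r \<in> N}"

definition real_open_in :: "V set \<Rightarrow> real set \<Rightarrow> bool" where
  "real_open_in N S \<longleftrightarrow>
     (\<exists>S'. open S' \<and> S = S' \<inter> reals_in N) \<and> (\<exists>s\<in>N. elts s = real_code ` S)"

definition continuous_real_in :: "V set \<Rightarrow> V set \<Rightarrow> V set \<Rightarrow> (V \<Rightarrow> real) \<Rightarrow> bool" where
  "continuous_real_in N X T g \<longleftrightarrow>
     fun_in N X (real_code \<circ> g) \<and> g ` X \<subseteq> reals_in N \<and>
     (\<forall>S. real_open_in N S \<longrightarrow> (\<exists>U\<in>T. elts U = {x \<in> X. g x \<in> S}))"

definition pseudocompact_in :: "V set \<Rightarrow> V set \<Rightarrow> V set \<Rightarrow> bool" where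
  "pseudocompact_in N X T \<longleftrightarrow>
     (\<forall>g. continuous_real_in N X T g \<longrightarrow> (\<exists>b. \<forall>x\<in>X. \<bar>g x\<bar> \<le> b))"

definition CL_Psi_pseudocompact_in :: "V set \<Rightarrow> V \<Rightarrow> bool" where
  "CL_Psi_pseudocompact_in N A \<longleftrightarrow>
     pseudocompact_in N
       (CL_points N (Psi_points A) (Psi_opens N A))
       (Vietoris_opens N (Psi_points A) (Psi_opens N A))"

end

(* By CH, the ground model M enumerates in type omega_1 the sequences of subsets of
   T0 = omega x Fin(omega). The sets A_beta are built by recursion so that each sequence Y enumerated
   up to beta is caught: if some Y_i contains, with first coordinate arbitrarily large, finite sets s
   that realize a given finite pattern (hit these tails of earlier sets, miss those) and have
   arbitrarily many points outside any finite union of such tails, then it also contains such an s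
   that moreover meets A_beta and has many points outside A_beta.

   A subset X of T0 in a Cohen extension N has a name supported by countably many coordinates, so
   that countably many supersets of X in M (what finite conditions do not exclude from X) decide
   whether X meets a given set of M. Hence X is caught by A_beta for all beta from some g on. Applied
   to the finite subsets of an infinite subset of omega this gives maximality in N.

   If a continuous g on CL(Psi(A)) in N were unbounded, take X = {(j,s) : |g(s)| >= j}, with s finite
   and nonempty. If X is big with respect to A_d, d < g, then decide greedily, for the countably many
   tails of these sets and singletons, which ones to hit; the hit ones together with all later
   A_beta form a closed set F, and every neighbourhood of F contains some s with (j,s) in X for
   arbitrarily large j. Otherwise X can be thinned out until all s lie in one finite union of members
   of A and of singletons, and the same construction works without the later A_beta. Continuity of g
   at F is contradicted. *)
theory Submission
  imports Defs
begin

section \<open>Definable predicates and functions of a transitive class\<close>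

text \<open>The obstacle is that the family lives in M and the hyperspace in an extension N, so each
  auxiliary set must be shown to belong to one of the two. Hence predicates and functions are
  treated as definable with parameters, by closure rules. In N little more than separation is
  available; other sets are taken over from M or described by finite approximations. Patterns
  consist of singletons and tails because these are the traces on \<omega> of the basic
  neighbourhoods in \<Psi>: a neighbourhood of F asks a finite set to meet finitely many of them and
  to avoid finitely many others. The many points outside a finite union make catching repeatable: a
  caught s meets the new set and still has points left for the next one. So a pattern realizable at
  one stage stays realizable at all later ones, although each set is built with regard to earlier
  sets only. Supersets of X in M are good enough since bigness passes to supersets, whereas the
  witnesses of catching form a set of M, and conditions on a countable support determine whether X
  can meet such a set.\<close>

text \<open>Outside the ordered pairs the projections are the identity. Thus \<open>vfst x\<close> always precedes
  the sets that have \<open>x\<close> as an element, which justifies recursion over names.\<close>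

definition vfst :: "V \<Rightarrow> V" where
  "vfst x = (if \<exists>a b. x = pair a b then THE a. \<exists>b. x = pair a b else x)"

definition vsnd :: "V \<Rightarrow> V" where
  "vsnd x = (if \<exists>a b. x = pair a b then THE b. \<exists>a. x = pair a b else x)"

lemma vfst_pair [simp]: "vfst (pair a b) = a"
  by (simp add: vfst_def)

lemma vsnd_pair [simp]: "vsnd (pair a b) = b"
  by (simp add: vsnd_def)

lemma V_eqI: "(\<And>z. z \<in> elts x \<longleftrightarrow> z \<in> elts y) \<Longrightarrow> x = y"
  by (auto simp: V_eq_iff)

definition vsep :: "V \<Rightarrow> (V \<Rightarrow> bool) \<Rightarrow> V" where
  "vsep a P = vset {y \<in> elts a. P y}"

lemma elts_vsep [simp]: "elts (vsep a P) = {y \<in> elts a. P y}"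
  unfolding vsep_def by (rule elts_vset) (rule countable_subset[of _ "elts a"], auto)

definition vins :: "V \<Rightarrow> V \<Rightarrow> V" where
  "vins x y = vset (insert x (elts y))"

lemma elts_vins [simp]: "elts (vins x y) = insert x (elts y)"
  by (simp add: vins_def)

abbreviation vempty :: V where "vempty \<equiv> vset {}"

lemma pair_vins: "pair a b = vins (vins a vempty) (vins (vins a (vins b vempty)) vempty)"
  by (simp add: pair_def vins_def)

text \<open>Application is total: where there is no value or no unique one, the default
  \<open>vempty\<close> keeps the result in every model that contains \<open>f\<close>.\<close>

definition vapp :: "V \<Rightarrow> V \<Rightarrow> V" where
  "vapp f x = (if \<exists>!y. pair x y \<in> elts f then THE y. pair x y \<in> elts f else vempty)"

primrec ren :: "(nat \<Rightarrow> nat) \<Rightarrow> fm \<Rightarrow> fm" where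
  "ren f (Mem i j) = Mem (f i) (f j)"
| "ren f (Eq i j) = Eq (f i) (f j)"
| "ren f (Neg \<phi>) = Neg (ren f \<phi>)"
| "ren f (Conj \<phi> \<psi>) = Conj (ren f \<phi>) (ren f \<psi>)"
| "ren f (All i \<phi>) = All (f i) (ren f \<phi>)"

text \<open>Bound variables are renamed along with the free ones, so injectivity prevents capture:
  updating the assignment at \<open>f i\<close> affects no other renamed variable.\<close>

lemma sat_ren: "inj f \<Longrightarrow> sat M e (ren f \<phi>) \<longleftrightarrow> sat M (e \<circ> f) \<phi>"
proof (induction \<phi> arbitrary: e)
  case (All i \<phi>)
  have "(e(f i := x)) \<circ> f = (e \<circ> f)(i := x)" for x
    using All.prems by (auto simp: fun_eq_iff inj_eq)
  with All show ?case by (simp only: ren.simps sat.simps)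
qed (auto simp: o_def)

text \<open>A generic extension enters the calculus of definability only through these closure
  properties, and through \<omega> in \<open>nmodel\<close>. Replacement, power set and choice come
  with \<open>zmodel\<close>, which is meant for the ground model.\<close>

locale omodel =
  fixes M :: "V set"
  assumes trans: "transitive_class M"
    and vempty_M [simp, intro]: "vempty \<in> M"
    and vins_M [simp, intro]: "x \<in> M \<Longrightarrow> y \<in> M \<Longrightarrow> vins x y \<in> M"
    and sep: "separation_in M"
begin

lemma mem_M: "y \<in> elts x \<Longrightarrow> x \<in> M \<Longrightarrow> y \<in> M"
  using trans unfolding transitive_class_def by blast

lemma elts_M: "x \<in> M \<Longrightarrow> elts x \<subseteq> M"
  using mem_M by blast

lemma pair_M [simp, intro]: "a \<in> M \<Longrightarrow> b \<in> M \<Longrightarrow> pair a b \<in> M"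
  unfolding pair_vins by (intro vins_M vempty_M)

lemma pair_MD: "pair a b \<in> M \<Longrightarrow> a \<in> M \<and> b \<in> M"
proof -
  assume p: "pair a b \<in> M"
  have "vset {a, b} \<in> elts (pair a b)" by (simp add: pair_def)
  with p have "vset {a, b} \<in> M" using mem_M by blast
  then show ?thesis using mem_M[of _ "vset {a,b}"] by simp
qed

lemma vfst_M [simp, intro]: "x \<in> M \<Longrightarrow> vfst x \<in> M"
  by (cases "\<exists>a b. x = pair a b") (auto dest: pair_MD simp: vfst_def)

lemma vsnd_M [simp, intro]: "x \<in> M \<Longrightarrow> vsnd x \<in> M"
  by (cases "\<exists>a b. x = pair a b") (auto dest: pair_MD simp: vsnd_def)

lemma vapp_M [simp, intro]:
  assumes f: "f \<in> M" shows "vapp f x \<in> M"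
proof (cases "\<exists>!y. pair x y \<in> elts f")
  case True
  then obtain y where y: "pair x y \<in> elts f" "vapp f x = y"
    unfolding vapp_def by (auto intro: the_equality)
  then show ?thesis using pair_MD[OF mem_M[OF y(1) f]] by simp
qed (simp add: vapp_def)

text \<open>Six variables are reserved for arguments; the others carry parameters.\<close>

definition dv :: "((nat \<Rightarrow> V) \<Rightarrow> bool) \<Rightarrow> bool" where
  "dv P \<longleftrightarrow> (\<exists>\<phi> e. range e \<subseteq> M \<and>
     (\<forall>a. range a \<subseteq> M \<longrightarrow> (P a \<longleftrightarrow> sat M (\<lambda>n. if n < 6 then a n else e n) \<phi>)))"

definition dfn :: "(V \<Rightarrow> bool) \<Rightarrow> bool" where
  "dfn P \<longleftrightarrow> dv (\<lambda>a. P (a 0))"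

text \<open>The class functions of M, with parameters. They are constrained only at arguments from
  M.\<close>

definition Fn :: "(V \<Rightarrow> V) \<Rightarrow> bool" where
  "Fn f \<longleftrightarrow> (\<forall>x\<in>M. f x \<in> M) \<and> dv (\<lambda>a. a 1 = f (a 0))"

lemma dvI:
  "range e \<subseteq> M \<Longrightarrow> (\<And>a. range a \<subseteq> M \<Longrightarrow> P a \<longleftrightarrow> sat M (\<lambda>n. if n < 6 then a n else e n) \<phi>) \<Longrightarrow> dv P"
  unfolding dv_def by blast

lemma dv_cong: "dv Q \<Longrightarrow> (\<And>a. range a \<subseteq> M \<Longrightarrow> P a \<longleftrightarrow> Q a) \<Longrightarrow> dv P"
  unfolding dv_def by simp

lemma dv_mem: "i < 6 \<Longrightarrow> j < 6 \<Longrightarrow> dv (\<lambda>a. a i \<in> elts (a j))"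
  by (rule dvI[of "\<lambda>_. vempty" _ "Mem i j"]) auto

lemma dv_eq: "i < 6 \<Longrightarrow> j < 6 \<Longrightarrow> dv (\<lambda>a. a i = a j)"
  by (rule dvI[of "\<lambda>_. vempty" _ "Eq i j"]) auto

lemma dv_const: "i < 6 \<Longrightarrow> c \<in> M \<Longrightarrow> dv (\<lambda>a. a i = c)"
  by (rule dvI[of "\<lambda>_. c" _ "Eq i 6"]) auto

lemma dv_neg: "dv P \<Longrightarrow> dv (\<lambda>a. \<not> P a)"
  unfolding dv_def by (metis sat.simps(3))

lemma dv_conj:
  assumes "dv P" "dv Q" shows "dv (\<lambda>a. P a \<and> Q a)"
proof -
  obtain \<phi> e where 1: "range e \<subseteq> M"
    "\<And>a. range a \<subseteq> M \<Longrightarrow> P a \<longleftrightarrow> sat M (\<lambda>n. if n < 6 then a n else e n) \<phi>"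
    using assms(1) unfolding dv_def by blast
  obtain \<psi> d where 2: "range d \<subseteq> M"
    "\<And>a. range a \<subseteq> M \<Longrightarrow> Q a \<longleftrightarrow> sat M (\<lambda>n. if n < 6 then a n else d n) \<psi>"
    using assms(2) unfolding dv_def by blast
  \<comment> \<open>The parameter slots of the two formulas are interleaved, those of \<phi> going
    to even and those of \<psi> to odd positions, while the six argument slots stay fixed.\<close>
  define f where "f n = (if n < 6 then n else 2 * n - 6)" for n :: nat
  define g where "g n = (if n < 6 then n else 2 * n - 5)" for n :: nat
  define u where "u n = (if even n then e ((n + 6) div 2) else d ((n + 5) div 2))" for n
  have f: "inj f" unfolding f_def inj_def by auto
  have g: "inj g" unfolding g_def inj_def by (auto split: if_splits)
  show ?thesis
  proof (rule dvI[of u _ "Conj (ren f \<phi>) (ren g \<psi>)"])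
    show "range u \<subseteq> M" using 1(1) 2(1) by (auto simp: u_def)
    fix a :: "nat \<Rightarrow> V" assume a: "range a \<subseteq> M"
    have "(\<lambda>n. if n < 6 then a n else u n) \<circ> f = (\<lambda>n. if n < 6 then a n else e n)"
      by (auto simp: fun_eq_iff f_def u_def)
    moreover have "(\<lambda>n. if n < 6 then a n else u n) \<circ> g = (\<lambda>n. if n < 6 then a n else d n)"
      by (auto simp: fun_eq_iff g_def u_def elim!: evenE)
    ultimately show "P a \<and> Q a \<longleftrightarrow>
        sat M (\<lambda>n. if n < 6 then a n else u n) (Conj (ren f \<phi>) (ren g \<psi>))"
      using 1(2) 2(2) a f g by (simp add: sat_ren)
  qed
qed

lemma dv_ex:
  assumes "i < 6" "dv P" shows "dv (\<lambda>a. \<exists>x\<in>M. P (a(i := x)))"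
proof -
  obtain \<phi> e where 1: "range e \<subseteq> M"
    "\<And>a. range a \<subseteq> M \<Longrightarrow> P a \<longleftrightarrow> sat M (\<lambda>n. if n < 6 then a n else e n) \<phi>"
    using assms(2) unfolding dv_def by blast
  show ?thesis
  proof (rule dvI[of e _ "Neg (All i (Neg \<phi>))"])
    fix a :: "nat \<Rightarrow> V" assume a: "range a \<subseteq> M"
    have "(\<lambda>n. if n < 6 then (a(i := x)) n else e n) = (\<lambda>n. if n < 6 then a n else e n)(i := x)" for x
      using assms(1) by auto
    moreover have "range (a(i := x)) \<subseteq> M" if "x \<in> M" for x using a that by auto
    ultimately show "(\<exists>x\<in>M. P (a(i := x))) \<longleftrightarrow>
        sat M (\<lambda>n. if n < 6 then a n else e n) (Neg (All i (Neg \<phi>)))"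
      using 1(2) by simp
  qed (fact 1(1))
qed

lemma dv_all:
  assumes "i < 6" "dv P" shows "dv (\<lambda>a. \<forall>x\<in>M. P (a(i := x)))"
  using dv_neg[OF dv_ex[OF assms(1) dv_neg[OF assms(2)]]] by (rule dv_cong) auto

lemma dv_iff: assumes "dv P" "dv Q" shows "dv (\<lambda>a. P a \<longleftrightarrow> Q a)"
  using dv_conj[OF dv_neg[OF dv_conj[OF assms(1) dv_neg[OF assms(2)]]]
      dv_neg[OF dv_conj[OF assms(2) dv_neg[OF assms(1)]]]]
  by (rule dv_cong) auto

lemma dv_disj: assumes "dv P" "dv Q" shows "dv (\<lambda>a. P a \<or> Q a)"
  using dv_neg[OF dv_conj[OF dv_neg[OF assms(1)] dv_neg[OF assms(2)]]] by (rule dv_cong) auto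

lemma dv_swap:
  assumes "i < 6" "j < 6" "dv P" shows "dv (\<lambda>a. P (a(i := a j, j := a i)))"
proof -
  define h where "h n = (if n = i then j else if n = j then i else n)" for n
  have h: "inj h" by (auto simp: inj_def h_def split: if_splits)
  obtain \<phi> e where 1: "range e \<subseteq> M"
    "\<And>a. range a \<subseteq> M \<Longrightarrow> P a \<longleftrightarrow> sat M (\<lambda>n. if n < 6 then a n else e n) \<phi>"
    using assms(3) unfolding dv_def by blast
  show ?thesis
  proof (rule dvI[of e _ "ren h \<phi>"])
    fix a :: "nat \<Rightarrow> V" assume a: "range a \<subseteq> M"
    have "(\<lambda>n. if n < 6 then a n else e n) \<circ> h =
        (\<lambda>n. if n < 6 then (a(i := a j, j := a i)) n else e n)"
      using assms(1,2) by (auto simp: h_def fun_eq_iff)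
    moreover have "range (a(i := a j, j := a i)) \<subseteq> M" using a by auto
    ultimately show "P (a(i := a j, j := a i)) \<longleftrightarrow> sat M (\<lambda>n. if n < 6 then a n else e n) (ren h \<phi>)"
      using 1(2) by (simp only: sat_ren[OF h])
  qed (fact 1(1))
qed

lemma dv_dfn: "dfn P \<Longrightarrow> i < 6 \<Longrightarrow> dv (\<lambda>a. P (a i))"
  using dv_swap[of 0 i "\<lambda>a. P (a 0)"] by (cases "i = 0") (simp_all add: dfn_def)

lemma dv_Fn0: "Fn f \<Longrightarrow> 0 < i \<Longrightarrow> i < 6 \<Longrightarrow> dv (\<lambda>a. a i = f (a 0))"
  using dv_swap[of 1 i "\<lambda>a. a 1 = f (a 0)"] by (cases "i = 1") (simp_all add: Fn_def)

lemma dv_set_eq: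
  assumes "i < 5" "dv (\<lambda>a. Q a (a 5))" "\<And>a x. Q (a(5 := x)) x \<longleftrightarrow> Q a x"
  shows "dv (\<lambda>a. \<forall>x\<in>M. x \<in> elts (a i) \<longleftrightarrow> Q a x)"
  using dv_all[OF _ dv_iff[OF dv_mem[of 5 i] assms(2)], of 5] assms(1)
  by (rule_tac dv_cong) (auto simp: assms(3))

text \<open>Slots 4 and 5 are the bound variables in the unfolding of the Kuratowski pair, hence the
  arguments must stay below 4.\<close>

lemma dv_pair:
  assumes "i < 4" "j < 4" "k < 4" shows "dv (\<lambda>a. a i = pair (a j) (a k))"
proof -
  have 1: "dv (\<lambda>a. \<forall>v\<in>M. v \<in> elts (a 4) \<longleftrightarrow> v = a j)"
    using dv_set_eq[of 4 "\<lambda>a v. v = a j", OF _ dv_eq[of 5 j]] assms by simp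
  have 2: "dv (\<lambda>a. \<forall>v\<in>M. v \<in> elts (a 4) \<longleftrightarrow> v = a j \<or> v = a k)"
    using dv_set_eq[of 4 "\<lambda>a v. v = a j \<or> v = a k", OF _ dv_disj[OF dv_eq[of 5 j] dv_eq[of 5 k]]] assms
    by simp
  have "dv (\<lambda>a. \<forall>w\<in>M. w \<in> elts (a i) \<longleftrightarrow>
     (\<forall>v\<in>M. v \<in> elts w \<longleftrightarrow> v = a j) \<or> (\<forall>v\<in>M. v \<in> elts w \<longleftrightarrow> v = a j \<or> v = a k))"
    using dv_all[OF _ dv_iff[OF dv_mem[of 4 i] dv_disj[OF 1 2]], of 4] assms by simp
  then show ?thesis
  proof (rule dv_cong)
    fix a :: "nat \<Rightarrow> V" assume "range a \<subseteq> M"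
    then have a: "a n \<in> M" for n by auto
    have s: "(\<forall>v\<in>M. v \<in> elts w \<longleftrightarrow> v \<in> X) \<longleftrightarrow> w = vset X" if "w \<in> M" "finite X" "X \<subseteq> M" for w X
      using that mem_M[of _ w] by (auto simp: V_eq_iff countable_finite)
    have *: "(\<forall>v\<in>M. v \<in> elts w \<longleftrightarrow> v = a j) \<longleftrightarrow> w = vset {a j}"
       "(\<forall>v\<in>M. v \<in> elts w \<longleftrightarrow> v = a j \<or> v = a k) \<longleftrightarrow> w = vset {a j, a k}" if "w \<in> M" for w
      using s[OF that, of "{a j}"] s[OF that, of "{a j, a k}"] a by auto
    have m: "vset {a j} \<in> M" "vset {a j, a k} \<in> M"
      using vins_M[OF a[of j] vempty_M] vins_M[OF a[of j] vins_M[OF a[of k] vempty_M]]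
      by (simp_all add: vins_def)
    have "a i = pair (a j) (a k) \<longleftrightarrow> (\<forall>w\<in>M. w \<in> elts (a i) \<longleftrightarrow> w = vset {a j} \<or> w = vset {a j, a k})"
      using m s[OF a[of i], of "{vset {a j}, vset {a j, a k}}"] by (auto simp: pair_def)
    then show "a i = pair (a j) (a k) \<longleftrightarrow> (\<forall>w\<in>M. w \<in> elts (a i) \<longleftrightarrow>
     (\<forall>v\<in>M. v \<in> elts w \<longleftrightarrow> v = a j) \<or> (\<forall>v\<in>M. v \<in> elts w \<longleftrightarrow> v = a j \<or> v = a k))"
      using * by simp
  qed
qed

subsection \<open>Closure rules\<close>

named_theorems dfn_intros

lemma dfn_cong: "dfn Q \<Longrightarrow> (\<And>x. x \<in> M \<Longrightarrow> P x \<longleftrightarrow> Q x) \<Longrightarrow> dfn P"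
  unfolding dfn_def by (erule dv_cong) auto

lemma Fn_cong: assumes "Fn g" "\<And>x. x \<in> M \<Longrightarrow> f x = g x" shows "Fn f"
proof -
  have "dv (\<lambda>a. a 1 = f (a 0))"
    by (rule dv_cong[of "\<lambda>a. a 1 = g (a 0)"]) (use assms in \<open>auto simp: Fn_def image_subset_iff\<close>)
  with assms show ?thesis by (simp add: Fn_def)
qed

lemma FnD: "Fn f \<Longrightarrow> x \<in> M \<Longrightarrow> f x \<in> M"
  by (simp add: Fn_def)

lemma dfn_neg [dfn_intros]: "dfn P \<Longrightarrow> dfn (\<lambda>x. \<not> P x)"
  unfolding dfn_def by (rule dv_neg)

lemma dfn_conj [dfn_intros]: "dfn P \<Longrightarrow> dfn Q \<Longrightarrow> dfn (\<lambda>x. P x \<and> Q x)"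
  unfolding dfn_def by (rule dv_conj)

lemma dfn_disj [dfn_intros]: "dfn P \<Longrightarrow> dfn Q \<Longrightarrow> dfn (\<lambda>x. P x \<or> Q x)"
  unfolding dfn_def by (rule dv_disj)

lemma dfn_iff [dfn_intros]: "dfn P \<Longrightarrow> dfn Q \<Longrightarrow> dfn (\<lambda>x. P x \<longleftrightarrow> Q x)"
  unfolding dfn_def by (rule dv_iff)

lemma dfn_imp [dfn_intros]: "dfn P \<Longrightarrow> dfn Q \<Longrightarrow> dfn (\<lambda>x. P x \<longrightarrow> Q x)"
  by (rule dfn_cong[OF dfn_disj[OF dfn_neg[of P], of Q]]) auto

lemma dfn_comp: assumes "dfn P" "Fn f" shows "dfn (\<lambda>x. P (f x))"
  unfolding dfn_def
  by (rule dv_cong[OF dv_ex[of 1, OF _ dv_conj[OF dv_Fn0[OF assms(2), of 1] dv_dfn[OF assms(1), of 1]]]])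
     (auto intro: FnD[OF assms(2)])

lemma Fn_comp: assumes "Fn f" "Fn g" shows "Fn (\<lambda>x. f (g x))"
  unfolding Fn_def
proof (intro conjI ballI)
  have 1: "dv (\<lambda>a. a 1 = f (a 2))"
    using dv_swap[of 0 2 "\<lambda>a. a 1 = f (a 0)"] assms(1) by (simp add: Fn_def)
  show "dv (\<lambda>a. a 1 = f (g (a 0)))"
    by (rule dv_cong[OF dv_ex[of 2, OF _ dv_conj[OF dv_Fn0[OF assms(2), of 2] 1]]])
       (auto intro: FnD[OF assms(2)])
qed (use assms FnD in auto)

lemma Fn_pair [dfn_intros]: assumes "Fn f" "Fn g" shows "Fn (\<lambda>x. pair (f x) (g x))"
  unfolding Fn_def
proof (intro conjI ballI)
  show "dv (\<lambda>a. a 1 = pair (f (a 0)) (g (a 0)))"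
    by (rule dv_cong[OF dv_ex[of 2, OF _ dv_ex[of 3, OF _ dv_conj[OF dv_Fn0[OF assms(1), of 2]
          dv_conj[OF dv_Fn0[OF assms(2), of 3] dv_pair[of 1 2 3]]]]]])
       (auto intro: FnD[OF assms(1)] FnD[OF assms(2)])
qed (use assms FnD in auto)

lemma Fn_id [dfn_intros]: "Fn (\<lambda>x. x)"
  unfolding Fn_def using dv_eq[of 1 0] by simp

lemma Fn_const [dfn_intros]: "c \<in> M \<Longrightarrow> Fn (\<lambda>x. c)"
  unfolding Fn_def using dv_const[of 1 c] by simp

lemma Fn_vfst0: "Fn vfst"
  unfolding Fn_def
proof (intro conjI ballI)
  have 1: "a 1 = vfst (a 0) \<longleftrightarrow> (\<exists>b\<in>M. a 0 = pair (a 1) b) \<or> \<not> (\<exists>b\<in>M. \<exists>c\<in>M. a 0 = pair b c) \<and> a 1 = a 0"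
    if "range a \<subseteq> M" for a
  proof (cases "\<exists>b c. a 0 = pair b c")
    case True
    then obtain b c where bc: "a 0 = pair b c" by blast
    then have "b \<in> M" "c \<in> M" using that pair_MD[of b c] by (metis rangeI subsetD)+
    then show ?thesis using bc by auto
  next
    case False
    then have "vfst (a 0) = a 0" by (auto simp: vfst_def)
    then show ?thesis using False by auto
  qed
  show "dv (\<lambda>a. a 1 = vfst (a 0))"
    by (rule dv_cong[OF dv_disj[OF dv_ex[of 2, OF _ dv_pair[of 0 1 2]] dv_conj[OF
          dv_neg[OF dv_ex[of 2, OF _ dv_ex[of 3, OF _ dv_pair[of 0 2 3]]]] dv_eq[of 1 0]]]])
       (simp_all add: 1 del: One_nat_def)
qed auto

lemma Fn_vsnd0: "Fn vsnd"
  unfolding Fn_def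
proof (intro conjI ballI)
  have 1: "a 1 = vsnd (a 0) \<longleftrightarrow> (\<exists>b\<in>M. a 0 = pair b (a 1)) \<or> \<not> (\<exists>b\<in>M. \<exists>c\<in>M. a 0 = pair b c) \<and> a 1 = a 0"
    if "range a \<subseteq> M" for a
  proof (cases "\<exists>b c. a 0 = pair b c")
    case True
    then obtain b c where bc: "a 0 = pair b c" by blast
    then have "b \<in> M" "c \<in> M" using that pair_MD[of b c] by (metis rangeI subsetD)+
    then show ?thesis using bc by auto
  next
    case False
    then have "vsnd (a 0) = a 0" by (auto simp: vsnd_def)
    then show ?thesis using False by auto
  qed
  show "dv (\<lambda>a. a 1 = vsnd (a 0))"
    by (rule dv_cong[OF dv_disj[OF dv_ex[of 2, OF _ dv_pair[of 0 2 1]] dv_conj[OF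
          dv_neg[OF dv_ex[of 2, OF _ dv_ex[of 3, OF _ dv_pair[of 0 2 3]]]] dv_eq[of 1 0]]]])
       (simp_all add: 1 del: One_nat_def)
qed auto

lemmas Fn_vfst [dfn_intros] = Fn_comp[OF Fn_vfst0]
lemmas Fn_vsnd [dfn_intros] = Fn_comp[OF Fn_vsnd0]

lemma dfn_mem [dfn_intros]: assumes "Fn f" "Fn g" shows "dfn (\<lambda>x. f x \<in> elts (g x))"
  unfolding dfn_def
  by (rule dv_cong[OF dv_ex[of 1, OF _ dv_ex[of 2, OF _ dv_conj[OF dv_Fn0[OF assms(1), of 1]
          dv_conj[OF dv_Fn0[OF assms(2), of 2] dv_mem[of 1 2]]]]]])
     (auto intro: FnD[OF assms(1)] FnD[OF assms(2)])

lemma dfn_eq [dfn_intros]: assumes "Fn f" "Fn g" shows "dfn (\<lambda>x. f x = g x)"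
  unfolding dfn_def
  by (rule dv_cong[OF dv_ex[of 1, OF _ dv_conj[OF dv_Fn0[OF assms(1), of 1] dv_Fn0[OF assms(2), of 1]]]])
     (auto intro: FnD[OF assms(1)] FnD[OF assms(2)])

text \<open>A binary relation is read as a predicate of one ordered pair. With a single argument
  throughout, the closure rules descend under nested quantifiers without any bookkeeping of
  variables.\<close>

lemma dfn_ex [dfn_intros]:
  assumes "dfn (\<lambda>p. P (vfst p) (vsnd p))" shows "dfn (\<lambda>x. \<exists>y\<in>M. P x y)"
  unfolding dfn_def
  by (rule dv_cong[OF dv_ex[of 1, OF _ dv_ex[of 2, OF _ dv_conj[OF dv_pair[of 2 0 1] dv_dfn[OF assms, of 2]]]]]) auto

lemma dfn_all [dfn_intros]:
  assumes "dfn (\<lambda>p. P (vfst p) (vsnd p))" shows "dfn (\<lambda>x. \<forall>y\<in>M. P x y)"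
  using dfn_neg[OF dfn_ex[of "\<lambda>x y. \<not> P x y"]] dfn_neg[OF assms] by simp

lemma dfn_ball [dfn_intros]:
  assumes f: "Fn f" and P: "dfn (\<lambda>p. P (vfst p) (vsnd p))" shows "dfn (\<lambda>x. \<forall>y\<in>elts (f x). P x y)"
proof -
  have "dfn (\<lambda>x. \<forall>y\<in>M. y \<in> elts (f x) \<longrightarrow> P x y)"
    by (intro dfn_intros P Fn_comp[OF f])
  then show ?thesis
    by (rule dfn_cong) (use mem_M FnD[OF f] in blast)
qed

lemma dfn_bex [dfn_intros]:
  assumes f: "Fn f" and P: "dfn (\<lambda>p. P (vfst p) (vsnd p))" shows "dfn (\<lambda>x. \<exists>y\<in>elts (f x). P x y)"
  using dfn_neg[OF dfn_ball[OF f, of "\<lambda>x y. \<not> P x y"]] dfn_neg[OF P] by simp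

lemma dfn_subset [dfn_intros]:
  assumes f: "Fn f" and g: "Fn g" shows "dfn (\<lambda>x. elts (f x) \<subseteq> elts (g x))"
proof -
  have "dfn (\<lambda>x. \<forall>y\<in>elts (f x). y \<in> elts (g x))"
    by (intro dfn_intros Fn_comp[OF f] Fn_comp[OF g])
  then show ?thesis by (simp add: subset_eq)
qed

lemma FnI: "(\<And>x. x \<in> M \<Longrightarrow> f x \<in> M) \<Longrightarrow> dfn (\<lambda>p. vsnd p = f (vfst p)) \<Longrightarrow> Fn f"
  unfolding Fn_def
  by (intro conjI ballI, simp, rule dv_cong[OF dv_ex[of 2, OF _ dv_conj[OF dv_pair[of 2 0 1] dv_dfn[of _ 2]]]])
     (auto simp: image_subset_iff)

text \<open>By transitivity a value has all its elements in M, so extensionality, quantified over M,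
  recovers the graph of \<open>f\<close> from its membership relation.\<close>

lemma FnI_mem:
  assumes "\<And>x. x \<in> M \<Longrightarrow> f x \<in> M" "dfn (\<lambda>p. vsnd p \<in> elts (f (vfst p)))" shows "Fn f"
proof (rule FnI[OF assms(1)])
  have "dfn (\<lambda>p. \<forall>w\<in>M. w \<in> elts (vsnd p) \<longleftrightarrow> w \<in> elts (f (vfst p)))"
    by (intro dfn_intros dfn_comp[OF assms(2), of "\<lambda>q. pair (vfst (vfst q)) (vsnd q)", simplified])
  then show "dfn (\<lambda>p. vsnd p = f (vfst p))"
  proof (rule dfn_cong)
    fix p assume p: "p \<in> M"
    have "elts (vsnd p) \<subseteq> M" "elts (f (vfst p)) \<subseteq> M"
      using p assms(1) by (intro elts_M; simp)+
    then show "vsnd p = f (vfst p) \<longleftrightarrow> (\<forall>w\<in>M. w \<in> elts (vsnd p) \<longleftrightarrow> w \<in> elts (f (vfst p)))"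
      unfolding V_eq_iff by blast
  qed
qed

lemma dfn_if [dfn_intros]: "dfn P \<Longrightarrow> dfn Q \<Longrightarrow> dfn R \<Longrightarrow> dfn (\<lambda>x. if P x then Q x else R x)"
  unfolding if_bool_eq_conj by (intro dfn_intros)

lemma Fn_if [dfn_intros]:
  assumes "dfn P" "Fn f" "Fn g" shows "Fn (\<lambda>x. if P x then f x else g x)"
proof (rule FnI)
  have "dfn (\<lambda>p. if P (vfst p) then vsnd p = f (vfst p) else vsnd p = g (vfst p))"
    by (intro dfn_intros dfn_comp[OF assms(1)] Fn_comp[OF assms(2)] Fn_comp[OF assms(3)])
  then show "dfn (\<lambda>p. vsnd p = (if P (vfst p) then f (vfst p) else g (vfst p)))"
    by (rule dfn_cong) auto
qed (use assms FnD in auto)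

lemma vsep_M [intro]: assumes "a \<in> M" "dfn P" shows "vsep a P \<in> M"
proof -
  obtain \<phi> e where 1: "range e \<subseteq> M"
    "\<And>a. range a \<subseteq> M \<Longrightarrow> P (a 0) \<longleftrightarrow> sat M (\<lambda>n. if n < 6 then a n else e n) \<phi>"
    using assms(2) unfolding dfn_def dv_def by blast
  obtain b where b: "b \<in> M" "\<And>x. x \<in> M \<Longrightarrow> x \<in> elts b \<longleftrightarrow> x \<in> elts a \<and> sat M (e(0 := x)) \<phi>"
    using sep[unfolded separation_in_def, rule_format, OF 1(1) assms(1)] by blast
  have "P x \<longleftrightarrow> sat M (e(0 := x)) \<phi>" if "x \<in> M" for x
  proof -
    \<comment> \<open>The argument slots 1 to 5 are filled from \<open>e\<close>, which is harmless
      because the predicate looks at slot 0 only.\<close>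
    have "(\<lambda>n. if n < 6 then (e(0 := x)) n else e n) = e(0 := x)" by (auto simp: fun_eq_iff)
    moreover have "range (e(0 := x)) \<subseteq> M" using 1(1) that by auto
    ultimately show ?thesis using 1(2)[of "e(0 := x)"] by simp
  qed
  then have "b = vsep a P"
    using b mem_M[of _ a] mem_M[of _ b] assms(1) by (intro V_eqI) auto
  with b show ?thesis by simp
qed

lemma Fn_vsep [dfn_intros]:
  assumes f: "Fn f" and P: "dfn (\<lambda>p. P (vfst p) (vsnd p))" shows "Fn (\<lambda>x. vsep (f x) (P x))"
proof (rule FnI_mem)
  fix x assume x: "x \<in> M"
  have "dfn (P x)"
    using dfn_comp[OF P Fn_pair[OF Fn_const[OF x] Fn_id]] by simp
  then show "vsep (f x) (P x) \<in> M" using FnD[OF f x] by blast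
qed (use P in \<open>auto intro!: dfn_intros Fn_comp[OF f]\<close>)

lemma Fn_vins [dfn_intros]: "Fn f \<Longrightarrow> Fn g \<Longrightarrow> Fn (\<lambda>x. vins (f x) (g x))"
  by (rule FnI_mem) (auto intro!: dfn_intros dest: FnD intro: Fn_comp[of f] Fn_comp[of g])

lemma Fn_vapp [dfn_intros]: assumes f: "Fn f" and g: "Fn g" shows "Fn (\<lambda>x. vapp (f x) (g x))"
proof (rule FnI)
  have "dfn (\<lambda>p. if (\<exists>y\<in>M. pair (g (vfst p)) y \<in> elts (f (vfst p)) \<and>
       (\<forall>z\<in>M. pair (g (vfst p)) z \<in> elts (f (vfst p)) \<longrightarrow> z = y)) then
      pair (g (vfst p)) (vsnd p) \<in> elts (f (vfst p)) else vsnd p = vempty)"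
    by (intro dfn_intros Fn_comp[OF f] Fn_comp[OF g]) simp
  then show "dfn (\<lambda>p. vsnd p = vapp (f (vfst p)) (g (vfst p)))"
  proof (rule dfn_cong)
    fix p assume "p \<in> M"
    then have m: "y \<in> M" if "pair (g (vfst p)) y \<in> elts (f (vfst p))" for y
      using that mem_M[OF that FnD[OF f vfst_M]] pair_MD by blast
    then have e: "(\<exists>y\<in>M. pair (g (vfst p)) y \<in> elts (f (vfst p)) \<and>
       (\<forall>z\<in>M. pair (g (vfst p)) z \<in> elts (f (vfst p)) \<longrightarrow> z = y)) \<longleftrightarrow>
       (\<exists>!y. pair (g (vfst p)) y \<in> elts (f (vfst p)))"
      by blast
    show "vsnd p = vapp (f (vfst p)) (g (vfst p)) \<longleftrightarrow> (if (\<exists>y\<in>M. pair (g (vfst p)) y \<in> elts (f (vfst p)) \<and>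
       (\<forall>z\<in>M. pair (g (vfst p)) z \<in> elts (f (vfst p)) \<longrightarrow> z = y)) then
      pair (g (vfst p)) (vsnd p) \<in> elts (f (vfst p)) else vsnd p = vempty)"
      unfolding e vapp_def by (smt (verit, best) the_equality)
  qed
qed (use f FnD in auto)

lemma finite_M: "finite X \<Longrightarrow> X \<subseteq> M \<Longrightarrow> vset X \<in> M"
proof (induction rule: finite_induct)
  case (insert x X)
  then have "vins x (vset X) \<in> M" by auto
  with insert show ?case by (simp add: vins_def countable_finite)
qed auto

end

section \<open>Natural numbers and finite sets\<close>

lemma mem_irrefl [simp]: "x \<notin> elts x"
  by (induction x rule: V_induct) blast

lemma elts_nat_code: "elts (nat_code n) = nat_code ` {..<n}"
  by (induction n) (simp_all add: lessThan_Suc)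

lemma nat_code_less: "m < n \<Longrightarrow> nat_code m \<in> elts (nat_code n)"
  by (auto simp: elts_nat_code)

lemma nat_code_eq_iff [simp]: "nat_code m = nat_code n \<longleftrightarrow> m = n"
  by (metis mem_irrefl nat_code_less nat_neq_iff)

lemma inj_nat_code: "inj nat_code"
  by (simp add: inj_def)

lemma nat_code_mem_iff [simp]: "nat_code m \<in> elts (nat_code n) \<longleftrightarrow> m < n"
  by (auto simp: elts_nat_code)

lemma nat_code_subset_iff [simp]: "elts (nat_code m) \<subseteq> elts (nat_code n) \<longleftrightarrow> m \<le> n"
  by (auto simp: elts_nat_code image_subset_iff)

lemma elts_omega: "elts omega = range nat_code"
  by (simp add: omega_def)

lemma nat_code_omega [simp]: "nat_code n \<in> elts omega"
  by (simp add: elts_omega)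

lemma nat_code_Suc_vins: "nat_code (Suc n) = vins (nat_code n) (nat_code n)"
  by (simp add: vins_def)

lemma finite_nat_code [simp]: "finite (elts (nat_code n))"
  by (simp add: elts_nat_code)

lemma card_nat_code [simp]: "card (elts (nat_code n)) = n"
  by (simp add: elts_nat_code card_image inj_on_def)

declare nat_code.simps(2) [simp del]

lemma vempty_nat_code: "vempty = nat_code 0" by simp

lemma vempty_omega [simp]: "vempty \<in> elts omega"
  unfolding vempty_nat_code by (rule nat_code_omega)

text \<open>At least \<open>j\<close> elements, as an existence statement. Finiteness and the
  cardinality of finite sets are expressed through it, so that one definability proof covers all
  three.\<close>

definition natle :: "V \<Rightarrow> V \<Rightarrow> bool" where
  "natle j x \<longleftrightarrow> j \<in> elts omega \<and> (\<exists>h. inj_on h (elts j) \<and> h ` elts j \<subseteq> elts x)"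

lemma natle_iff: "natle (nat_code n) x \<longleftrightarrow> infinite (elts x) \<or> n \<le> card (elts x)"
proof
  assume "natle (nat_code n) x"
  then obtain h where h: "inj_on h (elts (nat_code n))" "h ` elts (nat_code n) \<subseteq> elts x"
    by (auto simp: natle_def)
  then show "infinite (elts x) \<or> n \<le> card (elts x)"
    using card_inj_on_le[OF h] by auto
next
  assume "infinite (elts x) \<or> n \<le> card (elts x)"
  then obtain X where X: "X \<subseteq> elts x" "finite X" "card X = n"
    by (metis infinite_arbitrarily_large obtain_subset_with_card_n)
  then obtain h where "bij_betw h (elts (nat_code n)) X"
    using finite_same_card_bij[of "elts (nat_code n)" X] by auto
  with X show "natle (nat_code n) x"
    unfolding natle_def bij_betw_def by auto
qed

lemma finite_natle: "finite (elts x) \<longleftrightarrow> (\<exists>n\<in>elts omega. \<not> natle n x)"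
  by (auto simp: elts_omega natle_iff not_le)

definition vcard :: "V \<Rightarrow> V \<Rightarrow> bool" where
  "vcard n x \<longleftrightarrow> finite (elts x) \<and> n = nat_code (card (elts x))"

lemma vcard_natle: "vcard n x \<longleftrightarrow> natle n x \<and> \<not> natle (vins n n) x"
proof
  assume "vcard n x"
  then show "natle n x \<and> \<not> natle (vins n n) x"
    by (auto simp: vcard_def natle_iff simp flip: nat_code_Suc_vins)
next
  assume n: "natle n x \<and> \<not> natle (vins n n) x"
  then obtain m where "n = nat_code m" by (auto simp: natle_def elts_omega)
  with n show "vcard n x"
    by (auto simp: vcard_def natle_iff simp flip: nat_code_Suc_vins)
qed

definition vUn :: "V \<Rightarrow> V" where
  "vUn x = vset (\<Union> (elts ` elts x))"

lemma elts_vUn [simp]: "elts (vUn x) = \<Union> (elts ` elts x)"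
  by (simp add: vUn_def)

definition vimg :: "(V \<Rightarrow> V) \<Rightarrow> V \<Rightarrow> V" where
  "vimg f x = vset (f ` elts x)"

lemma elts_vimg [simp]: "elts (vimg f x) = f ` elts x"
  by (simp add: vimg_def)

lemma vapp_vimg [simp]: "x \<in> elts a \<Longrightarrow> vapp (vimg (\<lambda>z. pair z (f z)) a) x = f x"
  unfolding vapp_def by (auto intro: the_equality)

definition vtimes :: "V \<Rightarrow> V \<Rightarrow> V" where
  "vtimes a b = vUn (vimg (\<lambda>x. vimg (pair x) b) a)"

lemma elts_vtimes: "elts (vtimes a b) = (\<lambda>(x, y). pair x y) ` (elts a \<times> elts b)"
  by (auto simp: vtimes_def)

lemma pair_vtimes [simp]: "pair x y \<in> elts (vtimes a b) \<longleftrightarrow> x \<in> elts a \<and> y \<in> elts b"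
  by (auto simp: elts_vtimes)

lemma vtimesE:
  assumes "u \<in> elts (vtimes a b)" obtains x y where "u = pair x y" "x \<in> elts a" "y \<in> elts b"
  using assms by (auto simp: elts_vtimes)

text \<open>There are only countably many finite subsets of a set of \<open>V\<close>, and they all
  belong to every model that contains \<open>x\<close>. So no relativization occurs here, in
  contrast to \<open>vPow\<close>.\<close>

definition vFin :: "V \<Rightarrow> V" where
  "vFin x = vset {z. finite (elts z) \<and> elts z \<subseteq> elts x}"

lemma elts_vFin [simp]: "elts (vFin x) = {z. finite (elts z) \<and> elts z \<subseteq> elts x}"
proof -
  have "{z. finite (elts z) \<and> elts z \<subseteq> elts x} \<subseteq> vset ` {X. finite X \<and> X \<subseteq> elts x}"
    by (metis (mono_tags, lifting) image_eqI mem_Collect_eq subsetI vset_elts)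
  then show ?thesis
    unfolding vFin_def
    by (intro elts_vset) (erule countable_subset, intro countable_image countable_Collect_finite_subset countable_elts)
qed

locale nmodel = omodel +
  assumes omega_M [simp, intro]: "omega \<in> M"
begin

lemma nat_code_M [simp, intro]: "nat_code n \<in> M"
  using mem_M[OF nat_code_omega omega_M] .

text \<open>An injection defined on a natural number has a finite graph, so nothing is lost by
  looking for it inside M.\<close>

lemma dfn_natle [dfn_intros]:
  assumes f: "Fn f" and g: "Fn g" shows "dfn (\<lambda>x. natle (f x) (g x))"
proof -
  have "dfn (\<lambda>x. f x \<in> elts omega \<and> (\<exists>h\<in>M. (\<forall>u\<in>elts (f x). \<exists>v\<in>elts (g x). pair u v \<in> elts h) \<and>
     (\<forall>u\<in>elts (f x). \<forall>u'\<in>elts (f x). \<forall>v\<in>elts (g x). pair u v \<in> elts h \<and> pair u' v \<in> elts h \<longrightarrow> u = u')))"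
    by (intro dfn_intros f Fn_comp[OF f] Fn_comp[OF g] omega_M)
  then show ?thesis
  proof (rule dfn_cong)
    fix x assume x: "x \<in> M"
    have "(\<exists>h. inj_on h (elts (f x)) \<and> h ` elts (f x) \<subseteq> elts (g x)) \<longleftrightarrow>
      (\<exists>h\<in>M. (\<forall>u\<in>elts (f x). \<exists>v\<in>elts (g x). pair u v \<in> elts h) \<and>
     (\<forall>u\<in>elts (f x). \<forall>u'\<in>elts (f x). \<forall>v\<in>elts (g x). pair u v \<in> elts h \<and> pair u' v \<in> elts h \<longrightarrow> u = u'))"
      (is "?L \<longleftrightarrow> ?R") if "f x \<in> elts omega"
    proof
      assume ?L
      then obtain h where h: "inj_on h (elts (f x))" "h ` elts (f x) \<subseteq> elts (g x)" by blast
      have "finite (elts (f x))" using that by (auto simp: elts_omega)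
      moreover have "elts (f x) \<subseteq> M" "elts (g x) \<subseteq> M" using FnD[OF f x] FnD[OF g x] elts_M by auto
      ultimately have *: "vset ((\<lambda>u. pair u (h u)) ` elts (f x)) \<in> M"
        using h(2) by (intro finite_M finite_imageI) (blast intro: pair_M)+
      have e: "elts (vset ((\<lambda>u. pair u (h u)) ` elts (f x))) = (\<lambda>u. pair u (h u)) ` elts (f x)"
        by simp
      show ?R
        by (rule bexI[OF _ *], unfold e) (use h in \<open>fastforce dest: inj_onD\<close>)
    next
      assume ?R
      then obtain k where k: "\<forall>u\<in>elts (f x). \<exists>v\<in>elts (g x). pair u v \<in> elts k"
        "\<forall>u\<in>elts (f x). \<forall>u'\<in>elts (f x). \<forall>v\<in>elts (g x). pair u v \<in> elts k \<and> pair u' v \<in> elts k \<longrightarrow> u = u'"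
        by blast
      from k(1) obtain h where "\<forall>u\<in>elts (f x). h u \<in> elts (g x) \<and> pair u (h u) \<in> elts k"
        by metis
      with k(2) show ?L
        by (intro exI[of _ h] conjI inj_onI) (metis, blast)
    qed
    then show "natle (f x) (g x) \<longleftrightarrow> f x \<in> elts omega \<and> (\<exists>h\<in>M. (\<forall>u\<in>elts (f x). \<exists>v\<in>elts (g x). pair u v \<in> elts h) \<and>
     (\<forall>u\<in>elts (f x). \<forall>u'\<in>elts (f x). \<forall>v\<in>elts (g x). pair u v \<in> elts h \<and> pair u' v \<in> elts h \<longrightarrow> u = u'))"
      by (auto simp: natle_def)
  qed
qed

lemma dfn_finite [dfn_intros]: assumes f: "Fn f" shows "dfn (\<lambda>x. finite (elts (f x)))"
  unfolding finite_natle by (intro dfn_intros Fn_comp[OF f] omega_M)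

lemma dfn_vcard [dfn_intros]: assumes f: "Fn f" and g: "Fn g" shows "dfn (\<lambda>x. vcard (f x) (g x))"
  unfolding vcard_natle by (intro dfn_intros f g)

end

section \<open>Transitive models of ZFC\<close>

locale zmodel =
  fixes M :: "V set"
  assumes trM: "transitive_class M" and zfc: "ZFC_in M"
begin

lemma mem_M0: "y \<in> elts x \<Longrightarrow> x \<in> M \<Longrightarrow> y \<in> M"
  using trM unfolding transitive_class_def by blast

lemma vempty_M0: "vempty \<in> M"
proof -
  obtain y where y: "y \<in> M" "\<forall>z\<in>M. z \<notin> elts y"
    using zfc unfolding ZFC_in_def infinity_in_def by blast
  then have "y = vempty" using mem_M0[of _ y] by (intro V_eqI) auto
  with y show ?thesis by simp
qed

lemma doubleton_M0: assumes "x \<in> M" "y \<in> M" shows "vset {x, y} \<in> M"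
proof -
  obtain z where z: "z \<in> M" "\<forall>w\<in>M. w \<in> elts z \<longleftrightarrow> w = x \<or> w = y"
    using zfc assms unfolding ZFC_in_def pairing_in_def by blast
  then have "z = vset {x, y}" using mem_M0[of _ z] assms
    by (intro V_eqI) (auto simp: countable_finite)
  with z show ?thesis by simp
qed

lemma vUn_M [simp, intro]: assumes "x \<in> M" shows "vUn x \<in> M"
proof -
  obtain u where u: "u \<in> M" "\<forall>z\<in>M. z \<in> elts u \<longleftrightarrow> (\<exists>y\<in>M. y \<in> elts x \<and> z \<in> elts y)"
    using zfc assms unfolding ZFC_in_def union_in_def by blast
  then have "u = vUn x" using mem_M0[of _ u] mem_M0[of _ x] mem_M0 assms
    by (intro V_eqI) (simp, blast)
  with u show ?thesis by simp
qed

sublocale omodel M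
proof
  show "vins x y \<in> M" if "x \<in> M" "y \<in> M" for x y
  proof -
    have "vins x y = vUn (vset {vset {x, x}, y})"
      by (rule V_eqI) (auto simp: countable_finite)
    then show ?thesis using that doubleton_M0 vUn_M by metis
  qed
qed (use zfc trM vempty_M0 in \<open>auto simp: ZFC_in_def\<close>)

text \<open>The least inductive set is separated from the one that infinity provides. If it
  contained a set \<open>w\<close> that is no numeral, one that is minimal for membership, removing
  \<open>w\<close> would leave an inductive set of M: \<open>w\<close> is not empty, and it is not a
  successor since its elements are numerals.\<close>

lemma omega_M0: "omega \<in> M"
proof -
  define ind where "ind I \<longleftrightarrow> vempty \<in> elts I \<and> (\<forall>y\<in>elts I. vins y y \<in> elts I)" for I
  obtain x where x: "x \<in> M" "\<exists>y\<in>M. y \<in> elts x \<and> (\<forall>z\<in>M. z \<notin> elts y)"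
    "\<forall>y\<in>M. y \<in> elts x \<longrightarrow> (\<exists>s\<in>M. s \<in> elts x \<and> (\<forall>z\<in>M. z \<in> elts s \<longleftrightarrow> z \<in> elts y \<or> z = y))"
    using zfc unfolding ZFC_in_def infinity_in_def by blast
  have "ind x"
    unfolding ind_def
  proof (intro conjI ballI)
    obtain y where y: "y \<in> M" "y \<in> elts x" "\<forall>z\<in>M. z \<notin> elts y" using x by blast
    then have "y = vempty" using mem_M[of _ y] by (intro V_eqI) auto
    with y show "vempty \<in> elts x" by simp
  next
    fix y assume y: "y \<in> elts x"
    with x(1) have yM: "y \<in> M" using mem_M by blast
    then obtain s where s: "s \<in> M" "s \<in> elts x" "\<forall>z\<in>M. z \<in> elts s \<longleftrightarrow> z \<in> elts y \<or> z = y"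
      using x(3) y by blast
    then have "s = vins y y" using mem_M[of _ s] mem_M[of _ y] yM by (intro V_eqI) auto
    with s show "vins y y \<in> elts x" by simp
  qed
  have di: "dfn ind" unfolding ind_def by (intro dfn_intros vempty_M)
  then have "dfn (\<lambda>n. \<forall>I\<in>M. ind I \<longrightarrow> n \<in> elts I)"
    by (intro dfn_intros dfn_comp[OF di])
  then have WM: "vsep x (\<lambda>n. \<forall>I\<in>M. ind I \<longrightarrow> n \<in> elts I) \<in> M" (is "?W \<in> M")
    using x(1) by blast
  have "nat_code n \<in> elts I" if "ind I" for n I
    using that by (induction n) (auto simp: ind_def nat_code_Suc_vins)
  with \<open>ind x\<close> have 1: "range nat_code \<subseteq> elts ?W" by auto
  have "w \<in> elts ?W \<Longrightarrow> w \<in> range nat_code" for w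
  proof (induction w rule: V_induct)
    case (elts w)
    show ?case
    proof (rule ccontr)
      assume w: "w \<notin> range nat_code"
      let ?I = "vsep ?W (\<lambda>y. y \<noteq> w)"
      have wM: "w \<in> M" using elts.prems WM mem_M by blast
      have IM: "?I \<in> M" by (rule vsep_M[OF WM]) (intro dfn_intros wM)
      have "ind ?I"
        unfolding ind_def[of ?I]
      proof (intro conjI ballI)
        show "vempty \<in> elts ?I"
          using 1 w by (metis (mono_tags, lifting) elts_vsep mem_Collect_eq nat_code.simps(1) rangeI subsetD)
      next
        fix y assume y: "y \<in> elts ?I"
        have "vins y y \<in> elts ?W" using y \<open>ind x\<close> by (auto simp: ind_def)
        moreover have "vins y y \<noteq> w"
        proof
          assume yw: "vins y y = w"
          then have "y \<in> elts w" by auto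
          then have "y \<in> range nat_code" using elts.IH y by auto
          then show False using yw w by (metis rangeE rangeI nat_code_Suc_vins)
        qed
        ultimately show "vins y y \<in> elts ?I" by simp
      qed
      with IM have "w \<in> elts ?I" using elts.prems by auto
      then show False by simp
    qed
  qed
  with 1 have "?W = omega" by (intro V_eqI) (auto simp: elts_omega)
  with WM show ?thesis by simp
qed

sublocale nmodel M
  by unfold_locales (rule omega_M0)

lemma vimg_M [intro]: assumes "Fn f" "a \<in> M" shows "vimg f a \<in> M"
proof -
  obtain \<phi> e where 1: "range e \<subseteq> M"
    "\<And>a. range a \<subseteq> M \<Longrightarrow> a 1 = f (a 0) \<longleftrightarrow> sat M (\<lambda>n. if n < 6 then a n else e n) \<phi>"
    using assms(1) unfolding Fn_def dv_def by blast
  have s: "sat M (e(0 := x, 1 := y)) \<phi> \<longleftrightarrow> y = f x" if "x \<in> M" "y \<in> M" for x y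
  proof -
    have "(\<lambda>n. if n < 6 then (e(0 := x, 1 := y)) n else e n) = e(0 := x, 1 := y)"
      by (auto simp: fun_eq_iff)
    moreover have "range (e(0 := x, 1 := y)) \<subseteq> M" using 1(1) that by auto
    ultimately show ?thesis using 1(2)[of "e(0 := x, 1 := y)"] by simp
  qed
  have ex: "\<forall>x\<in>M. x \<in> elts a \<longrightarrow> (\<exists>!y. y \<in> M \<and> sat M (e(0 := x, 1 := y)) \<phi>)"
    using s FnD[OF assms(1)] by blast
  have "replacement_in M" using zfc unfolding ZFC_in_def by blast
  note this[unfolded replacement_in_def, THEN spec[of _ \<phi>], THEN spec[of _ e], THEN mp, OF 1(1),
      THEN bspec, OF assms(2), THEN mp, OF ex]
  then obtain b where b: "b \<in> M"
    "\<forall>y\<in>M. y \<in> elts b \<longleftrightarrow> (\<exists>x\<in>M. x \<in> elts a \<and> sat M (e(0 := x, 1 := y)) \<phi>)"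
    by blast
  have "b = vimg f a"
  proof (rule V_eqI)
    show "y \<in> elts b \<longleftrightarrow> y \<in> elts (vimg f a)" for y
    proof (cases "y \<in> M")
      case True
      then show ?thesis using b s mem_M[of _ a] assms(2) by auto
    next
      case False
      then show ?thesis using mem_M[of y b] mem_M[of _ a] b(1) assms(2) FnD[OF assms(1)] by auto
    qed
  qed
  with b show ?thesis by simp
qed

lemma Fn_vimg [dfn_intros]:
  assumes g: "Fn g" and f: "Fn (\<lambda>p. f (vfst p) (vsnd p))" shows "Fn (\<lambda>x. vimg (f x) (g x))"
proof (rule FnI_mem)
  show "vimg (f x) (g x) \<in> M" if "x \<in> M" for x
    using Fn_comp[OF f Fn_pair[OF Fn_const[OF that] Fn_id]] FnD[OF g that] by (simp add: vimg_M)
  have "dfn (\<lambda>p. \<exists>u\<in>elts (g (vfst p)). vsnd p = f (vfst p) u)"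
    by (intro dfn_intros Fn_comp[OF g]
         Fn_comp[OF f, of "\<lambda>q. pair (vfst (vfst q)) (vsnd q)", simplified])
  then show "dfn (\<lambda>p. vsnd p \<in> elts (vimg (f (vfst p)) (g (vfst p))))"
    by (simp add: image_iff)
qed

lemma Fn_vUn [dfn_intros]: assumes f: "Fn f" shows "Fn (\<lambda>x. vUn (f x))"
proof (rule FnI_mem)
  have "dfn (\<lambda>p. \<exists>u\<in>elts (f (vfst p)). vsnd p \<in> elts u)"
    by (intro dfn_intros Fn_comp[OF f])
  then show "dfn (\<lambda>p. vsnd p \<in> elts (vUn (f (vfst p))))" by simp
qed (use FnD[OF f] in auto)

lemma Fn_vtimes [dfn_intros]:
  assumes f: "Fn f" and g: "Fn g" shows "Fn (\<lambda>x. vtimes (f x) (g x))"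
  unfolding vtimes_def by (intro dfn_intros f Fn_comp[OF g])

lemma vtimes_M [simp, intro]: "a \<in> M \<Longrightarrow> b \<in> M \<Longrightarrow> vtimes a b \<in> M"
  using FnD[OF Fn_vtimes[OF Fn_const Fn_const] vempty_M] by blast

text \<open>Only subsets lying in M are collected. That they are countably many, as
  \<open>vset\<close> requires, comes from the power set axiom: the power set in M is an element of
  \<open>V\<close>.\<close>

definition vPow :: "V \<Rightarrow> V" where
  "vPow x = vset {z \<in> M. elts z \<subseteq> elts x}"

lemma vPow: assumes "x \<in> M" shows "vPow x \<in> M \<and> elts (vPow x) = {z \<in> M. elts z \<subseteq> elts x}"
proof -
  obtain p where p: "p \<in> M" "\<forall>z\<in>M. z \<in> elts p \<longleftrightarrow> (\<forall>w\<in>M. w \<in> elts z \<longrightarrow> w \<in> elts x)"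
    using zfc assms unfolding ZFC_in_def power_set_in_def by blast
  then have "elts p = {z \<in> M. elts z \<subseteq> elts x}"
    using mem_M[of _ p] mem_M by blast
  with p show ?thesis unfolding vPow_def by (metis vset_elts)
qed

lemma vPow_M [simp, intro]: "x \<in> M \<Longrightarrow> vPow x \<in> M"
  and elts_vPow [simp]: "x \<in> M \<Longrightarrow> elts (vPow x) = {z \<in> M. elts z \<subseteq> elts x}"
  using vPow by auto

lemma Fn_vPow [dfn_intros]: assumes f: "Fn f" shows "Fn (\<lambda>x. vPow (f x))"
proof (rule FnI_mem)
  have "dfn (\<lambda>p. elts (vsnd p) \<subseteq> elts (f (vfst p)))"
    by (intro dfn_intros Fn_comp[OF f])
  then show "dfn (\<lambda>p. vsnd p \<in> elts (vPow (f (vfst p))))"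
    by (rule dfn_cong) (use FnD[OF f] in auto)
qed (use FnD[OF f] in auto)

lemma vFin_vPow: "x \<in> M \<Longrightarrow> vFin x = vsep (vPow x) (\<lambda>z. finite (elts z))"
  using finite_M[of "elts z" for z] elts_M by (intro V_eqI) auto

lemma Fn_vFin [dfn_intros]: assumes f: "Fn f" shows "Fn (\<lambda>x. vFin (f x))"
  by (rule Fn_cong[of "\<lambda>x. vsep (vPow (f x)) (\<lambda>z. finite (elts z))"])
     (auto intro!: dfn_intros f simp: vFin_vPow FnD[OF f])

lemma vFin_M [simp, intro]: "x \<in> M \<Longrightarrow> vFin x \<in> M"
  using FnD[OF Fn_vFin[OF Fn_id]] .

end

section \<open>Recursion, choice and countability inside a model\<close>

text \<open>The step \<open>H\<close> receives the earlier values as a set of pairs and not as a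
  function. It can therefore itself be a class function of a model.\<close>

definition vrec :: "(V \<Rightarrow> V) \<Rightarrow> (V \<Rightarrow> V \<Rightarrow> V) \<Rightarrow> V \<Rightarrow> V" where
  "vrec S H = wfrec {(z, x). z \<in> elts (S x)} (\<lambda>R x. H x (vimg (\<lambda>z. pair z (R z)) (S x)))"

lemma vrec:
  assumes "wf {(z, x). z \<in> elts (S x)}"
  shows "vrec S H x = H x (vimg (\<lambda>z. pair z (vrec S H z)) (S x))"
proof -
  have "vimg (\<lambda>z. pair z (cut (vrec S H) {(z, x). z \<in> elts (S x)} x z)) (S x) =
      vimg (\<lambda>z. pair z (vrec S H z)) (S x)"
    by (rule V_eqI) (auto simp: cut_apply intro!: image_eqI)
  then show ?thesis
    unfolding vrec_def by (subst wfrec[OF assms]) simp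
qed

definition vthe :: "V set \<Rightarrow> (V \<Rightarrow> bool) \<Rightarrow> V" where
  "vthe N P = (if \<exists>!y. y \<in> N \<and> P y then THE y. y \<in> N \<and> P y else vempty)"

lemma vthe_eq:
  assumes "y \<in> N" "P y" "\<And>z. z \<in> N \<Longrightarrow> P z \<Longrightarrow> z = y" shows "vthe N P = y"
proof -
  have ex1: "\<exists>!y. y \<in> N \<and> P y" using assms by (intro ex1I[of _ y] conjI) blast+
  have "(THE y. y \<in> N \<and> P y) = y" by (rule the1_equality[OF ex1]) (use assms in blast)
  then show ?thesis unfolding vthe_def if_P[OF ex1] .
qed

context omodel
begin

lemma Fn_vthe [dfn_intros]:
  assumes P: "dfn (\<lambda>p. P (vfst p) (vsnd p))" shows "Fn (\<lambda>x. vthe M (P x))"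
proof (rule FnI)
  show "vthe M (P x) \<in> M" for x
    using theI'[of "\<lambda>y. y \<in> M \<and> P x y"] unfolding vthe_def by simp
  have P': "dfn (\<lambda>p. P (vfst p) (vsnd p))" "dfn (\<lambda>p. P (vfst (vfst p)) (vsnd p))"
    "dfn (\<lambda>p. P (vfst (vfst (vfst p))) (vsnd p))"
    using P dfn_comp[OF P, of "\<lambda>p. pair (vfst (vfst p)) (vsnd p)"]
      dfn_comp[OF P, of "\<lambda>p. pair (vfst (vfst (vfst p))) (vsnd p)"]
    by (simp_all add: dfn_intros)
  have "dfn (\<lambda>p. if (\<exists>y\<in>M. P (vfst p) y \<and> (\<forall>z\<in>M. P (vfst p) z \<longrightarrow> z = y))
     then P (vfst p) (vsnd p) else vsnd p = vempty)"
    by (intro dfn_intros P' vempty_M)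
  then show "dfn (\<lambda>p. vsnd p = vthe M (P (vfst p)))"
  proof (rule dfn_cong)
    fix p assume "p \<in> M"
    then have "vsnd p \<in> M" by simp
    have e: "(\<exists>y\<in>M. P (vfst p) y \<and> (\<forall>z\<in>M. P (vfst p) z \<longrightarrow> z = y)) \<longleftrightarrow> (\<exists>!y. y \<in> M \<and> P (vfst p) y)"
      by blast
    show "vsnd p = vthe M (P (vfst p)) \<longleftrightarrow> (if (\<exists>y\<in>M. P (vfst p) y \<and> (\<forall>z\<in>M. P (vfst p) z \<longrightarrow> z = y))
     then P (vfst p) (vsnd p) else vsnd p = vempty)"
    proof (cases "\<exists>!y. y \<in> M \<and> P (vfst p) y")
      case True
      have t: "vthe M (P (vfst p)) \<in> M \<and> P (vfst p) (vthe M (P (vfst p)))"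
        using theI'[OF True] True by (simp add: vthe_def)
      then show ?thesis using True e \<open>vsnd p \<in> M\<close> by metis
    next
      case False
      then have "vthe M (P (vfst p)) = vempty" unfolding vthe_def by (simp only: if_False)
      then show ?thesis using False unfolding e by (simp only: if_False)
    qed
  qed
qed

end

context zmodel
begin

text \<open>Values are read off from approximations (\<open>ap\<close>): sets of pairs closed under
  predecessors that obey the recursion. The least approximation \<open>K z\<close> reaching
  \<open>z\<close> is unique and hence definable, so replacement collects these sets for all
  predecessors of \<open>x\<close>; adding one pair to their union gives the least approximation
  reaching \<open>x\<close>.\<close>

lemma Fn_vrec:
  assumes wf: "wf {(z, x). z \<in> elts (S x)}" and S: "Fn S" and H: "Fn (\<lambda>p. H (vfst p) (vsnd p))"
  shows "Fn (vrec S H)"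
proof -
  define R where "R = vrec S H"
  have R: "R x = H x (vimg (\<lambda>z. pair z (R z)) (S x))" for x
    unfolding R_def by (rule vrec[OF wf])
  have SM: "S x \<in> M" if "x \<in> M" for x using FnD[OF S that] .
  have HM: "H x y \<in> M" if "x \<in> M" "y \<in> M" for x y
    using FnD[OF H pair_M[OF that]] by simp
  define ap where "ap f \<longleftrightarrow> (\<forall>u\<in>elts f. u = pair (vfst u) (vsnd u) \<and>
     (\<forall>z\<in>elts (S (vfst u)). \<exists>v\<in>elts f. vfst v = z) \<and>
     vsnd u = H (vfst u) (vsep f (\<lambda>v. vfst v \<in> elts (S (vfst u)))))" for f
  have ap: "dfn ap"
    unfolding ap_def
    by (intro dfn_intros Fn_comp[OF S]
        Fn_comp[OF H, of "\<lambda>p. pair (vfst (vsnd p)) (vsep (vfst p) (\<lambda>v. vfst v \<in> elts (S (vfst (vsnd p)))))", simplified])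
  have ap_R: "vsnd u = R (vfst u)" if f: "ap f" and u: "u \<in> elts f" for f u
  proof -
    have "\<forall>u\<in>elts f. vfst u = x \<longrightarrow> vsnd u = R x" for x
      using wf
    proof (induction x rule: wf_induct_rule)
      case (less x)
      show ?case
      proof (intro ballI impI)
        fix u assume u: "u \<in> elts f" "vfst u = x"
        have "vsep f (\<lambda>v. vfst v \<in> elts (S x)) = vimg (\<lambda>z. pair z (R z)) (S x)"
        proof (rule V_eqI, rule iffI)
          fix w assume "w \<in> elts (vsep f (\<lambda>v. vfst v \<in> elts (S x)))"
          then have w: "w \<in> elts f" "vfst w \<in> elts (S x)" by auto
          then have "w = pair (vfst w) (R (vfst w))"
            using less f unfolding ap_def by (metis (mono_tags, lifting) case_prodI mem_Collect_eq)
          with w show "w \<in> elts (vimg (\<lambda>z. pair z (R z)) (S x))" by auto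
        next
          fix w assume "w \<in> elts (vimg (\<lambda>z. pair z (R z)) (S x))"
          then obtain z where z: "z \<in> elts (S x)" "w = pair z (R z)" by auto
          obtain v where v: "v \<in> elts f" "vfst v = z" using f u z unfolding ap_def by blast
          have "v = pair (vfst v) (vsnd v)" "vsnd v = R z" using less f z v unfolding ap_def by auto
          then show "w \<in> elts (vsep f (\<lambda>v. vfst v \<in> elts (S x)))" using v z by auto
        qed
        then show "vsnd u = R x" using f u R[of x] unfolding ap_def by simp
      qed
    qed
    with u show ?thesis by blast
  qed
  define D where "D z f \<longleftrightarrow> ap f \<and> (\<exists>u\<in>elts f. vfst u = z) \<and>
     (\<forall>f'\<in>M. ap f' \<and> (\<exists>u\<in>elts f'. vfst u = z) \<longrightarrow> elts f \<subseteq> elts f')" for z f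
  have Dd: "dfn (\<lambda>p. D (vfst p) (vsnd p))"
    unfolding D_def by (intro dfn_intros dfn_comp[OF ap])
  define K where "K z = vthe M (D z)" for z
  have K: "Fn K" unfolding K_def by (intro dfn_intros Dd)
  have main: "x \<in> M \<longrightarrow> R x \<in> M \<and> K x \<in> M \<and> D x (K x)" for x
    using wf
  proof (induction x rule: wf_induct_rule)
    case (less x)
    show ?case
    proof
      assume x: "x \<in> M"
      have IH: "R z \<in> M \<and> K z \<in> M \<and> D z (K z)" if "z \<in> elts (S x)" for z
        using less[of z] that mem_M[OF that SM[OF x]] by auto
      define U where "U = vUn (vimg K (S x))"
      have UM: "U \<in> M" unfolding U_def using K SM[OF x] by auto
      have apU: "u = pair (vfst u) (R (vfst u)) \<and> (\<forall>z\<in>elts (S (vfst u)). pair z (R z) \<in> elts U)"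
        if "u \<in> elts U" for u
      proof -
        obtain z where z: "z \<in> elts (S x)" "u \<in> elts (K z)" using \<open>u \<in> elts U\<close> by (auto simp: U_def)
        then have a: "ap (K z)" using IH D_def by blast
        then have "u = pair (vfst u) (R (vfst u))" using z ap_R[OF a] unfolding ap_def by metis
        moreover have "pair w (R w) \<in> elts (K z)" if "w \<in> elts (S (vfst u))" for w
        proof -
          obtain v where "v \<in> elts (K z)" "vfst v = w" using a z(2) \<open>w \<in> _\<close> unfolding ap_def by blast
          then show ?thesis using a ap_R[OF a] unfolding ap_def by metis
        qed
        ultimately show ?thesis using z(1) by (auto simp: U_def)
      qed
      have Sx: "pair z (R z) \<in> elts U" if z: "z \<in> elts (S x)" for z
      proof -
        obtain v where v: "v \<in> elts (K z)" "vfst v = z" and a: "ap (K z)" using IH[OF z] unfolding D_def by blast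
        then have "v = pair z (R z)" using ap_R[OF a] unfolding ap_def by metis
        then show ?thesis using v z by (auto simp: U_def)
      qed
      have "vimg (\<lambda>z. pair z (R z)) (S x) = vsep U (\<lambda>v. vfst v \<in> elts (S x))"
        by (rule V_eqI) (use Sx apU in \<open>auto intro: rev_image_eqI\<close>)
      moreover have "vsep U (\<lambda>v. vfst v \<in> elts (S x)) \<in> M"
        using UM SM[OF x] by (intro vsep_M dfn_intros)
      ultimately have RM: "R x \<in> M" using R[of x] HM[OF x] by simp
      let ?f = "vins (pair x (R x)) U"
      have fM: "?f \<in> M" using RM UM x by simp
      have f1: "u = pair (vfst u) (R (vfst u)) \<and> (\<forall>z\<in>elts (S (vfst u)). pair z (R z) \<in> elts ?f)"
        if "u \<in> elts ?f" for u using that apU[of u] Sx by auto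
      have "ap ?f"
        unfolding ap_def
      proof (intro ballI)
        fix u assume u: "u \<in> elts ?f"
        have "vimg (\<lambda>z. pair z (R z)) (S (vfst u)) = vsep ?f (\<lambda>v. vfst v \<in> elts (S (vfst u)))"
          by (rule V_eqI) (use f1 f1[OF u] in \<open>auto intro: rev_image_eqI\<close>)
        then show "u = pair (vfst u) (vsnd u) \<and> (\<forall>z\<in>elts (S (vfst u)). \<exists>v\<in>elts ?f. vfst v = z) \<and>
          vsnd u = H (vfst u) (vsep ?f (\<lambda>v. vfst v \<in> elts (S (vfst u))))"
          using f1[OF u] R[of "vfst u"] by (metis vfst_pair vsnd_pair)
      qed
      moreover have "elts ?f \<subseteq> elts f'" if f': "f' \<in> M" "ap f'" "v \<in> elts f'" "vfst v = x" for f' v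
      proof -
        have v: "v = pair x (R x)" using ap_R[OF f'(2,3)] f' unfolding ap_def by metis
        have "elts (K z) \<subseteq> elts f'" if z: "z \<in> elts (S x)" for z
        proof -
          have "\<exists>u\<in>elts f'. vfst u = z" using f' z unfolding ap_def by blast
          then show ?thesis using IH[OF z] f'(1,2) unfolding D_def by blast
        qed
        with v f' show ?thesis by (auto simp: U_def)
      qed
      ultimately have D: "D x ?f" unfolding D_def by auto
      have "K x = ?f"
        unfolding K_def
      proof (rule vthe_eq[of ?f M "D x", OF fM D])
        fix g assume "g \<in> M" "D x g"
        with D fM have "elts g \<subseteq> elts ?f" "elts ?f \<subseteq> elts g" unfolding D_def by blast+
        then show "g = ?f" by (simp only: V_eq_iff)
      qed
      with D fM RM show "R x \<in> M \<and> K x \<in> M \<and> D x (K x)" by simp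
    qed
  qed
  have "Fn R"
  proof (rule FnI)
    have "dfn (\<lambda>p. \<exists>u\<in>elts (K (vfst p)). vfst u = vfst p \<and> vsnd p = vsnd u)"
      by (intro dfn_intros Fn_comp[OF K])
    then show "dfn (\<lambda>p. vsnd p = R (vfst p))"
    proof (rule dfn_cong)
      fix p assume "p \<in> M"
      then have D: "D (vfst p) (K (vfst p))" using main by auto
      then have a: "ap (K (vfst p))" unfolding D_def by blast
      show "vsnd p = R (vfst p) \<longleftrightarrow> (\<exists>u\<in>elts (K (vfst p)). vfst u = vfst p \<and> vsnd p = vsnd u)"
        using D ap_R[OF a] unfolding D_def by metis
    qed
  qed (use main in blast)
  then show ?thesis unfolding R_def .
qed

text \<open>The axiom speaks of disjoint families only. Each nonempty \<open>z\<close> is therefore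
  replaced by the set of pairs with first component \<open>z\<close> and second component in
  \<open>z\<close>; a selector for these copies is almost a choice function.\<close>

lemma choice:
  assumes Z: "Z \<in> M"
  shows "\<exists>c\<in>M. \<forall>z\<in>elts Z. elts z \<noteq> {} \<longrightarrow> vapp c z \<in> elts z"
proof -
  define X where "X = vimg (\<lambda>z. vimg (pair z) z) (vsep Z (\<lambda>z. z \<noteq> vempty))"
  have XM: "X \<in> M" unfolding X_def using Z
    by (intro vimg_M[OF Fn_vimg] vsep_M dfn_intros vempty_M)
  have X: "y \<in> elts X \<longleftrightarrow> (\<exists>z\<in>elts Z. elts z \<noteq> {} \<and> elts y = pair z ` elts z)" for y
    by (auto simp: X_def V_eq_iff)
  have prem: "(\<forall>y\<in>M. y \<in> elts X \<longrightarrow> (\<exists>z\<in>M. z \<in> elts y)) \<and>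
        (\<forall>y\<in>M. \<forall>y'\<in>M. y \<in> elts X \<and> y' \<in> elts X \<and> y \<noteq> y' \<longrightarrow>
           \<not> (\<exists>z\<in>M. z \<in> elts y \<and> z \<in> elts y'))"
  proof (intro conjI ballI impI)
    show "\<exists>z\<in>M. z \<in> elts y" if y: "y \<in> M" "y \<in> elts X" for y
    proof -
      have "elts y \<noteq> {}" using y(2) X by auto
      then show ?thesis using mem_M[OF _ y(1)] by blast
    qed
    show "\<not> (\<exists>z\<in>M. z \<in> elts y \<and> z \<in> elts y')" if "y \<in> elts X \<and> y' \<in> elts X \<and> y \<noteq> y'" for y y'
      using that unfolding X V_eq_iff[of y] by auto
  qed
  have "choice_in M" using zfc unfolding ZFC_in_def by blast
  note this[unfolded choice_in_def, THEN bspec, OF XM, THEN mp, OF prem]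
  then obtain c where c: "c \<in> M" "\<forall>y\<in>M. y \<in> elts X \<longrightarrow> (\<exists>!z. z \<in> M \<and> z \<in> elts y \<and> z \<in> elts c)"
    by (rule bexE)
  \<comment> \<open>The selector may contain foreign elements. After this cut exactly one pair is
    left over each nonempty element of \<open>Z\<close>.\<close>
  let ?c = "vsep c (\<lambda>u. vsnd u \<in> elts (vfst u))"
  have "vapp ?c z \<in> elts z" if z: "z \<in> elts Z" "elts z \<noteq> {}" for z
  proof -
    let ?y = "vimg (pair z) z"
    have y: "?y \<in> elts X" unfolding X using z by auto
    then obtain u where u: "u \<in> elts ?y" "u \<in> elts c" "\<And>v. v \<in> elts ?y \<Longrightarrow> v \<in> elts c \<Longrightarrow> v = u"
      using c(2)[rule_format, OF mem_M[OF y XM] y] mem_M[OF _ mem_M[OF y XM]] by (elim ex1E) blast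
    from u(1) obtain w where w: "w \<in> elts z" "u = pair z w" by auto
    have "y = w" if "pair z y \<in> elts ?c" for y
      using u(3)[of "pair z y"] that w by auto
    moreover have zw: "pair z w \<in> elts ?c" using u(2) w by simp
    ultimately have ex1: "\<exists>!y. pair z y \<in> elts ?c" by blast
    have "vapp ?c z = w"
      unfolding vapp_def if_P[OF ex1] by (rule the1_equality[OF ex1 zw])
    with w show ?thesis by simp
  qed
  moreover have "?c \<in> M" by (rule vsep_M[OF c(1)]) (intro dfn_intros)
  ultimately show ?thesis by blast
qed

end

section \<open>Recursion on the natural numbers and sets that are countable in the model\<close>

lemma vUn_nat_code_Suc: "vUn (nat_code (Suc n)) = nat_code n"
proof (rule V_eqI)
  show "z \<in> elts (vUn (nat_code (Suc n))) \<longleftrightarrow> z \<in> elts (nat_code n)" for z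
    unfolding elts_vUn elts_nat_code by (force simp: elts_nat_code less_Suc_eq)
qed

lemma nat_code_Suc_neq [simp]: "nat_code (Suc n) \<noteq> vempty"
  unfolding vempty_nat_code by (simp del: nat_code.simps)

text \<open>Finite sets of numerals are compared at the largest element of their symmetric
  difference. This is the order of the binary numbers that they represent, so initial segments are
  finite.\<close>

definition dlex :: "V \<Rightarrow> V \<Rightarrow> bool" where
  "dlex s t \<longleftrightarrow> (\<exists>k\<in>elts t. k \<notin> elts s \<and> (\<forall>i\<in>elts omega. k \<in> elts i \<longrightarrow> (i \<in> elts s \<longleftrightarrow> i \<in> elts t)))"

lemma dlex_nat:
  assumes "elts s \<subseteq> elts omega" "elts t \<subseteq> elts omega"
  shows "dlex s t \<longleftrightarrow> (\<exists>k. nat_code k \<in> elts t \<and> nat_code k \<notin> elts s \<and>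
    (\<forall>i>k. nat_code i \<in> elts s \<longleftrightarrow> nat_code i \<in> elts t))"
proof -
  have "dlex s t \<longleftrightarrow> (\<exists>k. nat_code k \<in> elts t \<and> nat_code k \<notin> elts s \<and> (\<forall>i\<in>elts omega. nat_code k \<in> elts i \<longrightarrow> (i \<in> elts s \<longleftrightarrow> i \<in> elts t)))"
    unfolding dlex_def using assms(2) unfolding elts_omega by blast
  also have "\<dots> \<longleftrightarrow> (\<exists>k. nat_code k \<in> elts t \<and> nat_code k \<notin> elts s \<and>
    (\<forall>i>k. nat_code i \<in> elts s \<longleftrightarrow> nat_code i \<in> elts t))"
    by (simp add: elts_omega)
  finally show ?thesis .
qed

definition max_less :: "V \<Rightarrow> V \<Rightarrow> bool" where
  "max_less u v \<longleftrightarrow> (\<exists>c\<in>elts (vins (vfst v) (vins (vsnd v) vempty)). vfst u \<in> elts c \<and> vsnd u \<in> elts c)"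

text \<open>Goedel's ordering of pairs. Comparing the maxima before the components makes the initial
  segments finite on pairs of numerals.\<close>

definition pair_less :: "V \<Rightarrow> V \<Rightarrow> bool" where
  "pair_less u v \<longleftrightarrow> max_less u v \<or> \<not> max_less v u \<and>
     (vfst u \<in> elts (vfst v) \<or> vfst u = vfst v \<and> vsnd u \<in> elts (vsnd v))"

lemma max_less_nat:
  "max_less (pair (nat_code a) (nat_code b)) (pair (nat_code c) (nat_code d)) \<longleftrightarrow> max a b < max c d"
  by (auto simp: max_less_def)

lemma pair_less_nat:
  "pair_less (pair (nat_code a) (nat_code b)) (pair (nat_code c) (nat_code d)) \<longleftrightarrow>
     max a b < max c d \<or> \<not> max c d < max a b \<and> (a < c \<or> a = c \<and> b < d)"
  by (simp only: pair_less_def max_less_nat vfst_pair vsnd_pair nat_code_mem_iff nat_code_eq_iff)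

context zmodel
begin

text \<open>Union is the predecessor function on nonzero numerals, which turns the general recursion
  along membership into primitive recursion.\<close>

lemma Fn_nat_rec:
  assumes "t0 \<in> M" and h: "Fn (\<lambda>p. h (vfst p) (vsnd p))"
  shows "\<exists>g. Fn g \<and> g vempty = t0 \<and> (\<forall>n. g (nat_code (Suc n)) = h (nat_code n) (g (nat_code n)))"
proof -
  define H where "H x F = (if x = vempty then t0 else h (vUn x) (vapp F (vUn x)))" for x F
  have "Fn (\<lambda>p. H (vfst p) (vsnd p))"
    unfolding H_def
    by (intro dfn_intros assms(1) vempty_M
        Fn_comp[OF h, of "\<lambda>p. pair (vUn (vfst p)) (vapp (vsnd p) (vUn (vfst p)))", simplified])
  then have "Fn (vrec (\<lambda>x. x) H)"
    by (intro Fn_vrec Fn_id wf_elts)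
  moreover have *: "vrec (\<lambda>x. x) H x = H x (vimg (\<lambda>z. pair z (vrec (\<lambda>x. x) H z)) x)" for x
    by (rule vrec[of "\<lambda>x. x", OF wf_elts])
  have "vrec (\<lambda>x. x) H (nat_code (Suc n)) = h (nat_code n) (vrec (\<lambda>x. x) H (nat_code n))" for n
    by (subst *) (simp add: H_def vUn_nat_code_Suc)
  moreover have "vrec (\<lambda>x. x) H vempty = t0"
    by (subst *) (simp add: H_def)
  ultimately show ?thesis by blast
qed

text \<open>A choice function on the subsets of \<open>T\<close> in M, fixed beforehand, picks the
  successor. The sequence is then given by recursion and is a class function of M, not merely a
  sequence in the surrounding universe.\<close>

lemma dependent_choice:
  assumes T: "T \<in> M" "t0 \<in> elts T"
    and R: "dfn (\<lambda>p. R (vfst p) (vfst (vsnd p)) (vsnd (vsnd p)))"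
    and ex: "\<And>n t. t \<in> elts T \<Longrightarrow> \<exists>t'\<in>elts T. R (nat_code n) t t'"
  shows "\<exists>f. Fn f \<and> f vempty = t0 \<and> (\<forall>n. f (nat_code n) \<in> elts T \<and>
     R (nat_code n) (f (nat_code n)) (f (nat_code (Suc n))))"
proof -
  obtain c where c: "c \<in> M" "\<forall>z\<in>elts (vPow T). elts z \<noteq> {} \<longrightarrow> vapp c z \<in> elts z"
    using choice[of "vPow T"] T by blast
  have tM: "t \<in> M" if "t \<in> elts T" for t using that T mem_M by blast
  have "Fn (\<lambda>p. vapp c (vsep T (R (vfst p) (vsnd p))))"
    by (intro dfn_intros c T dfn_comp[OF R, of "\<lambda>p. pair (vfst (vfst p)) (pair (vsnd (vfst p)) (vsnd p))", simplified])
  then obtain f where f: "Fn f" "f vempty = t0"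
    "\<And>n. f (nat_code (Suc n)) = vapp c (vsep T (R (nat_code n) (f (nat_code n))))"
    using Fn_nat_rec[of t0 "\<lambda>n t. vapp c (vsep T (R n t))"] tM[OF T(2)] by auto
  have step: "vapp c (vsep T (R (nat_code n) t)) \<in> elts T \<and> R (nat_code n) t (vapp c (vsep T (R (nat_code n) t)))"
    if t: "t \<in> elts T" for n t
  proof -
    have "vsep T (R (nat_code n) t) \<in> M"
      using tM[OF t] T
      by (intro vsep_M T dfn_comp[OF R, of "\<lambda>p. pair (nat_code n) (pair t p)", simplified] dfn_intros nat_code_M)
    then have 1: "vsep T (R (nat_code n) t) \<in> elts (vPow T)" using T by auto
    have 2: "elts (vsep T (R (nat_code n) t)) \<noteq> {}" using ex[OF t] by auto
    have "vapp c (vsep T (R (nat_code n) t)) \<in> elts (vsep T (R (nat_code n) t))"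
      using c(2)[THEN bspec, OF 1, THEN mp, OF 2] .
    then show ?thesis by simp
  qed
  have "f (nat_code n) \<in> elts T" for n
  proof (induction n)
    case (Suc n)
    then show ?case unfolding f(3) using step by blast
  qed (use f(2) T(2) in simp)
  then have "f (nat_code n) \<in> elts T \<and> R (nat_code n) (f (nat_code n)) (f (nat_code (Suc n)))" for n
    unfolding f(3) using step by blast
  with f show ?thesis by blast
qed

text \<open>Countability in the sense of M. The enumeration may repeat values and leave
  \<open>T\<close>, so empty and finite sets are no special cases.\<close>

definition ctbl :: "V \<Rightarrow> bool" where
  "ctbl T \<longleftrightarrow> (\<exists>f. Fn f \<and> elts T \<subseteq> f ` elts omega)"

lemma ctblI: assumes f: "Fn f" "ctbl T" "elts X \<subseteq> f ` elts T" shows "ctbl X"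
proof -
  obtain g where g: "Fn g" "elts T \<subseteq> g ` elts omega" using f(2) unfolding ctbl_def by blast
  have "elts X \<subseteq> (\<lambda>n. f (g n)) ` elts omega" using f(3) g(2) by blast
  with Fn_comp[OF f(1) g(1)] show ?thesis unfolding ctbl_def by blast
qed

lemma ctbl_subset: "ctbl T \<Longrightarrow> elts X \<subseteq> elts T \<Longrightarrow> ctbl X"
  by (rule ctblI[OF Fn_id]) auto

lemma ctbl_omega [simp]: "ctbl omega"
  unfolding ctbl_def by (intro exI[of _ "\<lambda>x. x"]) (simp add: Fn_id)

text \<open>In a linear order an element is determined by the number of its predecessors when that
  number is finite. Hence the n-th element is definable in M through \<open>vcard\<close>.\<close>

lemma ctbl_order:
  assumes T: "T \<in> M" and L: "dfn (\<lambda>p. L (vfst p) (vsnd p))"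
    and fin: "\<And>x. x \<in> elts T \<Longrightarrow> finite {y \<in> elts T. L y x}"
    and irr: "\<And>x. x \<in> elts T \<Longrightarrow> \<not> L x x"
    and tot: "\<And>x y. x \<in> elts T \<Longrightarrow> y \<in> elts T \<Longrightarrow> x \<noteq> y \<Longrightarrow> L x y \<or> L y x"
    and tr: "\<And>x y z. x \<in> elts T \<Longrightarrow> y \<in> elts T \<Longrightarrow> z \<in> elts T \<Longrightarrow> L x y \<Longrightarrow> L y z \<Longrightarrow> L x z"
  shows "ctbl T"
proof -
  define c where "c x = card {y \<in> elts T. L y x}" for x
  have less: "c x < c y" if "x \<in> elts T" "y \<in> elts T" "L x y" for x y
    unfolding c_def
  proof (rule psubset_card_mono[OF fin[OF that(2)]])
    show "{z \<in> elts T. L z x} \<subset> {z \<in> elts T. L z y}"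
      using that irr[of x] tr[of _ x y] by blast
  qed
  have inj: "x = y" if "x \<in> elts T" "y \<in> elts T" "c x = c y" for x y
    using tot[of x y] less[of x y] less[of y x] that by auto
  define f where "f n = vthe M (\<lambda>x. x \<in> elts T \<and> vcard n (vsep T (\<lambda>y. L y x)))" for n
  have "Fn f"
    unfolding f_def
    by (intro dfn_intros T dfn_comp[OF L, of "\<lambda>p. pair (vsnd p) (vsnd (vfst p))", simplified])
  moreover have "f (nat_code (c x)) = x" if x: "x \<in> elts T" for x
    unfolding f_def
  proof (rule vthe_eq)
    show "x \<in> M" using x T mem_M by blast
    show "x \<in> elts T \<and> vcard (nat_code (c x)) (vsep T (\<lambda>y. L y x))"
      using x fin[OF x] by (simp add: vcard_def c_def)
    show "z = x" if "z \<in> elts T \<and> vcard (nat_code (c x)) (vsep T (\<lambda>y. L y z))" for z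
      using that inj[of z x] x by (simp add: vcard_def c_def)
  qed
  ultimately show ?thesis
    unfolding ctbl_def by (intro exI[of _ f]) (metis image_eqI nat_code_omega subsetI)
qed

lemma ctbl_omega_times: "ctbl (vtimes omega omega)"
proof (rule ctbl_order[of _ pair_less])
  have "dfn (\<lambda>p. max_less (vfst p) (vsnd p))" "dfn (\<lambda>p. max_less (vsnd p) (vfst p))"
    unfolding max_less_def by (intro dfn_intros vempty_M)+
  then show "dfn (\<lambda>p. pair_less (vfst p) (vsnd p))"
    unfolding pair_less_def by (intro dfn_intros)
  have E: "\<exists>a b. x = pair (nat_code a) (nat_code b)" if "x \<in> elts (vtimes omega omega)" for x
    using that by (auto simp: elts_vtimes elts_omega)
  show "finite {y \<in> elts (vtimes omega omega). pair_less y x}" if x: "x \<in> elts (vtimes omega omega)" for x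
  proof -
    obtain c d where x: "x = pair (nat_code c) (nat_code d)" using E[OF x] by blast
    have "{y \<in> elts (vtimes omega omega). pair_less y x} \<subseteq>
      (\<lambda>(a, b). pair (nat_code a) (nat_code b)) ` ({..max c d} \<times> {..max c d})"
    proof
      fix y assume y: "y \<in> {y \<in> elts (vtimes omega omega). pair_less y x}"
      obtain a b where ab: "y = pair (nat_code a) (nat_code b)" using E y by blast
      with y have "a \<le> max c d" "b \<le> max c d" unfolding x by (auto simp: pair_less_nat)
      with ab show "y \<in> (\<lambda>(a, b). pair (nat_code a) (nat_code b)) ` ({..max c d} \<times> {..max c d})"
        by (auto intro!: image_eqI[of _ _ "(a, b)"])
    qed
    then show ?thesis by (rule finite_subset) simp
  qed
  show "\<not> pair_less x x" if "x \<in> elts (vtimes omega omega)" for x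
    using E[OF that] by (auto simp: pair_less_nat)
  show "pair_less x y \<or> pair_less y x" if "x \<in> elts (vtimes omega omega)" "y \<in> elts (vtimes omega omega)" "x \<noteq> y" for x y
    using E[OF that(1)] E[OF that(2)] that(3) by (auto simp: pair_less_nat)
  show "pair_less x z" if "x \<in> elts (vtimes omega omega)" "y \<in> elts (vtimes omega omega)"
    "z \<in> elts (vtimes omega omega)" "pair_less x y" "pair_less y z" for x y z
    using E[OF that(1)] E[OF that(2)] E[OF that(3)] that(4,5)
    by (elim exE) (simp only: pair_less_nat, linarith)
qed simp

lemma ctbl_times:
  assumes "ctbl A" "ctbl B" shows "ctbl (vtimes A B)"
proof -
  obtain f g where f: "Fn f" "elts A \<subseteq> f ` elts omega" and g: "Fn g" "elts B \<subseteq> g ` elts omega"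
    using assms unfolding ctbl_def by blast
  show ?thesis
  proof (rule ctblI[OF _ ctbl_omega_times])
    show "Fn (\<lambda>u. pair (f (vfst u)) (g (vsnd u)))"
      by (intro dfn_intros Fn_comp[OF f(1)] Fn_comp[OF g(1)])
    show "elts (vtimes A B) \<subseteq> (\<lambda>u. pair (f (vfst u)) (g (vsnd u))) ` elts (vtimes omega omega)"
    proof
      fix u assume "u \<in> elts (vtimes A B)"
      then obtain x y where u: "u = pair x y" "x \<in> elts A" "y \<in> elts B" by (rule vtimesE)
      then obtain m n where "x = f m" "y = g n" "m \<in> elts omega" "n \<in> elts omega" using f g by blast
      then show "u \<in> (\<lambda>u. pair (f (vfst u)) (g (vsnd u))) ` elts (vtimes omega omega)"
        using u by (intro image_eqI[of _ _ "pair m n"]) auto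
    qed
  qed
qed

lemma ctbl_Un:
  assumes "ctbl A" "ctbl B" "elts X \<subseteq> elts A \<union> elts B" shows "ctbl X"
proof -
  obtain f g where f: "Fn f" "elts A \<subseteq> f ` elts omega" and g: "Fn g" "elts B \<subseteq> g ` elts omega"
    using assms unfolding ctbl_def by blast
  show ?thesis
  proof (rule ctblI[OF _ ctbl_omega_times])
    show "Fn (\<lambda>u. if vfst u = vempty then f (vsnd u) else g (vsnd u))"
      by (intro dfn_intros Fn_comp[OF f(1)] Fn_comp[OF g(1)] vempty_M)
    show "elts X \<subseteq> (\<lambda>u. if vfst u = vempty then f (vsnd u) else g (vsnd u)) ` elts (vtimes omega omega)"
    proof
      fix x assume "x \<in> elts X"
      then consider m where "x = f m" "m \<in> elts omega" | m where "x = g m" "m \<in> elts omega"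
        using assms(3) f g by blast
      then show "x \<in> (\<lambda>u. if vfst u = vempty then f (vsnd u) else g (vsnd u)) ` elts (vtimes omega omega)"
      proof cases
        case 1
        then show ?thesis by (intro image_eqI[of _ _ "pair vempty m"]) auto
      next
        case 2
        then show ?thesis using nat_code_omega[of "Suc 0"] by (intro image_eqI[of _ _ "pair (nat_code (Suc 0)) m"]) auto
      qed
    qed
  qed
qed

lemma ctbl_Fin_omega: "ctbl (vFin omega)"
proof (rule ctbl_order[of _ dlex])
  show "dfn (\<lambda>p. dlex (vfst p) (vsnd p))"
    unfolding dlex_def by (intro dfn_intros omega_M)
  have sub: "elts x \<subseteq> elts omega" if "x \<in> elts (vFin omega)" for x using that by simp
  note dn = dlex_nat[OF sub sub]
  show "finite {y \<in> elts (vFin omega). dlex y x}" if x: "x \<in> elts (vFin omega)" for x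
  proof -
    obtain F where F: "finite F" "elts x = nat_code ` F"
      using x finite_subset_image[of "elts x" nat_code UNIV] by (auto simp: elts_omega)
    have "elts y \<subseteq> nat_code ` {..Max F}" if y: "y \<in> elts (vFin omega)" "dlex y x" for y
    proof
      fix w assume w: "w \<in> elts y"
      then obtain i where i: "w = nat_code i" using y by (auto simp: elts_omega)
      obtain k where k: "nat_code k \<in> elts x" "\<forall>i>k. nat_code i \<in> elts y \<longleftrightarrow> nat_code i \<in> elts x"
        using y dn[OF y(1) x] by blast
      have "k \<in> F" using k F by auto
      have "i \<le> Max F"
      proof (cases "i \<le> k")
        case True
        then show ?thesis using Max_ge[OF F(1) \<open>k \<in> F\<close>] by linarith
      next
        case False
        then have "i \<in> F" using k w F(2) i by auto
        then show ?thesis using F by simp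
      qed
      with i show "w \<in> nat_code ` {..Max F}" by simp
    qed
    then have "y \<in> vset ` Pow (nat_code ` {..Max F})" if "y \<in> elts (vFin omega)" "dlex y x" for y
      using that by (intro image_eqI[of y vset "elts y"]) (simp only: vset_elts, blast)
    then have "{y \<in> elts (vFin omega). dlex y x} \<subseteq> vset ` Pow (nat_code ` {..Max F})" by blast
    then show ?thesis by (rule finite_subset) simp
  qed
  show "\<not> dlex x x" for x unfolding dlex_def by blast
  show "dlex x y \<or> dlex y x" if x: "x \<in> elts (vFin omega)" and y: "y \<in> elts (vFin omega)" and n: "x \<noteq> y" for x y
  proof -
    define D where "D = {i. (nat_code i \<in> elts x) \<noteq> (nat_code i \<in> elts y)}"
    have "nat_code ` D \<subseteq> elts x \<union> elts y" by (auto simp: D_def)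
    then have "finite (nat_code ` D)" using x y by (auto intro: finite_subset)
    then have D: "finite D" by (auto dest!: finite_imageD simp: inj_on_def)
    have "D \<noteq> {}"
    proof
      assume "D = {}"
      then have "elts x = elts y" using sub[OF x] sub[OF y] unfolding D_def elts_omega by blast
      with n show False by (simp add: V_eq_iff)
    qed
    then have "Max D \<in> D" "\<forall>i>Max D. i \<notin> D" using D by (auto dest: Max_ge)
    then show ?thesis unfolding dn[OF x y] dn[OF y x] unfolding D_def by blast
  qed
  show "dlex x z" if x: "x \<in> elts (vFin omega)" and y: "y \<in> elts (vFin omega)" and z: "z \<in> elts (vFin omega)"
    and d: "dlex x y" "dlex y z" for x y z
  proof -
    obtain k l where k: "nat_code k \<in> elts y" "nat_code k \<notin> elts x" "\<forall>i>k. nat_code i \<in> elts x \<longleftrightarrow> nat_code i \<in> elts y"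
      and l: "nat_code l \<in> elts z" "nat_code l \<notin> elts y" "\<forall>i>l. nat_code i \<in> elts y \<longleftrightarrow> nat_code i \<in> elts z"
      using d unfolding dn[OF x y] dn[OF y z] by blast
    have "k \<noteq> l" using k l by blast
    then have "nat_code (max k l) \<in> elts z" "nat_code (max k l) \<notin> elts x"
      using k l by (auto simp: max_def not_le)
    moreover have "\<forall>i>max k l. nat_code i \<in> elts x \<longleftrightarrow> nat_code i \<in> elts z" using k(3) l(3) by simp
    ultimately show ?thesis unfolding dn[OF x z] by blast
  qed
qed simp

lemma ctbl_Fin: assumes "ctbl A" shows "ctbl (vFin A)"
proof -
  obtain f where f: "Fn f" "elts A \<subseteq> f ` elts omega" using assms unfolding ctbl_def by blast
  show ?thesis
  proof (rule ctblI[OF _ ctbl_Fin_omega])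
    show "Fn (\<lambda>s. vimg f s)" by (intro dfn_intros Fn_comp[OF f(1)])
    show "elts (vFin A) \<subseteq> vimg f ` elts (vFin omega)"
    proof
      fix x assume "x \<in> elts (vFin A)"
      then have x: "finite (elts x)" "elts x \<subseteq> f ` elts omega" using f(2) by auto
      then obtain S where S: "S \<subseteq> elts omega" "finite S" "elts x = f ` S"
        by (metis finite_subset_image)
      then show "x \<in> vimg f ` elts (vFin omega)"
        by (intro image_eqI[of _ _ "vset S"]) (auto simp: V_eq_iff countable_finite)
    qed
  qed
qed

end

section \<open>The forcing relation\<close>

text \<open>The predecessors of a pair of names are the pairs of their constituents in the same
  order. The symmetric half of forced equality swaps the arguments of the relation and leaves the
  pairs as they are, so the first component alone decreases and wellfoundedness follows.\<close>

definition fS :: "V \<Rightarrow> V" where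
  "fS x = vUn (vimg (\<lambda>u. vimg (\<lambda>v. pair (vfst u) (vfst v)) (vsnd x)) (vfst x))"

lemma vfst_order: "u \<in> elts y \<Longrightarrow> (vfst u, y) \<in> {(y, x). y \<in> elts x}\<^sup>+"
  by (cases "\<exists>a b. u = pair a b") (auto intro: name_order simp: vfst_def)

lemma wf_fS: "wf {(z, x). z \<in> elts (fS x)}"
proof (rule wf_subset)
  show "wf (inv_image ({(y, x). y \<in> elts x}\<^sup>+) vfst)"
    by (rule wf_inv_image[OF wf_name_order])
  show "{(z, x). z \<in> elts (fS x)} \<subseteq> inv_image ({(y, x). y \<in> elts x}\<^sup>+) vfst"
    by (auto simp: fS_def intro: vfst_order)
qed

locale poset = zmodel +
  fixes P :: V
  assumes P_M [simp, intro]: "P \<in> M"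
begin

definition ent :: "V \<Rightarrow> bool" where
  "ent x \<longleftrightarrow> x = pair (vfst x) (vsnd x) \<and> vsnd x \<in> elts P"

lemma ent_pair [simp]: "ent (pair a b) \<longleftrightarrow> b \<in> elts P"
  by (simp add: ent_def)

lemma dfn_ent [dfn_intros]: "Fn f \<Longrightarrow> dfn (\<lambda>x. ent (f x))"
  unfolding ent_def by (intro dfn_intros P_M)

text \<open>With forced equality for \<open>R\<close>, the condition \<open>p\<close> forces the
  value of \<sigma> to be a subset of that of \<tau>: below \<open>p\<close> and the label of an
  entry of \<sigma> it is dense to be below an entry of \<tau> whose name is forced equal. Stronger
  conditions are larger sets.\<close>

definition fsub :: "(V \<Rightarrow> V \<Rightarrow> V \<Rightarrow> bool) \<Rightarrow> V \<Rightarrow> V \<Rightarrow> V \<Rightarrow> bool" where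
  "fsub R p \<sigma> \<tau> \<longleftrightarrow> (\<forall>u\<in>elts \<sigma>. ent u \<longrightarrow> (\<forall>q\<in>elts P. elts p \<subseteq> elts q \<and> elts (vsnd u) \<subseteq> elts q \<longrightarrow>
     (\<exists>r\<in>elts P. elts q \<subseteq> elts r \<and> (\<exists>v\<in>elts \<tau>. ent v \<and> elts (vsnd v) \<subseteq> elts r \<and> R r (vfst u) (vfst v)))))"

definition fH :: "V \<Rightarrow> V \<Rightarrow> V" where
  "fH x F = vsep P (\<lambda>p. fsub (\<lambda>r a b. r \<in> elts (vapp F (pair a b))) p (vfst x) (vsnd x) \<and>
     fsub (\<lambda>r a b. r \<in> elts (vapp F (pair b a))) p (vsnd x) (vfst x))"

text \<open>\<open>feq p \<sigma> \<tau>\<close>: the condition \<open>p\<close> forces the values of the names \<open>\<sigma>\<close> and \<open>\<tau>\<close> to be equal.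
  Every set is read as a name; its elements that are not pairs with second component in \<open>P\<close> are ignored.\<close>

definition feq :: "V \<Rightarrow> V \<Rightarrow> V \<Rightarrow> bool" where
  "feq p \<sigma> \<tau> \<longleftrightarrow> p \<in> elts (vrec fS fH (pair \<sigma> \<tau>))"

lemma fsub_cong:
  assumes "\<And>r u v. u \<in> elts \<sigma> \<Longrightarrow> v \<in> elts \<tau> \<Longrightarrow> R r (vfst u) (vfst v) \<longleftrightarrow> R' r (vfst u) (vfst v)"
  shows "fsub R p \<sigma> \<tau> \<longleftrightarrow> fsub R' p \<sigma> \<tau>"
  unfolding fsub_def by (intro ball_cong refl imp_cong bex_cong conj_cong) (simp_all add: assms)

lemma feq_unfold:
  "feq p \<sigma> \<tau> \<longleftrightarrow> p \<in> elts P \<and> fsub feq p \<sigma> \<tau> \<and> fsub (\<lambda>r a b. feq r b a) p \<tau> \<sigma>"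
proof -
  let ?F = "vimg (\<lambda>z. pair z (vrec fS fH z)) (fS (pair \<sigma> \<tau>))"
  have "pair (vfst u) (vfst v) \<in> elts (fS (pair \<sigma> \<tau>))" if "u \<in> elts \<sigma>" "v \<in> elts \<tau>" for u v
    unfolding fS_def using that by auto
  then have app: "r \<in> elts (vapp ?F (pair (vfst u) (vfst v))) \<longleftrightarrow> feq r (vfst u) (vfst v)"
    if "u \<in> elts \<sigma>" "v \<in> elts \<tau>" for r u v
    using that unfolding feq_def by simp
  have "feq p \<sigma> \<tau> \<longleftrightarrow> p \<in> elts (fH (pair \<sigma> \<tau>) ?F)"
    unfolding feq_def by (subst vrec[OF wf_fS]) simp
  also have "\<dots> \<longleftrightarrow> p \<in> elts P \<and> fsub feq p \<sigma> \<tau> \<and> fsub (\<lambda>r a b. feq r b a) p \<tau> \<sigma>"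
    unfolding fH_def[of "pair \<sigma> \<tau>" ?F] elts_vsep mem_Collect_eq vfst_pair vsnd_pair
    using fsub_cong[of \<sigma> \<tau> "\<lambda>r a b. r \<in> elts (vapp ?F (pair a b))" feq p]
      fsub_cong[of \<tau> \<sigma> "\<lambda>r a b. r \<in> elts (vapp ?F (pair b a))" "\<lambda>r a b. feq r b a" p] app by simp
  finally show ?thesis .
qed

lemma Fn_fH: "Fn (\<lambda>p. fH (vfst p) (vsnd p))"
  unfolding fH_def fsub_def by (intro dfn_intros P_M)

lemma Fn_fE: "Fn (vrec fS fH)"
  by (rule Fn_vrec[OF wf_fS _ Fn_fH], unfold fS_def, intro dfn_intros)

lemma dfn_feq [dfn_intros]: "Fn f \<Longrightarrow> Fn g \<Longrightarrow> Fn h \<Longrightarrow> dfn (\<lambda>x. feq (f x) (g x) (h x))"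
  unfolding feq_def by (intro dfn_intros Fn_comp[OF Fn_fE])

lemma fsub_mono: "fsub R p \<sigma> \<tau> \<Longrightarrow> elts p \<subseteq> elts q \<Longrightarrow> fsub R q \<sigma> \<tau>"
  unfolding fsub_def by (meson order_trans)

lemma feq_mono: "feq p \<sigma> \<tau> \<Longrightarrow> elts p \<subseteq> elts q \<Longrightarrow> q \<in> elts P \<Longrightarrow> feq q \<sigma> \<tau>"
  unfolding feq_unfold[of _ \<sigma> \<tau>] using fsub_mono by blast

text \<open>Membership is forced in the strong sense, by one particular entry of \<tau> rather than
  densely below \<open>p\<close>. The truth lemma asks only for some condition in the filter, and
  there the two versions agree.\<close>

definition fmem :: "V \<Rightarrow> V \<Rightarrow> V \<Rightarrow> bool" where
  "fmem p \<sigma> \<tau> \<longleftrightarrow> p \<in> elts P \<and> (\<exists>v\<in>elts \<tau>. ent v \<and> elts (vsnd v) \<subseteq> elts p \<and> feq p \<sigma> (vfst v))"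

lemma dfn_fmem [dfn_intros]:
  assumes f: "Fn f" and g: "Fn g" and h: "Fn h" shows "dfn (\<lambda>x. fmem (f x) (g x) (h x))"
  unfolding fmem_def by (intro dfn_intros P_M f h Fn_comp[OF f] Fn_comp[OF g])

lemma fmem_mono: "fmem p \<sigma> \<tau> \<Longrightarrow> elts p \<subseteq> elts q \<Longrightarrow> q \<in> elts P \<Longrightarrow> fmem q \<sigma> \<tau>"
  unfolding fmem_def using feq_mono by blast

text \<open>Since forcing of membership is not closed under density, the clause for
  \<open>All\<close> asks for each instance to be forced densely below \<open>p\<close>. Names range
  over all of M because every set is read as a name.\<close>

primrec frc :: "fm \<Rightarrow> V \<Rightarrow> (nat \<Rightarrow> V) \<Rightarrow> bool" where
  "frc (Mem i j) p e \<longleftrightarrow> fmem p (e i) (e j)"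
| "frc (Eq i j) p e \<longleftrightarrow> feq p (e i) (e j)"
| "frc (Neg \<phi>) p e \<longleftrightarrow> (\<forall>q\<in>elts P. elts p \<subseteq> elts q \<longrightarrow> \<not> frc \<phi> q e)"
| "frc (Conj \<phi> \<psi>) p e \<longleftrightarrow> frc \<phi> p e \<and> frc \<psi> p e"
| "frc (All i \<phi>) p e \<longleftrightarrow> (\<forall>\<tau>\<in>M. \<forall>q\<in>elts P. elts p \<subseteq> elts q \<longrightarrow>
     (\<exists>r\<in>elts P. elts q \<subseteq> elts r \<and> frc \<phi> r (e(i := \<tau>))))"

lemma frc_mono: "frc \<phi> p e \<Longrightarrow> elts p \<subseteq> elts q \<Longrightarrow> q \<in> elts P \<Longrightarrow> frc \<phi> q e"
proof (induction \<phi> arbitrary: p q e)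
  case (All i \<phi>)
  then show ?case unfolding frc.simps by (meson order_trans)
next
  case (Neg \<phi>)
  then show ?case unfolding frc.simps by (meson order_trans)
qed (auto intro: fmem_mono feq_mono)

text \<open>The environment consists of class functions of the free argument. Under a quantifier the
  new name becomes a component of a nested pair, and the induction hypothesis applies to the changed
  environment.\<close>

lemma dfn_frc:
  assumes "\<And>n. Fn (e n)" "Fn p" shows "dfn (\<lambda>x. frc \<phi> (p x) (\<lambda>n. e n x))"
  using assms
proof (induction \<phi> arbitrary: p e)
  case (Mem i j)
  then show ?case unfolding frc.simps by (intro dfn_intros)
next
  case (Eq i j)
  then show ?case unfolding frc.simps by (intro dfn_intros)
next
  case (Neg \<phi>)
  have "dfn (\<lambda>z. frc \<phi> (vsnd z) (\<lambda>n. e n (vfst z)))"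
    by (rule Neg.IH) (intro dfn_intros Fn_comp[OF Neg.prems(1)])+
  then show ?case unfolding frc.simps
    by (intro dfn_intros P_M Fn_comp[OF Neg.prems(2)])
next
  case (Conj \<phi> \<psi>)
  show ?case unfolding frc.simps
    by (rule dfn_conj[OF Conj.IH(1)[OF Conj.prems] Conj.IH(2)[OF Conj.prems]])
next
  case (All i \<phi>)
  define d where "d n z = (if n = i then vsnd (vfst (vfst z)) else e n (vfst (vfst (vfst z))))" for n z
  have "Fn (d n)" for n
    unfolding d_def by (cases "n = i") (simp_all add: dfn_intros Fn_comp[OF All.prems(1)])
  then have "dfn (\<lambda>z. frc \<phi> (vsnd z) (\<lambda>n. d n z))"
    by (rule All.IH) (intro dfn_intros)
  then show ?case unfolding frc.simps
    by (intro dfn_intros P_M Fn_comp[OF All.prems(2)]) (simp add: d_def fun_upd_def)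
qed

end

locale forcing = poset +
  fixes G :: "V set"
  assumes gen: "generic_over M (elts P) rev_incl G"
begin

lemma G_P: "p \<in> G \<Longrightarrow> p \<in> elts P"
  using gen unfolding generic_over_def filter_on_def by blast

lemma P_memM: "p \<in> elts P \<Longrightarrow> p \<in> M"
  using mem_M by blast

lemma G_M: "p \<in> G \<Longrightarrow> p \<in> M"
  using G_P P_memM by blast

lemma G_up: "p \<in> G \<Longrightarrow> q \<in> elts P \<Longrightarrow> elts q \<subseteq> elts p \<Longrightarrow> q \<in> G"
  using gen unfolding generic_over_def filter_on_def rev_incl_def by blast

lemma G_dir: "p \<in> G \<Longrightarrow> q \<in> G \<Longrightarrow> \<exists>r\<in>G. elts p \<subseteq> elts r \<and> elts q \<subseteq> elts r"
  using gen unfolding generic_over_def filter_on_def rev_incl_def by blast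

lemma G_ne: "\<exists>p. p \<in> G"
  using gen unfolding generic_over_def filter_on_def by blast

text \<open>Density below \<open>p\<close> becomes density everywhere when the conditions
  incompatible with \<open>p\<close> are added. A filter containing \<open>p\<close> cannot meet the
  added ones.\<close>

lemma generic_dfn:
  assumes Q: "dfn Q" and p: "p \<in> G"
    and dense: "\<And>q. q \<in> elts P \<Longrightarrow> elts p \<subseteq> elts q \<Longrightarrow> \<exists>r\<in>elts P. elts q \<subseteq> elts r \<and> Q r"
  shows "\<exists>r\<in>G. Q r \<and> elts p \<subseteq> elts r"
proof -
  define D where "D = vsep P (\<lambda>r. (elts p \<subseteq> elts r \<and> Q r) \<or>
     \<not> (\<exists>s\<in>elts P. elts r \<subseteq> elts s \<and> elts p \<subseteq> elts s))"
  have "D \<in> M"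
    unfolding D_def by (intro vsep_M dfn_intros Q P_M G_M[OF p])
  moreover have "dense_in (elts P) rev_incl (elts D)"
    unfolding dense_in_def rev_incl_def
  proof (intro conjI ballI)
    fix q assume q: "q \<in> elts P"
    show "\<exists>d\<in>elts D. elts q \<subseteq> elts d"
    proof (cases "\<exists>s\<in>elts P. elts q \<subseteq> elts s \<and> elts p \<subseteq> elts s")
      case True
      then obtain s where s: "s \<in> elts P" "elts q \<subseteq> elts s" "elts p \<subseteq> elts s" by blast
      from dense[OF s(1,3)] obtain r where "r \<in> elts P" "elts s \<subseteq> elts r" "Q r" by blast
      then show ?thesis using s by (intro bexI[of _ r]) (auto simp: D_def)
    next
      case False
      then show ?thesis using q by (intro bexI[of _ q]) (auto simp: D_def)
    qed
  qed (auto simp: D_def)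
  ultimately obtain r where r: "r \<in> G" "r \<in> elts D"
    using gen unfolding generic_over_def by blast
  obtain s where "s \<in> G" "elts r \<subseteq> elts s" "elts p \<subseteq> elts s" using G_dir[OF r(1) p] by blast
  with r show ?thesis using G_P by (intro bexI[of _ r]) (auto simp: D_def)
qed

lemma val_mem: "y \<in> elts (val G \<tau>) \<longleftrightarrow> (\<exists>x\<in>elts \<tau>. ent x \<and> vsnd x \<in> G \<and> y = val G (vfst x))"
proof
  assume "y \<in> elts (val G \<tau>)"
  then obtain \<sigma> p where "p \<in> G" "pair \<sigma> p \<in> elts \<tau>" "y = val G \<sigma>" by (auto simp: elts_val)
  then show "\<exists>x\<in>elts \<tau>. ent x \<and> vsnd x \<in> G \<and> y = val G (vfst x)"
    using G_P by (intro bexI[of _ "pair \<sigma> p"]) auto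
next
  assume "\<exists>x\<in>elts \<tau>. ent x \<and> vsnd x \<in> G \<and> y = val G (vfst x)"
  then obtain x where "x \<in> elts \<tau>" "ent x" "vsnd x \<in> G" "y = val G (vfst x)" by blast
  then show "y \<in> elts (val G \<tau>)"
    unfolding elts_val ent_def by (metis (mono_tags, lifting) image_eqI mem_Collect_eq)
qed

lemma fsub_val:
  assumes p: "p \<in> G" "fsub R p \<sigma> \<tau>" and M: "\<sigma> \<in> M" "\<tau> \<in> M"
    and R: "dfn (\<lambda>p. R (vfst p) (vfst (vsnd p)) (vsnd (vsnd p)))"
    and tr: "\<And>u v r. u \<in> elts \<sigma> \<Longrightarrow> v \<in> elts \<tau> \<Longrightarrow> r \<in> G \<Longrightarrow> R r (vfst u) (vfst v) \<Longrightarrow> val G (vfst u) = val G (vfst v)"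
  shows "elts (val G \<sigma>) \<subseteq> elts (val G \<tau>)"
proof
  fix y assume "y \<in> elts (val G \<sigma>)"
  then obtain u where u: "u \<in> elts \<sigma>" "ent u" "vsnd u \<in> G" "y = val G (vfst u)"
    unfolding val_mem by blast
  have uM: "u \<in> M" using u M mem_M by blast
  obtain q where q: "q \<in> G" "elts p \<subseteq> elts q" "elts (vsnd u) \<subseteq> elts q" using G_dir[OF p(1) u(3)] by blast
  have "\<exists>r\<in>G. (\<exists>v\<in>elts \<tau>. ent v \<and> elts (vsnd v) \<subseteq> elts r \<and> R r (vfst u) (vfst v)) \<and> elts q \<subseteq> elts r"
  proof (rule generic_dfn[OF _ q(1)])
    show "dfn (\<lambda>r. \<exists>v\<in>elts \<tau>. ent v \<and> elts (vsnd v) \<subseteq> elts r \<and> R r (vfst u) (vfst v))"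
      by (intro dfn_intros M dfn_comp[OF R, of "\<lambda>z. pair (vfst z) (pair (vfst u) (vfst (vsnd z)))", simplified] vfst_M uM)
    show "\<exists>r\<in>elts P. elts s \<subseteq> elts r \<and> (\<exists>v\<in>elts \<tau>. ent v \<and> elts (vsnd v) \<subseteq> elts r \<and> R r (vfst u) (vfst v))"
      if "s \<in> elts P" "elts q \<subseteq> elts s" for s
      using p(2) u that q unfolding fsub_def by (meson order_trans)
  qed
  then obtain r v where r: "r \<in> G" "v \<in> elts \<tau>" "ent v" "elts (vsnd v) \<subseteq> elts r" "R r (vfst u) (vfst v)" by blast
  then have "vsnd v \<in> G" using G_up[OF r(1)] unfolding ent_def by blast
  with r u(4) tr[OF u(1) r(2,1,5)] show "y \<in> elts (val G \<tau>)" unfolding val_mem by auto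
qed

text \<open>It is dense either to force the inclusion or to witness against it, that is, to lie
  below an entry of \<sigma> that no stronger condition relates to an entry of \<tau> below which it
  lies. A witness in the filter would contradict the inclusion of the values.\<close>

lemma val_fsub:
  assumes sub: "elts (val G \<sigma>) \<subseteq> elts (val G \<tau>)" and M: "\<sigma> \<in> M" "\<tau> \<in> M"
    and R: "dfn (\<lambda>p. R (vfst p) (vfst (vsnd p)) (vsnd (vsnd p)))"
    and mono: "\<And>p q a b. R p a b \<Longrightarrow> elts p \<subseteq> elts q \<Longrightarrow> q \<in> elts P \<Longrightarrow> R q a b"
    and tr: "\<And>u v. u \<in> elts \<sigma> \<Longrightarrow> v \<in> elts \<tau> \<Longrightarrow> val G (vfst u) = val G (vfst v) \<Longrightarrow> \<exists>r\<in>G. R r (vfst u) (vfst v)"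
  shows "\<exists>p\<in>G. fsub R p \<sigma> \<tau>"
proof -
  obtain p0 where p0: "p0 \<in> G" using G_ne by blast
  define Q where "Q p \<longleftrightarrow> fsub R p \<sigma> \<tau> \<or> (\<exists>u\<in>elts \<sigma>. ent u \<and> elts (vsnd u) \<subseteq> elts p \<and>
      (\<forall>r\<in>elts P. elts p \<subseteq> elts r \<longrightarrow> (\<forall>v\<in>elts \<tau>. ent v \<and> elts (vsnd v) \<subseteq> elts r \<longrightarrow> \<not> R r (vfst u) (vfst v))))" for p
  have R2: "Fn f \<Longrightarrow> Fn g \<Longrightarrow> Fn h \<Longrightarrow> dfn (\<lambda>x. R (f x) (g x) (h x))" for f g h
    using dfn_comp[OF R, of "\<lambda>x. pair (f x) (pair (g x) (h x))"] by (simp add: dfn_intros)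
  have "\<exists>r\<in>G. Q r \<and> elts p0 \<subseteq> elts r"
  proof (rule generic_dfn[OF _ p0])
    show "dfn Q" unfolding Q_def fsub_def by (intro dfn_intros R2 P_M M)
    fix q assume q: "q \<in> elts P"
    show "\<exists>r\<in>elts P. elts q \<subseteq> elts r \<and> Q r"
    proof (cases "fsub R q \<sigma> \<tau>")
      case True
      with q show ?thesis unfolding Q_def by blast
    next
      case False
      then obtain u s where "u \<in> elts \<sigma>" "ent u" "s \<in> elts P" "elts q \<subseteq> elts s" "elts (vsnd u) \<subseteq> elts s"
        "\<not> (\<exists>r\<in>elts P. elts s \<subseteq> elts r \<and> (\<exists>v\<in>elts \<tau>. ent v \<and> elts (vsnd v) \<subseteq> elts r \<and> R r (vfst u) (vfst v)))"
        unfolding fsub_def by blast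
      then show ?thesis by (intro bexI[of _ s]) (auto simp: Q_def)
    qed
  qed
  then obtain p where p: "p \<in> G" "Q p" by blast
  show ?thesis
  proof (cases "fsub R p \<sigma> \<tau>")
    case False
    with p(2) obtain u where u: "u \<in> elts \<sigma>" "ent u" "elts (vsnd u) \<subseteq> elts p"
      "\<forall>r\<in>elts P. elts p \<subseteq> elts r \<longrightarrow> (\<forall>v\<in>elts \<tau>. ent v \<and> elts (vsnd v) \<subseteq> elts r \<longrightarrow> \<not> R r (vfst u) (vfst v))"
      unfolding Q_def by blast
    have "vsnd u \<in> G" using G_up[OF p(1)] u unfolding ent_def by blast
    then have "val G (vfst u) \<in> elts (val G \<sigma>)" using u unfolding val_mem by blast
    then have "val G (vfst u) \<in> elts (val G \<tau>)" using sub by blast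
    then obtain v where v: "v \<in> elts \<tau>" "ent v" "vsnd v \<in> G" "val G (vfst u) = val G (vfst v)"
      unfolding val_mem by blast
    obtain r where r: "r \<in> G" "R r (vfst u) (vfst v)" using tr[OF u(1) v(1,4)] by blast
    obtain s where s: "s \<in> G" "elts r \<subseteq> elts s" "elts p \<subseteq> elts s" using G_dir r(1) p(1) by blast
    obtain t where t: "t \<in> G" "elts s \<subseteq> elts t" "elts (vsnd v) \<subseteq> elts t" using G_dir[OF s(1) v(3)] by blast
    have "R t (vfst u) (vfst v)" using mono[OF r(2)] s t G_P by blast
    with u(4) t s v G_P[OF t(1)] have False by blast
    then show ?thesis ..
  qed (use p in blast)
qed

lemma feq_truth: "\<sigma> \<in> M \<Longrightarrow> \<tau> \<in> M \<Longrightarrow> val G \<sigma> = val G \<tau> \<longleftrightarrow> (\<exists>p\<in>G. feq p \<sigma> \<tau>)"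
proof (induction \<sigma> arbitrary: \<tau> rule: wf_induct_rule[OF wf_name_order])
  case (1 \<sigma>)
  have IH: "val G (vfst u) = val G (vfst v) \<longleftrightarrow> (\<exists>p\<in>G. feq p (vfst u) (vfst v))"
    if "u \<in> elts \<sigma>" "v \<in> elts \<tau>" for u v
    using "1.IH"[OF vfst_order[OF that(1)]] "1.prems" that mem_M vfst_M by blast
  have d: "dfn (\<lambda>p. feq (vfst p) (vfst (vsnd p)) (vsnd (vsnd p)))"
     "dfn (\<lambda>p. feq (vfst p) (vsnd (vsnd p)) (vfst (vsnd p)))"
    by (intro dfn_intros)+
  show ?case
  proof
    assume eq: "val G \<sigma> = val G \<tau>"
    have "\<exists>p\<in>G. fsub feq p \<sigma> \<tau>"
    proof (rule val_fsub[OF _ "1.prems" d(1)])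
      show "feq q a b" if "feq p a b" "elts p \<subseteq> elts q" "q \<in> elts P" for p q a b
        using feq_mono that .
    qed (use eq IH in simp_all)
    moreover have "\<exists>p\<in>G. fsub (\<lambda>r a b. feq r b a) p \<tau> \<sigma>"
    proof (rule val_fsub[OF _ "1.prems"(2,1) d(2)])
      show "feq q b a" if "feq p b a" "elts p \<subseteq> elts q" "q \<in> elts P" for p q a b
        using feq_mono that .
      show "\<exists>r\<in>G. feq r (vfst v) (vfst u)" if "u \<in> elts \<tau>" "v \<in> elts \<sigma>" "val G (vfst u) = val G (vfst v)" for u v
        using IH[OF that(2,1)] that(3) by simp
    qed (use eq in simp)
    ultimately obtain p q where pq: "p \<in> G" "q \<in> G" "fsub feq p \<sigma> \<tau>" "fsub (\<lambda>r a b. feq r b a) q \<tau> \<sigma>" by blast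
    then obtain r where r: "r \<in> G" "elts p \<subseteq> elts r" "elts q \<subseteq> elts r" using G_dir by blast
    then have "feq r \<sigma> \<tau>" unfolding feq_unfold[of r \<sigma> \<tau>]
      using pq fsub_mono G_P by blast
    with r show "\<exists>p\<in>G. feq p \<sigma> \<tau>" by blast
  next
    assume "\<exists>p\<in>G. feq p \<sigma> \<tau>"
    then obtain p where p: "p \<in> G" "fsub feq p \<sigma> \<tau>" "fsub (\<lambda>r a b. feq r b a) p \<tau> \<sigma>"
      using feq_unfold by blast
    have "elts (val G \<sigma>) \<subseteq> elts (val G \<tau>)"
      by (rule fsub_val[OF p(1,2) "1.prems" d(1)]) (use IH in blast)
    moreover have "elts (val G \<tau>) \<subseteq> elts (val G \<sigma>)"
      by (rule fsub_val[OF p(1,3) "1.prems"(2,1) d(2)]) (use IH in metis)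
    ultimately show "val G \<sigma> = val G \<tau>" by (simp add: V_eq_iff)
  qed
qed

lemma fmem_truth:
  assumes "\<sigma> \<in> M" "\<tau> \<in> M" shows "val G \<sigma> \<in> elts (val G \<tau>) \<longleftrightarrow> (\<exists>p\<in>G. fmem p \<sigma> \<tau>)"
proof
  assume "val G \<sigma> \<in> elts (val G \<tau>)"
  then obtain v where v: "v \<in> elts \<tau>" "ent v" "vsnd v \<in> G" "val G \<sigma> = val G (vfst v)"
    unfolding val_mem by blast
  then obtain p where p: "p \<in> G" "feq p \<sigma> (vfst v)"
    using feq_truth[of \<sigma> "vfst v"] assms mem_M by blast
  obtain q where q: "q \<in> G" "elts p \<subseteq> elts q" "elts (vsnd v) \<subseteq> elts q" using G_dir[OF p(1) v(3)] by blast
  then have "fmem q \<sigma> \<tau>" unfolding fmem_def using v p feq_mono G_P by blast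
  with q show "\<exists>p\<in>G. fmem p \<sigma> \<tau>" by blast
next
  assume "\<exists>p\<in>G. fmem p \<sigma> \<tau>"
  then obtain p v where p: "p \<in> G" "v \<in> elts \<tau>" "ent v" "elts (vsnd v) \<subseteq> elts p" "feq p \<sigma> (vfst v)"
    unfolding fmem_def by blast
  then have "vsnd v \<in> G" using G_up[OF p(1)] unfolding ent_def by blast
  moreover have "val G \<sigma> = val G (vfst v)"
    using feq_truth[of \<sigma> "vfst v"] p assms mem_M by blast
  ultimately show "val G \<sigma> \<in> elts (val G \<tau>)" using p unfolding val_mem by blast
qed

abbreviation N :: "V set" where "N \<equiv> val G ` M"

theorem truth:
  "(\<And>n. e n \<in> M) \<Longrightarrow> sat N (\<lambda>n. val G (e n)) \<phi> \<longleftrightarrow> (\<exists>p\<in>G. frc \<phi> p e)"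
proof (induction \<phi> arbitrary: e)
  case (Mem i j)
  then show ?case by (simp add: fmem_truth)
next
  case (Eq i j)
  then show ?case by (simp add: feq_truth)
next
  case (Neg \<phi>)
  have d: "dfn (\<lambda>p. frc \<phi> p e)" "dfn (\<lambda>z. frc \<phi> (vsnd z) e)"
    using dfn_frc[of "\<lambda>n x. e n" "\<lambda>x. x" \<phi>] dfn_frc[of "\<lambda>n x. e n" vsnd \<phi>] Neg.prems by (simp_all add: dfn_intros)
  have "\<exists>p\<in>G. frc \<phi> p e \<or> (\<forall>q\<in>elts P. elts p \<subseteq> elts q \<longrightarrow> \<not> frc \<phi> q e)"
  proof -
    obtain p0 where "p0 \<in> G" using G_ne by blast
    have "\<exists>r\<in>G. (frc \<phi> r e \<or> (\<forall>q\<in>elts P. elts r \<subseteq> elts q \<longrightarrow> \<not> frc \<phi> q e)) \<and> elts p0 \<subseteq> elts r"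
    proof (rule generic_dfn[OF _ \<open>p0 \<in> G\<close>])
      show "dfn (\<lambda>r. frc \<phi> r e \<or> (\<forall>q\<in>elts P. elts r \<subseteq> elts q \<longrightarrow> \<not> frc \<phi> q e))"
        by (intro dfn_intros d P_M)
    qed (meson order_refl)
    then show ?thesis by blast
  qed
  moreover have "\<not> (\<exists>q\<in>G. frc \<phi> q e)" if p: "p \<in> G" "\<forall>q\<in>elts P. elts p \<subseteq> elts q \<longrightarrow> \<not> frc \<phi> q e" for p
  proof
    assume "\<exists>q\<in>G. frc \<phi> q e"
    then obtain q where q: "q \<in> G" "frc \<phi> q e" by blast
    obtain r where "r \<in> G" "elts p \<subseteq> elts r" "elts q \<subseteq> elts r" using G_dir p q by blast
    then show False using p q frc_mono G_P by blast
  qed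
  ultimately have "\<not> (\<exists>q\<in>G. frc \<phi> q e) \<longleftrightarrow> (\<exists>p\<in>G. frc (Neg \<phi>) p e)"
    unfolding frc.simps by blast
  then show ?case using Neg.IH[OF Neg.prems] by simp
next
  case (Conj \<phi> \<psi>)
  have "(\<exists>p\<in>G. frc \<phi> p e) \<and> (\<exists>p\<in>G. frc \<psi> p e) \<longleftrightarrow> (\<exists>p\<in>G. frc \<phi> p e \<and> frc \<psi> p e)"
    using G_dir frc_mono G_P by meson
  then show ?case using Conj by simp
next
  case (All i \<phi>)
  have up: "(\<lambda>n. val G (e n))(i := val G \<tau>) = (\<lambda>n. val G ((e(i := \<tau>)) n))" for \<tau> by auto
  have IH: "sat N ((\<lambda>n. val G (e n))(i := val G \<tau>)) \<phi> \<longleftrightarrow> (\<exists>p\<in>G. frc \<phi> p (e(i := \<tau>)))" if "\<tau> \<in> M" for \<tau>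
    unfolding up by (rule All.IH) (use that All.prems in auto)
  have Fe: "Fn f \<Longrightarrow> Fn p \<Longrightarrow> dfn (\<lambda>z. frc \<phi> (p z) (e(i := f z)))" for f p
  proof -
    assume f: "Fn f" and p: "Fn p"
    have "Fn (\<lambda>z. if n = i then f z else e n)" for n
      by (cases "n = i") (simp_all add: f Fn_const All.prems)
    from dfn_frc[of "\<lambda>n z. if n = i then f z else e n" p \<phi>, OF this p]
    show "dfn (\<lambda>z. frc \<phi> (p z) (e(i := f z)))" by (simp add: fun_upd_def)
  qed
  show ?case
  proof
    assume "\<exists>p\<in>G. frc (All i \<phi>) p e"
    then obtain p where p: "p \<in> G" "frc (All i \<phi>) p e" by blast
    have "\<exists>r\<in>G. frc \<phi> r (e(i := \<tau>))" if t: "\<tau> \<in> M" for \<tau>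
    proof -
      have "\<exists>r\<in>G. frc \<phi> r (e(i := \<tau>)) \<and> elts p \<subseteq> elts r"
        by (rule generic_dfn[OF _ p(1)]) (use Fe[OF Fn_const[OF t] Fn_id] p(2) t in auto)
      then show ?thesis by blast
    qed
    then show "sat N (\<lambda>n. val G (e n)) (All i \<phi>)" using IH by simp
  next
    assume "sat N (\<lambda>n. val G (e n)) (All i \<phi>)"
    then have s: "\<exists>p\<in>G. frc \<phi> p (e(i := \<tau>))" if "\<tau> \<in> M" for \<tau> using IH that by simp
    obtain p0 where "p0 \<in> G" using G_ne by blast
    \<comment> \<open>A condition that does not force the universal formula has an extension above
      which some fixed instance is never forced. So the alternative is dense.\<close>
    have "\<exists>r\<in>G. (frc (All i \<phi>) r e \<or> (\<exists>\<tau>\<in>M. \<forall>q\<in>elts P. elts r \<subseteq> elts q \<longrightarrow> \<not> frc \<phi> q (e(i := \<tau>)))) \<and> elts p0 \<subseteq> elts r"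
    proof (rule generic_dfn[OF _ \<open>p0 \<in> G\<close>])
      show "dfn (\<lambda>r. frc (All i \<phi>) r e \<or> (\<exists>\<tau>\<in>M. \<forall>q\<in>elts P. elts r \<subseteq> elts q \<longrightarrow> \<not> frc \<phi> q (e(i := \<tau>))))"
        unfolding frc.simps by (intro dfn_intros Fe P_M)
      show "\<exists>r\<in>elts P. elts q \<subseteq> elts r \<and> (frc (All i \<phi>) r e \<or> (\<exists>\<tau>\<in>M. \<forall>q\<in>elts P. elts r \<subseteq> elts q \<longrightarrow> \<not> frc \<phi> q (e(i := \<tau>))))"
        if "q \<in> elts P" for q
        using that unfolding frc.simps by (meson order_refl order_trans)
    qed
    then obtain p where p: "p \<in> G" "frc (All i \<phi>) p e \<or> (\<exists>\<tau>\<in>M. \<forall>q\<in>elts P. elts p \<subseteq> elts q \<longrightarrow> \<not> frc \<phi> q (e(i := \<tau>)))" by blast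
    moreover have False if t: "\<tau> \<in> M" "\<forall>q\<in>elts P. elts p \<subseteq> elts q \<longrightarrow> \<not> frc \<phi> q (e(i := \<tau>))" for \<tau>
    proof -
      obtain q where q: "q \<in> G" "frc \<phi> q (e(i := \<tau>))" using s t by blast
      obtain r where "r \<in> G" "elts p \<subseteq> elts r" "elts q \<subseteq> elts r" using G_dir p q by blast
      then show False using t(2) q frc_mono G_P by blast
    qed
    ultimately show "\<exists>p\<in>G. frc (All i \<phi>) p e" by blast
  qed
qed

end

section \<open>The generic extension as a model\<close>

context poset
begin

definition chkH :: "V \<Rightarrow> V \<Rightarrow> V" where
  "chkH x F = vUn (vimg (\<lambda>y. vimg (pair (vapp F y)) P) x)"

text \<open>Check names. All conditions are attached to each constituent, so that any nonempty
  filter evaluates the name correctly without a distinguished weakest condition.\<close>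

definition chk :: "V \<Rightarrow> V" where
  "chk = vrec (\<lambda>x. x) chkH"

lemma elts_chk: "elts (chk x) = (\<lambda>(y, p). pair (chk y) p) ` (elts x \<times> elts P)"
  unfolding chk_def by (subst vrec[of "\<lambda>x. x", OF wf_elts]) (auto simp: chkH_def)

lemma Fn_chk0: "Fn chk"
  unfolding chk_def
  by (rule Fn_vrec[of "\<lambda>x. x", OF wf_elts Fn_id], unfold chkH_def, intro dfn_intros P_M)

lemmas Fn_chk [dfn_intros] = Fn_comp[OF Fn_chk0]

lemma chk_M [simp, intro]: "x \<in> M \<Longrightarrow> chk x \<in> M"
  by (rule FnD[OF Fn_chk0])

definition nmH :: "V \<Rightarrow> V \<Rightarrow> V" where
  "nmH \<tau> F = vimg (\<lambda>u. pair (vapp F (vfst u)) (vsnd u)) (vsep \<tau> ent)"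

text \<open>So far arbitrary sets were read as names. Here the ignored entries are deleted
  hereditarily, which gives a name in the strict sense of \<open>is_name\<close> with the same
  value.\<close>

definition nm :: "V \<Rightarrow> V" where
  "nm = vrec (vimg vfst) nmH"

lemma wf_nm: "wf {(z, x). z \<in> elts (vimg vfst x)}"
  by (rule wf_subset[OF wf_name_order]) (auto intro: vfst_order)

lemma elts_nm: "elts (nm \<tau>) = (\<lambda>u. pair (nm (vfst u)) (vsnd u)) ` {u \<in> elts \<tau>. ent u}"
proof -
  have "nm \<tau> = nmH \<tau> (vimg (\<lambda>z. pair z (nm z)) (vimg vfst \<tau>))"
    unfolding nm_def by (rule vrec[OF wf_nm])
  moreover have "vapp (vimg (\<lambda>z. pair z (nm z)) (vimg vfst \<tau>)) (vfst u) = nm (vfst u)" if "u \<in> elts \<tau>" for u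
    using that by simp
  ultimately show ?thesis by (simp add: nmH_def cong: image_cong_simp)
qed

lemma nm_M: "\<tau> \<in> M \<Longrightarrow> nm \<tau> \<in> M"
  unfolding nm_def
  by (rule FnD[OF Fn_vrec[OF wf_nm]], intro dfn_intros, unfold nmH_def, intro dfn_intros)

lemma is_name_nm: "is_name (elts P) (nm \<tau>)"
proof (induction \<tau> rule: wf_induct_rule[OF wf_name_order])
  case (1 \<tau>)
  show ?case
  proof (rule is_name.intros)
    fix x assume "x \<in> elts (nm \<tau>)"
    then obtain u where u: "u \<in> elts \<tau>" "ent u" "x = pair (nm (vfst u)) (vsnd u)"
      unfolding elts_nm by blast
    then show "\<exists>\<sigma> p. x = pair \<sigma> p \<and> is_name (elts P) \<sigma> \<and> p \<in> elts P"
      using 1 vfst_order unfolding ent_def by blast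
  qed
qed

end

context forcing
begin

lemma val_chk [simp]: "val G (chk x) = x"
proof (induction x rule: V_induct)
  case (elts x)
  obtain p where p: "p \<in> G" "p \<in> elts P" using G_ne G_P by blast
  show ?case
  proof (rule V_eqI)
    fix z
    have "z \<in> elts (val G (chk x))" if z: "z \<in> elts x"
      unfolding val_mem using elts.IH[OF z] p z
      by (intro bexI[of _ "pair (chk z) p"]) (auto simp: elts_chk intro!: image_eqI[of _ _ "(z, p)"])
    moreover have "z \<in> elts x" if "z \<in> elts (val G (chk x))"
      using that elts.IH unfolding val_mem elts_chk by auto
    ultimately show "z \<in> elts (val G (chk x)) \<longleftrightarrow> z \<in> elts x" by blast
  qed
qed

lemma M_sub_N: "M \<subseteq> N"
  by (metis chk_M image_eqI subsetI val_chk)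

lemma val_nm: "val G (nm \<tau>) = val G \<tau>"
proof (induction \<tau> rule: wf_induct_rule[OF wf_name_order])
  case (1 \<tau>)
  show ?case
  proof (rule V_eqI)
    show "z \<in> elts (val G (nm \<tau>)) \<longleftrightarrow> z \<in> elts (val G \<tau>)" for z
      unfolding val_mem elts_nm using 1 vfst_order by (force simp: ent_def)
  qed
qed

lemma gen_ext_eq: "gen_ext M (elts P) G = N"
  unfolding gen_ext_def
proof (intro equalityI subsetI)
  fix x assume "x \<in> N"
  then obtain \<tau> where "\<tau> \<in> M" "x = val G (nm \<tau>)" using val_nm by auto
  then show "x \<in> val G ` {\<tau> \<in> M. is_name (elts P) \<tau>}" using nm_M is_name_nm by blast
qed auto

lemma N_trans: "transitive_class N"
  unfolding transitive_class_def
proof safe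
  fix \<tau> y assume "\<tau> \<in> M" "y \<in> elts (val G \<tau>)"
  then show "y \<in> N" unfolding val_mem using mem_M by blast
qed

lemma N_vins: assumes "x \<in> N" "y \<in> N" shows "vins x y \<in> N"
proof -
  obtain \<sigma> \<tau> where st: "\<sigma> \<in> M" "x = val G \<sigma>" "\<tau> \<in> M" "y = val G \<tau>" using assms by blast
  define \<rho> where "\<rho> = vUn (vins \<tau> (vins (vimg (pair \<sigma>) P) vempty))"
  have "vimg (pair \<sigma>) P \<in> M" by (rule vimg_M) (intro dfn_intros st P_M)+
  then have "\<rho> \<in> M" unfolding \<rho>_def using st by blast
  moreover have "val G \<rho> = vins x y"
  proof (rule V_eqI)
    obtain p where p: "p \<in> G" "p \<in> elts P" using G_ne G_P by blast
    have "z = x \<longleftrightarrow> (\<exists>u\<in>elts (vimg (pair \<sigma>) P). ent u \<and> vsnd u \<in> G \<and> z = val G (vfst u))" for z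
      using st p by auto
    then show "z \<in> elts (val G \<rho>) \<longleftrightarrow> z \<in> elts (vins x y)" for z
      unfolding elts_vins insert_iff st(4) val_mem \<rho>_def elts_vUn by (auto simp: bex_Un)
  qed
  ultimately show ?thesis by (metis imageI)
qed

text \<open>The subset is named by the pairs of a constituent of \<alpha> and a condition that is
  stronger than one of its labels and forces the formula.\<close>

lemma N_sep: "separation_in N"
  unfolding separation_in_def
proof (intro allI impI ballI)
  fix \<phi> and e :: "nat \<Rightarrow> V" and a assume e: "range e \<subseteq> N" and "a \<in> N"
  then obtain \<alpha> where \<alpha>: "\<alpha> \<in> M" "a = val G \<alpha>" by blast
  have "\<forall>n. \<exists>\<sigma>\<in>M. e n = val G \<sigma>" using e by blast
  then obtain \<epsilon> where \<epsilon>: "\<And>n. \<epsilon> n \<in> M" "\<And>n. e n = val G (\<epsilon> n)" by metis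
  have e0: "e(0 := val G \<sigma>) = (\<lambda>n. val G ((\<epsilon>(0 := \<sigma>)) n))" for \<sigma> using \<epsilon> by auto
  define \<beta> where "\<beta> = vsep (vtimes (vimg vfst \<alpha>) P)
     (\<lambda>u. (\<exists>x\<in>elts \<alpha>. ent x \<and> vfst x = vfst u \<and> elts (vsnd x) \<subseteq> elts (vsnd u)) \<and> frc \<phi> (vsnd u) (\<epsilon>(0 := vfst u)))"
  have "Fn (\<lambda>z. if n = 0 then vfst z else \<epsilon> n)" for n
    by (cases "n = 0") (simp_all add: dfn_intros \<epsilon>)
  from dfn_frc[of "\<lambda>n z. if n = 0 then vfst z else \<epsilon> n" vsnd \<phi>, OF this]
  have d: "dfn (\<lambda>u. frc \<phi> (vsnd u) (\<epsilon>(0 := vfst u)))" by (simp add: fun_upd_def dfn_intros)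
  have "vimg vfst \<alpha> \<in> M" by (intro vimg_M dfn_intros \<alpha>)
  then have "\<beta> \<in> M" unfolding \<beta>_def by (intro vsep_M dfn_intros d vtimes_M \<alpha> P_M)
  moreover have "y \<in> elts (val G \<beta>) \<longleftrightarrow> y \<in> elts a \<and> sat N (e(0 := y)) \<phi>" for y
  proof
    assume "y \<in> elts (val G \<beta>)"
    then obtain u where u: "u \<in> elts \<beta>" "vsnd u \<in> G" "y = val G (vfst u)" unfolding val_mem by blast
    then obtain x where x: "x \<in> elts \<alpha>" "ent x" "vfst x = vfst u" "elts (vsnd x) \<subseteq> elts (vsnd u)"
      and f: "frc \<phi> (vsnd u) (\<epsilon>(0 := vfst u))" unfolding \<beta>_def by auto
    have "vsnd x \<in> G" using G_up[OF u(2)] x unfolding ent_def by blast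
    then have "y \<in> elts a" unfolding \<alpha>(2) val_mem using x u by metis
    moreover have "vfst u \<in> M" using x \<alpha> mem_M by (metis vfst_M)
    then have "sat N (e(0 := y)) \<phi>"
      unfolding u(3) e0 using truth[of "\<epsilon>(0 := vfst u)" \<phi>] \<epsilon> f u(2) by auto
    ultimately show "y \<in> elts a \<and> sat N (e(0 := y)) \<phi>" ..
  next
    assume y: "y \<in> elts a \<and> sat N (e(0 := y)) \<phi>"
    then obtain x where x: "x \<in> elts \<alpha>" "ent x" "vsnd x \<in> G" "y = val G (vfst x)"
      unfolding \<alpha>(2) val_mem by blast
    have "vfst x \<in> M" using x \<alpha> mem_M by blast
    then have "(\<epsilon>(0 := vfst x)) n \<in> M" for n using \<epsilon>(1) by simp
    from truth[of "\<epsilon>(0 := vfst x)" \<phi>, OF this] y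
    obtain p where p: "p \<in> G" "frc \<phi> p (\<epsilon>(0 := vfst x))"
      unfolding x(4) e0 by blast
    obtain q where q: "q \<in> G" "elts p \<subseteq> elts q" "elts (vsnd x) \<subseteq> elts q" using G_dir[OF p(1) x(3)] by blast
    have "frc \<phi> q (\<epsilon>(0 := vfst x))" using frc_mono p q G_P by blast
    then have "pair (vfst x) q \<in> elts \<beta>" unfolding \<beta>_def using x q G_P by auto
    then show "y \<in> elts (val G \<beta>)"
      unfolding val_mem using q G_P x(4) by (intro bexI[of _ "pair (vfst x) q"]) auto
  qed
  ultimately show "\<exists>b\<in>N. \<forall>x\<in>N. x \<in> elts b \<longleftrightarrow> x \<in> elts a \<and> sat N (e(0 := x)) \<phi>" by blast
qed

sublocale ext: nmodel N
proof
  show "vempty \<in> N" "omega \<in> N" using M_sub_N by auto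
qed (use N_trans N_vins N_sep in auto)

text \<open>What later arguments need of a name for X is just which conditions put which members of
  M into X. Check names make this a definable relation that is monotone in the condition.\<close>

lemma nice_name:
  assumes "X \<in> N"
  shows "\<exists>A. dfn (\<lambda>p. A (vfst p) (vsnd p)) \<and> (\<forall>t\<in>M. t \<in> elts X \<longleftrightarrow> (\<exists>p\<in>G. A t p)) \<and>
    (\<forall>t p q. A t p \<longrightarrow> elts p \<subseteq> elts q \<longrightarrow> q \<in> elts P \<longrightarrow> A t q)"
proof -
  obtain \<tau> where \<tau>: "\<tau> \<in> M" "X = val G \<tau>" using assms by blast
  show ?thesis
  proof (intro exI[of _ "\<lambda>t p. fmem p (chk t) \<tau>"] conjI ballI allI impI)
    show "dfn (\<lambda>p. fmem (vsnd p) (chk (vfst p)) \<tau>)" by (intro dfn_intros \<tau>)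
    show "t \<in> elts X \<longleftrightarrow> (\<exists>p\<in>G. fmem p (chk t) \<tau>)" if "t \<in> M" for t
      using fmem_truth[of "chk t" \<tau>] \<tau> that by simp
  qed (rule fmem_mono)
qed

text \<open>Each subset of \<open>Q\<close> in N is the value of a subset of \<open>chk Q\<close>.
  Hence the power set of \<open>chk Q\<close> in M, labelled with all conditions, names a bound; in
  N this does the work of the power set axiom.\<close>

lemma Pow_bounded:
  assumes Q: "Q \<in> M" shows "\<exists>B\<in>N. \<forall>x\<in>N. elts x \<subseteq> elts Q \<longrightarrow> x \<in> elts B"
proof -
  define B where "B = val G (vtimes (vPow (chk Q)) P)"
  have "B \<in> N" unfolding B_def using Q by (intro imageI vtimes_M vPow_M chk_M P_M)
  moreover have "x \<in> elts B" if x: "x \<in> N" "elts x \<subseteq> elts Q" for x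
  proof -
    obtain A where A: "dfn (\<lambda>p. A (vfst p) (vsnd p))" "\<forall>t\<in>M. t \<in> elts x \<longleftrightarrow> (\<exists>p\<in>G. A t p)"
      using nice_name[OF x(1)] by blast
    define \<nu> where "\<nu> = vimg (\<lambda>u. pair (chk (vfst u)) (vsnd u)) (vsep (vtimes Q P) (\<lambda>u. A (vfst u) (vsnd u)))"
    have "\<nu> \<in> M" unfolding \<nu>_def
      by (intro vimg_M vsep_M[OF vtimes_M] dfn_intros A Q P_M)
    moreover have "elts \<nu> \<subseteq> elts (chk Q)"
      unfolding \<nu>_def elts_chk by (auto elim!: vtimesE)
    ultimately have \<nu>: "\<nu> \<in> elts (vPow (chk Q))" using Q by auto
    have QM: "t \<in> M" if "t \<in> elts Q" for t using that Q mem_M by blast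
    have "val G \<nu> = x"
    proof (rule V_eqI)
      fix z
      have "z \<in> elts (val G \<nu>) \<longleftrightarrow> z \<in> elts Q \<and> (\<exists>p\<in>G. A z p)"
      proof
        assume "z \<in> elts (val G \<nu>)"
        then show "z \<in> elts Q \<and> (\<exists>p\<in>G. A z p)" unfolding val_mem \<nu>_def by (auto elim!: vtimesE)
      next
        assume "z \<in> elts Q \<and> (\<exists>p\<in>G. A z p)"
        then obtain p where "z \<in> elts Q" "p \<in> G" "A z p" by blast
        then show "z \<in> elts (val G \<nu>)"
          unfolding val_mem \<nu>_def using G_P
          by (intro bexI[of _ "pair (chk z) p"]) (auto intro!: image_eqI[of _ _ "pair z p"])
      qed
      then show "z \<in> elts (val G \<nu>) \<longleftrightarrow> z \<in> elts x" using A(2) QM x(2) by blast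
    qed
    moreover obtain p where "p \<in> G" "p \<in> elts P" using G_ne G_P by blast
    ultimately show ?thesis
      unfolding B_def val_mem using \<nu> by (intro bexI[of _ "pair \<nu> p"]) auto
  qed
  ultimately show ?thesis by blast
qed

end

section \<open>Linearity of ordinals and the combinatorics of Cohen conditions\<close>

lemma ordinal_linear:
  assumes k: "ordinal k" shows "a \<in> elts k \<Longrightarrow> b \<in> elts k \<Longrightarrow> a \<in> elts b \<or> a = b \<or> b \<in> elts a"
proof (induction a arbitrary: b rule: V_induct)
  case (elts a)
  have tr: "x \<in> elts k" if "x \<in> elts y" "y \<in> elts k" for x y
    using k that unfolding ordinal_def by blast
  have tr2: "x \<in> elts z" if "x \<in> elts y" "y \<in> elts z" "z \<in> elts k" for x y z
    using k that unfolding ordinal_def by blast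
  note IHa = elts.IH
  note a = elts.prems(1)
  from elts.prems(2) show ?case
  proof (induction b rule: V_induct)
    case (elts b)
    note IHb = elts.IH
    note b = elts.prems
    show ?case
    proof (rule ccontr)
      assume n: "\<not> ?case"
      \<comment> \<open>If \<open>a\<close> and \<open>b\<close> were incomparable, the two
        induction hypotheses would put each element of one into the other, and the sets would be
        equal.\<close>
      have "x \<in> elts b" if x: "x \<in> elts a" for x
        using IHa[OF x tr[OF x a] b] n tr2[OF _ x a] x by blast
      moreover have "x \<in> elts a" if x: "x \<in> elts b" for x
        using IHb[OF x tr[OF x b]] n tr2[OF _ x b] x by blast
      ultimately have "a = b" by (intro V_eqI) blast
      with n show False by blast
    qed
  qed
qed

lemma ordinal_trans: "ordinal k \<Longrightarrow> a \<in> elts b \<Longrightarrow> b \<in> elts c \<Longrightarrow> c \<in> elts k \<Longrightarrow> a \<in> elts c"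
  unfolding ordinal_def by blast

lemma ordinal_trans1: "ordinal k \<Longrightarrow> a \<in> elts b \<Longrightarrow> b \<in> elts k \<Longrightarrow> a \<in> elts k"
  unfolding ordinal_def by blast

lemma (in zmodel) Fn2_M:
  assumes "k \<in> M" shows "\<exists>Q\<in>M. elts Q = Fn2 k"
proof
  let ?Q = "vsep (vFin (vtimes k (nat_code 2))) (\<lambda>p. \<forall>u\<in>elts p. \<forall>v\<in>elts p. vfst u = vfst v \<longrightarrow> vsnd u = vsnd v)"
  show "?Q \<in> M" by (rule vsep_M) (use assms in \<open>auto intro!: dfn_intros vFin_M vtimes_M nat_code_M simp del: nat_code.simps\<close>)
  have e: "elts (vtimes k (nat_code 2)) = (\<Union>\<alpha>\<in>elts k. {pair \<alpha> (nat_code 0), pair \<alpha> (nat_code 1)})"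
    by (auto simp: elts_vtimes elts_nat_code numeral_2_eq_2 lessThan_Suc)
  show "elts ?Q = Fn2 k"
  proof (rule set_eqI)
    fix p
    have "(\<forall>u\<in>elts p. \<forall>v\<in>elts p. vfst u = vfst v \<longrightarrow> vsnd u = vsnd v) \<longleftrightarrow>
        (\<forall>\<alpha> b c. pair \<alpha> b \<in> elts p \<and> pair \<alpha> c \<in> elts p \<longrightarrow> b = c)"
      if "elts p \<subseteq> elts (vtimes k (nat_code 2))"
    proof -
      have "u = pair (vfst u) (vsnd u)" if "u \<in> elts p" for u
        using that \<open>elts p \<subseteq> _\<close> by (metis vtimesE subsetD vfst_pair vsnd_pair)
      then show ?thesis by (metis vfst_pair vsnd_pair)
    qed
    then show "p \<in> elts ?Q \<longleftrightarrow> p \<in> Fn2 k"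
      unfolding Fn2_def elts_vsep elts_vFin e by blast
  qed
qed

locale cohen = forcing +
  fixes k :: V
  assumes kM [simp, intro]: "k \<in> M" and k_ord: "ordinal k" and P_Fn2: "elts P = Fn2 k"
begin

definition dm :: "V \<Rightarrow> V \<Rightarrow> bool" where
  "dm p S \<longleftrightarrow> (\<forall>u\<in>elts p. vfst u \<in> elts S)"

lemma dfn_dm [dfn_intros]: assumes f: "Fn f" and g: "Fn g" shows "dfn (\<lambda>x. dm (f x) (g x))"
  unfolding dm_def by (intro dfn_intros f Fn_comp[OF g])

lemma P_sub: "p \<in> elts P \<Longrightarrow> elts p \<subseteq> elts (vtimes k omega)"
  unfolding P_Fn2 Fn2_def using nat_code_omega[of 0] nat_code_omega[of 1] by (force simp: elts_vtimes)

lemma P_fin: "p \<in> elts P \<Longrightarrow> finite (elts p)"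
  unfolding P_Fn2 Fn2_def by blast

lemma P_pair: "p \<in> elts P \<Longrightarrow> u \<in> elts p \<Longrightarrow> u = pair (vfst u) (vsnd u) \<and> vfst u \<in> elts k"
  using P_sub by (fastforce elim!: vtimesE)

lemma P_sub_vtimes: "p \<in> elts P \<Longrightarrow> dm p S \<Longrightarrow> elts p \<subseteq> elts (vtimes S omega)"
proof
  fix u assume p: "p \<in> elts P" "dm p S" "u \<in> elts p"
  then obtain x y where "u = pair x y" "y \<in> elts omega" using P_sub by (blast elim: vtimesE)
  with p show "u \<in> elts (vtimes S omega)" by (auto simp: dm_def)
qed

lemma P_down: "p \<in> elts P \<Longrightarrow> elts q \<subseteq> elts p \<Longrightarrow> q \<in> elts P"
  unfolding P_Fn2 Fn2_def by (blast intro: finite_subset)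

text \<open>The conditions can clash only on coordinates in \<open>S\<close>, because
  \<open>q\<close> has no others, and there \<open>q\<close> extends the restriction of
  \<open>p\<close>.\<close>

lemma P_join:
  assumes p: "p \<in> elts P" and q: "q \<in> elts P" "dm q S"
    and sub: "\<And>u. u \<in> elts p \<Longrightarrow> vfst u \<in> elts S \<Longrightarrow> u \<in> elts q"
  shows "\<exists>r\<in>elts P. elts p \<subseteq> elts r \<and> elts q \<subseteq> elts r"
proof
  let ?r = "vset (elts p \<union> elts q)"
  have e: "elts ?r = elts p \<union> elts q" by simp
  have "b = c" if "pair \<alpha> b \<in> elts p \<union> elts q" "pair \<alpha> c \<in> elts p \<union> elts q" for \<alpha> b c
  proof (cases "\<alpha> \<in> elts S")
    case True
    then have "pair \<alpha> b \<in> elts q" "pair \<alpha> c \<in> elts q" using that sub by fastforce+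
    then show ?thesis using q(1) unfolding P_Fn2 Fn2_def by blast
  next
    case False
    then have "pair \<alpha> b \<in> elts p" "pair \<alpha> c \<in> elts p" using that q(2) unfolding dm_def by fastforce+
    then show ?thesis using p unfolding P_Fn2 Fn2_def by blast
  qed
  then show "?r \<in> elts P"
    using p q(1) unfolding P_Fn2 Fn2_def mem_Collect_eq e by blast
  show "elts p \<subseteq> elts ?r \<and> elts q \<subseteq> elts ?r" unfolding e by blast
qed

text \<open>Instead of the countable chain condition, a countable set \<open>S\<close> of coordinates is closed off so
  that conditions with domain in \<open>S\<close> suffice to extend conditions with domain in \<open>S\<close>.\<close>

lemma countable_support:
  assumes A: "dfn (\<lambda>p. A (vfst p) (vsnd p))" and T: "T \<in> M" "ctbl T"
  shows "\<exists>S\<in>M. ctbl S \<and> (\<forall>t\<in>elts T. \<forall>r\<in>elts P. dm r S \<longrightarrow> (\<exists>q\<in>elts P. elts r \<subseteq> elts q \<and> A t q) \<longrightarrow>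
     (\<exists>q\<in>elts P. elts r \<subseteq> elts q \<and> A t q \<and> dm q S))"
proof -
  obtain c where c: "Fn c" "elts T \<subseteq> c ` elts omega" using T(2) unfolding ctbl_def by blast
  define R where "R n S S' \<longleftrightarrow> elts S \<subseteq> elts S' \<and> (\<forall>i\<in>elts n. \<forall>r\<in>elts P. dm r S \<longrightarrow> c i \<in> elts T \<longrightarrow>
     (\<exists>q\<in>elts P. elts r \<subseteq> elts q \<and> A (c i) q) \<longrightarrow> (\<exists>q\<in>elts P. elts r \<subseteq> elts q \<and> A (c i) q \<and> dm q S'))" for n S S'
  have A2: "Fn f \<Longrightarrow> Fn g \<Longrightarrow> dfn (\<lambda>x. A (f x) (g x))" for f g
    using dfn_comp[OF A, of "\<lambda>x. pair (f x) (g x)"] by (simp add: dfn_intros)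
  have ex: "\<exists>S'\<in>elts (vFin k). R (nat_code n) S S'" if S: "S \<in> elts (vFin k)" for n S
  proof -
    \<comment> \<open>A stage handles the first \<open>n\<close> members of \<open>T\<close> only.
      As \<open>S\<close> is finite, just finitely many conditions live on it, so one extension for
      each task adds finitely many coordinates.\<close>
    define I where "I = {(i, r). i \<in> elts (nat_code n) \<and> r \<in> elts P \<and> dm r S \<and> (\<exists>q\<in>elts P. elts r \<subseteq> elts q \<and> A (c i) q)}"
    have "vtimes S (nat_code 2) = vset ((\<lambda>(x, y). pair x y) ` (elts S \<times> elts (nat_code 2)))"
      by (simp add: V_eq_iff elts_vtimes)
    have "r \<in> vset ` Pow ((\<lambda>(x, y). pair x y) ` (elts S \<times> {nat_code 0, nat_code 1}))" if r: "r \<in> elts P" "dm r S" for r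
    proof (rule image_eqI[of r vset "elts r"])
      have "elts r \<subseteq> (\<Union>\<alpha>\<in>elts k. {pair \<alpha> (nat_code 0), pair \<alpha> (nat_code 1)})"
        using r(1) unfolding P_Fn2 Fn2_def by blast
      then show "elts r \<in> Pow ((\<lambda>(x, y). pair x y) ` (elts S \<times> {nat_code 0, nat_code 1}))"
        using r(2) unfolding dm_def by fastforce
    qed simp
    then have "I \<subseteq> elts (nat_code n) \<times> (vset ` Pow ((\<lambda>(x, y). pair x y) ` (elts S \<times> {nat_code 0, nat_code 1})))"
      unfolding I_def by blast
    then have "finite I" by (rule finite_subset) (use S in simp)
    have "\<forall>ir\<in>I. \<exists>q. q \<in> elts P \<and> elts (snd ir) \<subseteq> elts q \<and> A (c (fst ir)) q"
      unfolding I_def by auto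
    then obtain q where q: "\<And>ir. ir \<in> I \<Longrightarrow> q ir \<in> elts P \<and> elts (snd ir) \<subseteq> elts (q ir) \<and> A (c (fst ir)) (q ir)"
      by metis
    define X where "X = elts S \<union> (\<Union>ir\<in>I. vfst ` elts (q ir))"
    have "vfst u \<in> elts k" if "ir \<in> I" "u \<in> elts (q ir)" for ir u
      using q[OF that(1)] P_pair that(2) by blast
    then have X: "finite X" "X \<subseteq> elts k"
      unfolding X_def using \<open>finite I\<close> S q P_fin by auto
    then have eX: "elts (vset X) = X" by (simp add: countable_finite)
    have "R (nat_code n) S (vset X)"
      unfolding R_def eX
    proof (intro conjI ballI impI)
      show "elts S \<subseteq> X" unfolding X_def by blast
      fix i r assume "i \<in> elts (nat_code n)" "r \<in> elts P" "dm r S" "c i \<in> elts T" "\<exists>q\<in>elts P. elts r \<subseteq> elts q \<and> A (c i) q"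
      then have I: "(i, r) \<in> I" unfolding I_def by blast
      then have "dm (q (i, r)) (vset X)" unfolding dm_def eX unfolding X_def by blast
      then show "\<exists>q\<in>elts P. elts r \<subseteq> elts q \<and> A (c i) q \<and> dm q (vset X)" using q[OF I] by auto
    qed
    then show ?thesis using X eX by (intro bexI[of _ "vset X"]) auto
  qed
  have dR: "dfn (\<lambda>p. R (vfst p) (vfst (vsnd p)) (vsnd (vsnd p)))"
    unfolding R_def by (intro dfn_intros A2 P_M T Fn_comp[OF c(1)])
  have "vempty \<in> elts (vFin k)" by simp
  have "\<exists>f. Fn f \<and> f vempty = vempty \<and> (\<forall>n. f (nat_code n) \<in> elts (vFin k) \<and>
     R (nat_code n) (f (nat_code n)) (f (nat_code (Suc n))))"
    by (rule dependent_choice[of "vFin k" vempty R, OF vFin_M[OF kM] \<open>vempty \<in> elts (vFin k)\<close> dR ex])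
  then obtain f where f': "Fn f \<and> f vempty = vempty \<and> (\<forall>n. f (nat_code n) \<in> elts (vFin k) \<and>
     R (nat_code n) (f (nat_code n)) (f (nat_code (Suc n))))" by (rule exE)
  then have f: "Fn f" "\<And>n. f (nat_code n) \<in> elts (vFin k)"
    "\<And>n. R (nat_code n) (f (nat_code n)) (f (nat_code (Suc n)))" by simp_all
  have mono: "elts (f (nat_code m)) \<subseteq> elts (f (nat_code n))" if "m \<le> n" for m n
    by (rule lift_Suc_mono_le[of "\<lambda>n. elts (f (nat_code n))", OF _ that]) (use f(3) in \<open>auto simp: R_def\<close>)
  define S where "S = vsep k (\<lambda>\<alpha>. \<exists>n\<in>elts omega. \<alpha> \<in> elts (f n))"
  have SM: "S \<in> M" unfolding S_def by (intro vsep_M dfn_intros omega_M kM Fn_comp[OF f(1)])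
  have S: "\<alpha> \<in> elts S \<longleftrightarrow> (\<exists>n. \<alpha> \<in> elts (f (nat_code n)))" for \<alpha>
    unfolding S_def using f(2) by (auto simp: elts_omega)
  \<comment> \<open>Countability of \<open>S\<close> in M is obtained from the order by stage of
    entry and, within a stage, by membership of ordinals. The stages are finite, hence so are the
    initial segments.\<close>
  define L where "L \<alpha> \<beta> \<longleftrightarrow> (\<exists>n\<in>elts omega. \<alpha> \<in> elts (f n) \<and> \<beta> \<notin> elts (f n)) \<or>
     (\<forall>n\<in>elts omega. \<alpha> \<in> elts (f n) \<longleftrightarrow> \<beta> \<in> elts (f n)) \<and> \<alpha> \<in> elts \<beta>" for \<alpha> \<beta>
  have L: "L \<alpha> \<beta> \<longleftrightarrow> (\<exists>n. \<alpha> \<in> elts (f (nat_code n)) \<and> \<beta> \<notin> elts (f (nat_code n))) \<or>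
     (\<forall>n. \<alpha> \<in> elts (f (nat_code n)) \<longleftrightarrow> \<beta> \<in> elts (f (nat_code n))) \<and> \<alpha> \<in> elts \<beta>" for \<alpha> \<beta>
    unfolding L_def by (simp add: elts_omega)
  have Sk: "\<alpha> \<in> elts k" if "\<alpha> \<in> elts S" for \<alpha> using that by (simp add: S_def)
  have "ctbl S"
  proof (rule ctbl_order[OF SM, of L])
    show "dfn (\<lambda>p. L (vfst p) (vsnd p))"
      unfolding L_def by (intro dfn_intros omega_M Fn_comp[OF f(1)])
    show "finite {\<alpha> \<in> elts S. L \<alpha> \<beta>}" if b: "\<beta> \<in> elts S" for \<beta>
    proof -
      obtain n where n: "\<beta> \<in> elts (f (nat_code n))" using S[of \<beta>] b by auto
      have "{\<alpha> \<in> elts S. L \<alpha> \<beta>} \<subseteq> elts (f (nat_code n))"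
      proof
        fix \<alpha> assume "\<alpha> \<in> {\<alpha> \<in> elts S. L \<alpha> \<beta>}"
        then consider m where "\<alpha> \<in> elts (f (nat_code m))" "\<beta> \<notin> elts (f (nat_code m))"
          | "\<alpha> \<in> elts (f (nat_code n))"
          unfolding L using n by blast
        then show "\<alpha> \<in> elts (f (nat_code n))"
        proof cases
          case 1
          then have "m \<le> n" using n mono[of n m] by (meson nat_le_linear subsetD)
          with 1 mono[of m n] show ?thesis by blast
        qed
      qed
      then show ?thesis by (rule finite_subset) (use f(2)[of n] in simp)
    qed
    show "\<not> L \<alpha> \<alpha>" for \<alpha> unfolding L by simp
    show "L \<alpha> \<beta> \<or> L \<beta> \<alpha>" if "\<alpha> \<in> elts S" "\<beta> \<in> elts S" "\<alpha> \<noteq> \<beta>" for \<alpha> \<beta>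
      using ordinal_linear[OF k_ord Sk[OF that(1)] Sk[OF that(2)]] that(3) unfolding L by blast
    show "L \<alpha> \<gamma>" if "\<alpha> \<in> elts S" "\<beta> \<in> elts S" and g: "\<gamma> \<in> elts S" and l: "L \<alpha> \<beta>" "L \<beta> \<gamma>" for \<alpha> \<beta> \<gamma>
    proof -
      have *: "\<alpha> \<in> elts \<gamma>" if "\<alpha> \<in> elts \<beta>" "\<beta> \<in> elts \<gamma>"
        using ordinal_trans[OF k_ord that Sk[OF g]] .
      show ?thesis
      proof (cases "\<exists>m. \<beta> \<in> elts (f (nat_code m)) \<and> \<gamma> \<notin> elts (f (nat_code m))")
        case True
        then obtain m where m: "\<beta> \<in> elts (f (nat_code m))" "\<gamma> \<notin> elts (f (nat_code m))" by blast
        show ?thesis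
        proof (cases "\<alpha> \<in> elts (f (nat_code m))")
          case False
          then obtain n where n: "\<alpha> \<in> elts (f (nat_code n))" "\<beta> \<notin> elts (f (nat_code n))"
            using l(1) m(1) unfolding L by blast
          then have "n \<le> m" using m mono by (meson nat_le_linear subsetD)
          then show ?thesis using mono n False by blast
        qed (use m in \<open>auto simp: L\<close>)
      next
        case False
        then have b: "\<forall>n. \<beta> \<in> elts (f (nat_code n)) \<longleftrightarrow> \<gamma> \<in> elts (f (nat_code n))" "\<beta> \<in> elts \<gamma>"
          using l(2) unfolding L by blast+
        then show ?thesis using l(1) * unfolding L by blast
      qed
    qed
  qed
  moreover have "\<exists>q\<in>elts P. elts r \<subseteq> elts q \<and> A t q \<and> dm q S"
    if t: "t \<in> elts T" "r \<in> elts P" "dm r S" "\<exists>q\<in>elts P. elts r \<subseteq> elts q \<and> A t q" for t r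
  proof -
    obtain m where m: "t = c (nat_code m)" using c(2) t(1) by (auto simp: elts_omega)
    have "\<forall>u\<in>elts r. \<exists>n. vfst u \<in> elts (f (nat_code n))" using t(3) S unfolding dm_def by blast
    then obtain h where h: "\<And>u. u \<in> elts r \<Longrightarrow> vfst u \<in> elts (f (nat_code (h u)))" by metis
    \<comment> \<open>Stage \<open>n\<close> contains the whole domain of \<open>r\<close>. The
      entry \<open>Suc m\<close> ensures \<open>m < n\<close>, as stage \<open>n\<close> treats the
      indices strictly below \<open>n\<close>.\<close>
    define n where "n = Max (insert (Suc m) (h ` elts r))"
    have fin: "finite (insert (Suc m) (h ` elts r))" using P_fin[OF t(2)] by simp
    have n: "h u \<le> n" if "u \<in> elts r" for u unfolding n_def using fin that by (intro Max_ge) auto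
    have "m < n" using Max_ge[OF fin, of "Suc m"] unfolding n_def by simp
    have "dm r (f (nat_code n))" unfolding dm_def using h n mono by blast
    then obtain q where "q \<in> elts P" "elts r \<subseteq> elts q" "A t q" "dm q (f (nat_code (Suc n)))"
      using f(3)[of n, unfolded R_def, THEN conjunct2, rule_format, of "nat_code m" r] \<open>m < n\<close> t
      unfolding m by auto
    then show ?thesis using S unfolding dm_def by blast
  qed
  ultimately show ?thesis using SM by blast
qed

text \<open>\<open>Y i\<close> contains what the i-th condition on the countable support does not
  exclude from X. If X misses C, some \<open>p\<close> in the filter forbids X to meet C. The
  restriction \<open>r\<close> of \<open>p\<close> to the support gives a superset of X; if that
  superset meets C in \<open>t\<close>, an extension of \<open>r\<close> putting \<open>t\<close>
  into X can be taken on the support as well. It is then compatible with \<open>p\<close>, a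
  contradiction.\<close>

lemma countable_approx:
  assumes X: "X \<in> N" "elts X \<subseteq> elts T" and T: "T \<in> M" "ctbl T"
  shows "\<exists>Y. Fn Y \<and> (\<forall>i. elts (Y i) \<subseteq> elts T) \<and>
    (\<forall>C\<in>M. (\<forall>i\<in>elts omega. elts X \<subseteq> elts (Y i) \<longrightarrow> elts (Y i) \<inter> elts C \<noteq> {}) \<longrightarrow> elts X \<inter> elts C \<noteq> {})"
proof -
  obtain A where A: "dfn (\<lambda>p. A (vfst p) (vsnd p))" and A': "\<forall>t\<in>M. t \<in> elts X \<longleftrightarrow> (\<exists>p\<in>G. A t p)"
    "\<forall>t p q. A t p \<longrightarrow> elts p \<subseteq> elts q \<longrightarrow> q \<in> elts P \<longrightarrow> A t q"
    using nice_name[OF X(1)] by blast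
  note A = A A'[rule_format]
  have A2: "Fn f \<Longrightarrow> Fn g \<Longrightarrow> dfn (\<lambda>x. A (f x) (g x))" for f g
    using dfn_comp[OF A(1), of "\<lambda>x. pair (f x) (g x)"] by (simp add: dfn_intros)
  have tM: "t \<in> M" if "t \<in> elts T" for t using that T(1) mem_M by blast
  obtain S where S: "S \<in> M" "ctbl S"
    "\<And>t r. t \<in> elts T \<Longrightarrow> r \<in> elts P \<Longrightarrow> dm r S \<Longrightarrow> (\<exists>q\<in>elts P. elts r \<subseteq> elts q \<and> A t q) \<Longrightarrow>
     (\<exists>q\<in>elts P. elts r \<subseteq> elts q \<and> A t q \<and> dm q S)"
    using countable_support[OF A(1) T] by blast
  define FS where "FS = vsep P (\<lambda>r. dm r S)"
  have FSM: "FS \<in> M" unfolding FS_def by (intro vsep_M dfn_intros P_M S)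
  have "ctbl FS"
    by (rule ctbl_subset[OF ctbl_Fin[OF ctbl_times[OF S(2) ctbl_omega]]])
       (auto simp: FS_def P_fin dest: P_sub_vtimes)
  then obtain d where d: "Fn d" "elts FS \<subseteq> d ` elts omega" unfolding ctbl_def by blast
  define Y where "Y i = vsep T (\<lambda>t. d i \<in> elts FS \<and> (\<exists>q\<in>elts P. elts (d i) \<subseteq> elts q \<and> A t q))" for i
  have "Fn Y" unfolding Y_def by (intro dfn_intros A2 FSM P_M T Fn_comp[OF d(1)])
  moreover have "elts X \<inter> elts C \<noteq> {}"
    if C: "C \<in> M" and h: "\<forall>i\<in>elts omega. elts X \<subseteq> elts (Y i) \<longrightarrow> elts (Y i) \<inter> elts C \<noteq> {}" for C
  proof
    assume disj: "elts X \<inter> elts C = {}"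
    obtain p0 where "p0 \<in> G" using G_ne by blast
    have "\<exists>p\<in>G. ((\<exists>t\<in>elts C. t \<in> elts T \<and> A t p) \<or>
        (\<forall>q\<in>elts P. elts p \<subseteq> elts q \<longrightarrow> (\<forall>t\<in>elts C. t \<in> elts T \<longrightarrow> \<not> A t q))) \<and> elts p0 \<subseteq> elts p"
    proof (rule generic_dfn[OF _ \<open>p0 \<in> G\<close>])
      show "dfn (\<lambda>p. (\<exists>t\<in>elts C. t \<in> elts T \<and> A t p) \<or>
        (\<forall>q\<in>elts P. elts p \<subseteq> elts q \<longrightarrow> (\<forall>t\<in>elts C. t \<in> elts T \<longrightarrow> \<not> A t q)))"
        by (intro dfn_intros A2 C T P_M)
    qed blast
    then obtain p where pG: "p \<in> G" and alt: "(\<exists>t\<in>elts C. t \<in> elts T \<and> A t p) \<or>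
        (\<forall>q\<in>elts P. elts p \<subseteq> elts q \<longrightarrow> (\<forall>t\<in>elts C. t \<in> elts T \<longrightarrow> \<not> A t q))" by blast
    have "\<not> (t \<in> elts C \<and> t \<in> elts T \<and> A t p)" for t
      using A(2)[OF tM, of t] disj pG by blast
    with alt have p: "p \<in> G" "\<And>q t. q \<in> elts P \<Longrightarrow> elts p \<subseteq> elts q \<Longrightarrow> t \<in> elts C \<Longrightarrow> t \<in> elts T \<Longrightarrow> \<not> A t q"
      using pG by auto
    define r where "r = vsep p (\<lambda>u. vfst u \<in> elts S)"
    have rp: "elts r \<subseteq> elts p" unfolding r_def by auto
    have rP: "r \<in> elts P" using P_down[OF G_P[OF p(1)] rp] .
    have rG: "r \<in> G" using G_up[OF p(1) rP rp] .
    have rS: "dm r S" unfolding dm_def r_def by simp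
    then have "r \<in> elts FS" unfolding FS_def using rP by simp
    then obtain i where i: "i \<in> elts omega" "d i = r" using d(2) by blast
    have Yi: "t \<in> elts (Y i) \<longleftrightarrow> t \<in> elts T \<and> (\<exists>q\<in>elts P. elts r \<subseteq> elts q \<and> A t q)" for t
      unfolding Y_def i using \<open>r \<in> elts FS\<close> by simp
    have "elts X \<subseteq> elts (Y i)"
    proof
      fix t assume t: "t \<in> elts X"
      then have tT: "t \<in> elts T" using X(2) by blast
      then obtain q where q: "q \<in> G" "A t q" using A(2)[OF tM] t by blast
      obtain s where s: "s \<in> G" "elts q \<subseteq> elts s" "elts r \<subseteq> elts s" using G_dir[OF q(1) rG] by blast
      then have "A t s" using A(3) q(2) G_P by blast
      then show "t \<in> elts (Y i)" unfolding Yi using tT s G_P by blast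
    qed
    then obtain t where t: "t \<in> elts (Y i)" "t \<in> elts C" using h i(1) by blast
    then obtain q where q: "q \<in> elts P" "elts r \<subseteq> elts q" "A t q" "dm q S"
      using S(3)[OF _ rP rS] unfolding Yi by blast
    have "\<exists>s\<in>elts P. elts p \<subseteq> elts s \<and> elts q \<subseteq> elts s"
      by (rule P_join[OF G_P[OF p(1)] q(1,4)]) (use q(2) in \<open>auto simp: r_def\<close>)
    then show False using p(2) t q A(3) unfolding Yi by blast
  qed
  moreover have "elts (Y i) \<subseteq> elts T" for i unfolding Y_def by auto
  ultimately show ?thesis by blast
qed

end

section \<open>Catching sets of finite patterns\<close>

text \<open>A pattern is a pair of finite sets of sets, those to be hit and those to be missed by a
  finite set of naturals. Elements of the sets \<open>Y\<close> below are pairs of a natural number and a finite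
  set of naturals.\<close>

definition hits :: "V \<Rightarrow> V \<Rightarrow> bool" where
  "hits s a \<longleftrightarrow> (\<forall>e\<in>elts a. \<exists>x\<in>elts s. x \<in> elts e)"

definition misses :: "V \<Rightarrow> V \<Rightarrow> bool" where
  "misses s b \<longleftrightarrow> (\<forall>e\<in>elts b. \<forall>x\<in>elts s. x \<notin> elts e)"

definition rem :: "V \<Rightarrow> V \<Rightarrow> V" where
  "rem s D = vsep s (\<lambda>x. \<forall>e\<in>elts D. x \<notin> elts e)"

text \<open>One number \<open>j\<close> serves both as a bound for the first coordinate and as the
  number of points outside the union of \<open>D\<close>; both requirements become stronger as
  \<open>j\<close> grows. The set \<open>FB\<close> of admissible finite sets is an argument, so
  that the notion can be used in N as soon as \<open>FB\<close> belongs to N.\<close>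

definition big :: "V \<Rightarrow> V \<Rightarrow> V \<Rightarrow> V \<Rightarrow> bool" where
  "big FB Y a b \<longleftrightarrow> (\<forall>D\<in>elts FB. \<forall>j\<in>elts omega. \<exists>t\<in>elts Y. elts j \<subseteq> elts (vfst t) \<and>
     hits (vsnd t) a \<and> misses (vsnd t) b \<and> natle j (rem (vsnd t) D))"

text \<open>The point in \<open>x\<close> allows a tail of \<open>x\<close> to join the sets to be
  hit, and the \<open>j\<close> points outside \<open>x\<close> allow \<open>x\<close> to join the
  union of \<open>D\<close>. Together they make a big pattern big again when \<open>x\<close> counts
  among the earlier sets.\<close>

definition catch :: "V \<Rightarrow> V \<Rightarrow> V \<Rightarrow> bool" where
  "catch FB Y x \<longleftrightarrow> (\<forall>a\<in>elts FB. \<forall>b\<in>elts FB. \<forall>D\<in>elts FB. \<forall>j\<in>elts omega. big FB Y a b \<longrightarrow>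
     (\<exists>t\<in>elts Y. elts j \<subseteq> elts (vfst t) \<and> hits (vsnd t) a \<and> misses (vsnd t) b \<and>
       (\<exists>y\<in>elts (rem (vsnd t) D). y \<in> elts x) \<and> natle j (vsep (rem (vsnd t) D) (\<lambda>y. y \<notin> elts x))))"

definition cut_below :: "V \<Rightarrow> V \<Rightarrow> V" where
  "cut_below a m = vsep a (\<lambda>x. x \<notin> elts m)"

text \<open>Singletons and tails are the traces on \<omega> of basic neighbourhoods in the
  Isbell-Mrowka space. Finite unions of them also absorb any finite set of exceptions.\<close>

definition Bs :: "V \<Rightarrow> V" where
  "Bs AA = vUn (vins (vimg (\<lambda>k. vins k vempty) omega)
     (vins (vimg (\<lambda>u. cut_below (vfst u) (vsnd u)) (vtimes AA omega)) vempty))"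

lemma Bs_iff: "e \<in> elts (Bs AA) \<longleftrightarrow> (\<exists>k. e = vins (nat_code k) vempty) \<or>
    (\<exists>a\<in>elts AA. \<exists>m. e = cut_below a (nat_code m))"
  by (auto simp: Bs_def elts_vtimes elts_omega image_iff)

definition T0 :: V where "T0 = vtimes omega (vFin omega)"

lemma T0_E: assumes "t \<in> elts T0"
  obtains j s where "t = pair (nat_code j) s" "finite (elts s)" "elts s \<subseteq> elts omega"
  using assms unfolding T0_def by (auto elim!: vtimesE simp: elts_omega)

lemma natle_mono: "natle j x \<Longrightarrow> elts x \<subseteq> elts y \<Longrightarrow> natle j y"
  unfolding natle_def by blast

context nmodel
begin

lemma dfn_hits [dfn_intros]: assumes f: "Fn f" and g: "Fn g" shows "dfn (\<lambda>x. hits (f x) (g x))"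
  unfolding hits_def by (intro dfn_intros g Fn_comp[OF f])

lemma dfn_misses [dfn_intros]: assumes f: "Fn f" and g: "Fn g" shows "dfn (\<lambda>x. misses (f x) (g x))"
  unfolding misses_def by (intro dfn_intros g Fn_comp[OF f])

lemma Fn_rem [dfn_intros]: assumes f: "Fn f" and g: "Fn g" shows "Fn (\<lambda>x. rem (f x) (g x))"
  unfolding rem_def by (intro dfn_intros f Fn_comp[OF g])

lemma dfn_big [dfn_intros]:
  assumes f: "Fn f" and g: "Fn g" and h: "Fn h" and k: "Fn k"
  shows "dfn (\<lambda>x. big (f x) (g x) (h x) (k x))"
  unfolding big_def by (intro dfn_intros omega_M f Fn_comp[OF f] Fn_comp[OF g] Fn_comp[OF h] Fn_comp[OF k])

lemma dfn_catch [dfn_intros]: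
  assumes f: "Fn f" and g: "Fn g" and h: "Fn h"
  shows "dfn (\<lambda>x. catch (f x) (g x) (h x))"
  unfolding catch_def by (intro dfn_intros omega_M f Fn_comp[OF f] Fn_comp[OF g] Fn_comp[OF h])

lemma Fn_cut_below [dfn_intros]:
  assumes f: "Fn f" and g: "Fn g" shows "Fn (\<lambda>x. cut_below (f x) (g x))"
  unfolding cut_below_def by (intro dfn_intros f Fn_comp[OF g])

end

context zmodel
begin

lemma Fn_Bs [dfn_intros]: assumes f: "Fn f" shows "Fn (\<lambda>x. Bs (f x))"
  unfolding Bs_def by (intro dfn_intros omega_M vempty_M f)

lemma Bs_M [simp, intro]: "AA \<in> M \<Longrightarrow> Bs AA \<in> M"
  using FnD[OF Fn_Bs[OF Fn_id]] .

lemma T0_M [simp, intro]: "T0 \<in> M"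
  unfolding T0_def by (intro vtimes_M vFin_M omega_M)

lemma ctbl_T0: "ctbl T0"
  unfolding T0_def by (intro ctbl_times ctbl_Fin ctbl_omega)

lemma ctbl_Bs: assumes "ctbl AA" shows "ctbl (Bs AA)"
proof (rule ctbl_Un)
  show "ctbl (vimg (\<lambda>k. vins k vempty) omega)"
    by (rule ctblI[OF _ ctbl_omega, of "\<lambda>k. vins k vempty"]) (intro dfn_intros vempty_M, simp)
  show "ctbl (vimg (\<lambda>u. cut_below (vfst u) (vsnd u)) (vtimes AA omega))"
    by (rule ctblI[OF _ ctbl_times[OF assms ctbl_omega], of "\<lambda>u. cut_below (vfst u) (vsnd u)"])
      (intro dfn_intros, simp)
qed (auto simp: Bs_def)

text \<open>A finite-condition construction in M: a stage is a disjoint pair of finite sets, the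
  numbers put into \<open>x\<close> and those kept out. New numbers avoid the members of
  \<open>AA\<close> listed so far, which yields almost disjointness. A task is met by an element of
  \<open>Y\<close> with enough undecided points: one of them goes into \<open>x\<close> and the
  others are kept out.\<close>

lemma catch_exists:
  assumes AA: "AA \<in> M" "ctbl AA" "\<And>a. a \<in> elts AA \<Longrightarrow> elts a \<subseteq> elts omega"
    and YY: "YY \<in> M" "ctbl YY" "\<And>Y. Y \<in> elts YY \<Longrightarrow> elts Y \<subseteq> elts T0"
  shows "\<exists>x\<in>M. elts x \<subseteq> elts omega \<and> (\<forall>a\<in>elts AA. finite (elts (vsep x (\<lambda>y. y \<in> elts a)))) \<and>
    (\<forall>Y\<in>elts YY. catch (vFin (Bs AA)) Y x)"
proof -
  define FB where "FB = vFin (Bs AA)"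
  have FB_M: "FB \<in> M" unfolding FB_def using AA by blast
  have "ctbl FB" unfolding FB_def by (intro ctbl_Fin ctbl_Bs AA)
  obtain hA where hA: "Fn hA" "elts AA \<subseteq> hA ` elts omega" using AA(2) unfolding ctbl_def by blast
  define RQ where "RQ = vtimes YY (vtimes (vtimes FB FB) (vtimes FB omega))"
  have RQ_M: "RQ \<in> M" unfolding RQ_def by (intro vtimes_M YY FB_M omega_M)
  have "ctbl RQ" unfolding RQ_def by (intro ctbl_times YY \<open>ctbl FB\<close> ctbl_omega)
  then obtain hR where hR: "Fn hR" "elts RQ \<subseteq> hR ` elts omega" unfolding ctbl_def by blast
  \<comment> \<open>The requirement of \<open>catch\<close> for a stage \<open>B\<close>. Points
    outside \<open>x\<close> are replaced by points already promised to stay outside, so a task once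
    met remains met.\<close>
  define met where "met B Y a b D j \<longleftrightarrow> (big FB Y a b \<longrightarrow>
     (\<exists>t\<in>elts Y. elts j \<subseteq> elts (vfst t) \<and> hits (vsnd t) a \<and> misses (vsnd t) b \<and>
       (\<exists>y\<in>elts (rem (vsnd t) D). y \<in> elts (vfst B)) \<and> natle j (vsep (rem (vsnd t) D) (\<lambda>y. y \<in> elts (vsnd B)))))"
    for B Y a b D j
  define T where "T = vsep (vtimes (vFin omega) (vFin omega)) (\<lambda>t. \<forall>x\<in>elts (vfst t). x \<notin> elts (vsnd t))"
  have T_M: "T \<in> M" unfolding T_def by (intro vsep_M dfn_intros vtimes_M vFin_M omega_M)
  define R where "R n t t' \<longleftrightarrow> elts (vfst t) \<subseteq> elts (vfst t') \<and> elts (vsnd t) \<subseteq> elts (vsnd t') \<and>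
     (\<forall>x\<in>elts (vfst t'). x \<notin> elts (vfst t) \<longrightarrow> (\<forall>i\<in>elts n. hA i \<in> elts AA \<longrightarrow> x \<notin> elts (hA i))) \<and>
     (hR n \<in> elts RQ \<longrightarrow> met t' (vfst (hR n)) (vfst (vfst (vsnd (hR n)))) (vsnd (vfst (vsnd (hR n))))
        (vfst (vsnd (vsnd (hR n)))) (vsnd (vsnd (vsnd (hR n)))))" for n t t'
  have dR: "dfn (\<lambda>p. R (vfst p) (vfst (vsnd p)) (vsnd (vsnd p)))"
    unfolding R_def met_def by (intro dfn_intros Fn_comp[OF hA(1)] Fn_comp[OF hR(1)] AA RQ_M FB_M)
  have ex: "\<exists>t'\<in>elts T. R (nat_code n) t t'" if t: "t \<in> elts T" for n t
  proof -
    obtain a b where ab0: "t = pair a b" "finite (elts a)" "finite (elts b)" "elts a \<subseteq> elts omega" "elts b \<subseteq> elts omega"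
      using t unfolding T_def by (auto elim!: vtimesE)
    have "elts a \<inter> elts b = {}" using t unfolding T_def ab0(1) by auto
    note ab = ab0 this
    show ?thesis
    proof (cases "hR (nat_code n) \<in> elts RQ \<and> \<not> met t (vfst (hR (nat_code n))) (vfst (vfst (vsnd (hR (nat_code n))))) (vsnd (vfst (vsnd (hR (nat_code n)))))
        (vfst (vsnd (vsnd (hR (nat_code n))))) (vsnd (vsnd (vsnd (hR (nat_code n)))))")
      case False
      then have "R (nat_code n) t t" unfolding R_def by blast
      with t show ?thesis by blast
    next
      case True
      then obtain Y a0 b0 D j where u: "hR (nat_code n) = pair Y (pair (pair a0 b0) (pair D (nat_code j)))"
        "Y \<in> elts YY" "a0 \<in> elts FB" "b0 \<in> elts FB" "D \<in> elts FB"
        unfolding RQ_def by (auto elim!: vtimesE simp: elts_omega)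
      with True have bg: "big FB Y a0 b0" unfolding met_def by simp
      \<comment> \<open>A point outside all these sets is outside \<open>D\<close>, outside the
        members of \<open>AA\<close> listed up to now, and undecided. The set is an admissible
        \<open>D\<close>, so bigness supplies such points.\<close>
      define E where "E = elts D \<union> (\<lambda>i. hA (nat_code i)) ` {i. i < n \<and> hA (nat_code i) \<in> elts AA} \<union>
         (\<lambda>k. vins k vempty) ` (elts a \<union> elts b)"
      have fE: "finite E" unfolding E_def using u(5) ab by (auto simp: FB_def)
      then have eE: "elts (vset E) = E" by (simp add: countable_finite)
      have "cut_below x vempty = x" for x unfolding cut_below_def by (rule V_eqI) simp
      then have "x \<in> elts (Bs AA)" if "x \<in> elts AA" for x
        using that unfolding Bs_iff vempty_nat_code by metis
      moreover have "vins k vempty \<in> elts (Bs AA)" if "k \<in> elts omega" for k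
        using that unfolding Bs_iff elts_omega by blast
      ultimately have "E \<subseteq> elts (Bs AA)"
        unfolding E_def using u(5) ab(4,5) by (auto simp: FB_def)
      then have "vset E \<in> elts FB" using fE eE unfolding FB_def by simp
      \<comment> \<open>One point more than demanded: it is spent on meeting \<open>x\<close>, and
        \<open>j\<close> points remain to be kept out.\<close>
      then obtain s where s: "s \<in> elts Y" "elts (nat_code (Suc j)) \<subseteq> elts (vfst s)" "hits (vsnd s) a0"
        "misses (vsnd s) b0" "natle (nat_code (Suc j)) (rem (vsnd s) (vset E))"
        using bg nat_code_omega[of "Suc j"] unfolding big_def by blast
      have "s \<in> elts T0" using YY(3)[OF u(2)] s(1) by blast
      then have sf: "finite (elts (vsnd s))" "elts (vsnd s) \<subseteq> elts omega"
        by (rule T0_E, simp)+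
      define W where "W = elts (rem (vsnd s) (vset E))"
      have W: "finite W" "W \<subseteq> elts omega" "Suc j \<le> card W"
        using sf s(5) unfolding natle_iff W_def by (auto simp: rem_def)
      have W_E: "x \<notin> e" if "x \<in> W" "e \<in> elts ` E" for x e
        using that eE unfolding W_def rem_def by auto
      obtain y where y: "y \<in> W" using W(3) by fastforce
      define t' where "t' = pair (vins y a) (vset (elts b \<union> (W - {y})))"
      have eb: "elts (vset (elts b \<union> (W - {y}))) = elts b \<union> (W - {y})" using W(1) by (simp add: countable_finite)
      have Wab: "W \<inter> (elts a \<union> elts b) = {}"
      proof -
        have "False" if "x \<in> W" "x \<in> elts a \<union> elts b" for x
        proof -
          have "vins x vempty \<in> E" using that(2) unfolding E_def by blast
          from W_E[OF that(1) imageI[OF this]] show False by simp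
        qed
        then show ?thesis by blast
      qed
      have t'T: "t' \<in> elts T"
        unfolding T_def t'_def using ab W y Wab eb by (auto simp del: elts_vset)
      have yA: "y \<notin> elts (hA i)" if i: "i \<in> elts (nat_code n)" "hA i \<in> elts AA" for i
      proof -
        obtain m where "i = nat_code m" "m < n" using i(1) by (auto simp: elts_nat_code)
        then have "hA i \<in> E" using i(2) unfolding E_def by auto
        then show ?thesis using W_E[OF y] by blast
      qed
      have WD: "W \<subseteq> elts (rem (vsnd s) D)" unfolding W_def rem_def using eE by (auto simp: E_def)
      have "natle (nat_code j) (vsep (rem (vsnd s) D) (\<lambda>x. x \<in> elts (vsnd t')))"
      proof (rule natle_mono)
        show "natle (nat_code j) (vset (W - {y}))" using W y by (simp add: natle_iff countable_finite)
        show "elts (vset (W - {y})) \<subseteq> elts (vsep (rem (vsnd s) D) (\<lambda>x. x \<in> elts (vsnd t')))"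
          using WD W(1) eb unfolding t'_def by (auto simp: countable_finite simp del: elts_vset)
            (auto simp: countable_finite)
      qed
      moreover have "\<exists>x\<in>elts (rem (vsnd s) D). x \<in> elts (vfst t')" using WD y unfolding t'_def by auto
      moreover have "elts (nat_code j) \<subseteq> elts (vfst s)" by (rule subset_trans[OF _ s(2)]) simp
      ultimately have "met t' Y a0 b0 D (nat_code j)" unfolding met_def using s by blast
      then have "R (nat_code n) t t'"
        unfolding R_def u using yA ab(1) eb unfolding t'_def by auto
      with t'T show ?thesis by blast
    qed
  qed
  have "pair vempty vempty \<in> elts T" unfolding T_def by simp
  then have "\<exists>f. Fn f \<and> f vempty = pair vempty vempty \<and> (\<forall>n. f (nat_code n) \<in> elts T \<and>
     R (nat_code n) (f (nat_code n)) (f (nat_code (Suc n))))"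
    by (intro dependent_choice T_M dR ex)
  then obtain f where f': "Fn f \<and> f vempty = pair vempty vempty \<and> (\<forall>n. f (nat_code n) \<in> elts T \<and>
     R (nat_code n) (f (nat_code n)) (f (nat_code (Suc n))))" by (rule exE)
  then have f: "Fn f" "\<And>n. f (nat_code n) \<in> elts T"
     "\<And>n. R (nat_code n) (f (nat_code n)) (f (nat_code (Suc n)))" by simp_all
  define a where "a n = elts (vfst (f (nat_code n)))" for n
  define b where "b n = elts (vsnd (f (nat_code n)))" for n
  have amono: "a m \<subseteq> a n" and bmono: "b m \<subseteq> b n" if "m \<le> n" for m n
    by (rule lift_Suc_mono_le[OF _ that]; use f(3) in \<open>simp add: a_def b_def R_def\<close>)+
  have disj: "a n \<inter> b n = {}" "finite (a n)" "a n \<subseteq> elts omega" for n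
    using f(2)[of n] unfolding a_def b_def T_def by (auto elim!: vtimesE)
  have disj2: "a m \<inter> b n = {}" for m n
    using disj(1)[of "max m n"] amono[of m "max m n"] bmono[of n "max m n"] by auto
  define x where "x = vsep omega (\<lambda>y. \<exists>n\<in>elts omega. y \<in> elts (vfst (f n)))"
  have xM: "x \<in> M" unfolding x_def by (intro vsep_M dfn_intros omega_M Fn_comp[OF f(1)])
  have x: "y \<in> elts x \<longleftrightarrow> (\<exists>n. y \<in> a n)" for y
    using disj(3) unfolding x_def a_def by (auto simp: elts_omega)
  have "finite (elts (vsep x (\<lambda>y. y \<in> elts A)))" if A: "A \<in> elts AA" for A
  proof -
    obtain i where i: "A = hA (nat_code i)" using A hA(2) by (auto simp: elts_omega)
    \<comment> \<open>The step from stage \<open>m\<close> to \<open>Suc m\<close> respects the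
      indices below \<open>m\<close>. So points of the i-th set can enter only up to stage
      \<open>Suc i\<close>.\<close>
    have "y \<in> a (Suc i)" if "y \<in> a m" "y \<in> elts A" for m y
      using that(1)
    proof (induction m)
      case (Suc m)
      show ?case
      proof (cases "y \<in> a m \<or> Suc m \<le> Suc i")
        case True
        then show ?thesis using Suc amono[of "Suc m" "Suc i"] by blast
      next
        case False
        then have "y \<notin> elts (hA (nat_code i))"
          using f(3)[of m] Suc.prems A i unfolding R_def a_def by (auto simp del: nat_code.simps)
        with that(2) i show ?thesis by blast
      qed
    qed (use amono[of 0 "Suc i"] in blast)
    then have "elts (vsep x (\<lambda>y. y \<in> elts A)) \<subseteq> a (Suc i)" using x by auto
    then show ?thesis using disj(2) finite_subset by blast
  qed
  moreover have "catch FB Y x" if Y: "Y \<in> elts YY" for Y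
    unfolding catch_def
  proof (intro ballI impI)
    fix a0 b0 D j assume h: "a0 \<in> elts FB" "b0 \<in> elts FB" "D \<in> elts FB" "j \<in> elts omega" "big FB Y a0 b0"
    let ?u = "pair Y (pair (pair a0 b0) (pair D j))"
    have u: "?u \<in> elts RQ" unfolding RQ_def using Y h by simp
    then obtain n where n: "hR (nat_code n) = ?u" using hR(2) by (force simp: elts_omega)
    have "met (f (nat_code (Suc n))) Y a0 b0 D j"
      using f(3)[of n] u unfolding R_def n by (simp del: nat_code.simps)
    then obtain t where t: "t \<in> elts Y" "elts j \<subseteq> elts (vfst t)" "hits (vsnd t) a0" "misses (vsnd t) b0"
      "\<exists>y\<in>elts (rem (vsnd t) D). y \<in> a (Suc n)" "natle j (vsep (rem (vsnd t) D) (\<lambda>y. y \<in> b (Suc n)))"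
      unfolding met_def a_def b_def using h by blast
    have "elts (vsep (rem (vsnd t) D) (\<lambda>y. y \<in> b (Suc n))) \<subseteq> elts (vsep (rem (vsnd t) D) (\<lambda>y. y \<notin> elts x))"
      using disj2 x by auto
    then have "natle j (vsep (rem (vsnd t) D) (\<lambda>y. y \<notin> elts x))" by (rule natle_mono[OF t(6)])
    with t x show "\<exists>t\<in>elts Y. elts j \<subseteq> elts (vfst t) \<and> hits (vsnd t) a0 \<and> misses (vsnd t) b0 \<and>
       (\<exists>y\<in>elts (rem (vsnd t) D). y \<in> elts x) \<and> natle j (vsep (rem (vsnd t) D) (\<lambda>y. y \<notin> elts x))"
      by blast
  qed
  moreover have "elts x \<subseteq> elts omega" unfolding x_def by auto
  ultimately show ?thesis using xM unfolding FB_def by blast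
qed

end

section \<open>An indestructible family from CH\<close>

context zmodel
begin

lemma fun_in_Fn: assumes "fun_in M X g" shows "\<exists>F. Fn F \<and> (\<forall>x\<in>X. F x = g x)"
proof -
  obtain f where f: "f \<in> M" "elts f = (\<lambda>x. pair x (g x)) ` X"
    using assms unfolding fun_in_def by blast
  have "vapp f x = g x" if "x \<in> X" for x
  proof -
    have ex1: "\<exists>!y. pair x y \<in> elts f" using f(2) that by auto
    have "pair x (g x) \<in> elts f" using f(2) that by blast
    then show ?thesis unfolding vapp_def if_P[OF ex1] by (rule the1_equality[OF ex1])
  qed
  moreover have "Fn (vapp f)" by (intro dfn_intros f)
  ultimately show ?thesis by blast
qed

lemma Fn_fun_in: assumes "Fn F" "x \<in> M" shows "fun_in M (elts x) F"
  unfolding fun_in_def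
  by (rule bexI[of _ "vimg (\<lambda>z. pair z (F z)) x"]) (auto intro!: vimg_M dfn_intros Fn_comp[OF assms(1)] assms)

lemma equipotent_trans:
  assumes "equipotent_in M (elts x) Y" "equipotent_in M Y Z" "x \<in> M" shows "equipotent_in M (elts x) Z"
proof -
  obtain f g where f: "fun_in M (elts x) f" "bij_betw f (elts x) Y" and g: "fun_in M Y g" "bij_betw g Y Z"
    using assms unfolding equipotent_in_def by blast
  obtain F where F: "Fn F" "\<forall>u\<in>elts x. F u = f u" using fun_in_Fn[OF f(1)] by blast
  obtain H where H: "Fn H" "\<forall>u\<in>Y. H u = g u" using fun_in_Fn[OF g(1)] by blast
  have "bij_betw F (elts x) Y" "bij_betw H Y Z" using f(2) g(2) F(2) H(2) by (metis bij_betw_cong)+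
  then have "bij_betw (H \<circ> F) (elts x) Z" by (rule bij_betw_trans)
  then show ?thesis
    unfolding equipotent_in_def using Fn_fun_in[OF Fn_comp[OF H(1) F(1)] assms(3)]
    by (intro exI[of _ "\<lambda>u. H (F u)"]) (simp add: o_def)
qed

lemma equipotent_refl: "x \<in> M \<Longrightarrow> equipotent_in M (elts x) (elts x)"
  unfolding equipotent_in_def
  by (intro exI[of _ "\<lambda>u. u"] conjI Fn_fun_in Fn_id) (simp_all add: bij_betw_def)

lemma ctbl_equipotent: assumes "equipotent_in M (elts omega) (elts x)" shows "ctbl x"
proof -
  obtain f where f: "fun_in M (elts omega) f" "bij_betw f (elts omega) (elts x)"
    using assms unfolding equipotent_in_def by blast
  obtain F where F: "Fn F" "\<forall>u\<in>elts omega. F u = f u" using fun_in_Fn[OF f(1)] by blast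
  have "elts x \<subseteq> F ` elts omega" using f(2) F(2) unfolding bij_betw_def by auto
  with F(1) show ?thesis unfolding ctbl_def by blast
qed

lemma ctbl_finite: assumes "x \<in> M" "finite (elts x)" shows "ctbl x"
proof -
  obtain h where h: "bij_betw h (elts (nat_code (card (elts x)))) (elts x)"
    using finite_same_card_bij[of "elts (nat_code (card (elts x)))" "elts x"] assms(2) by auto
  let ?n = "nat_code (card (elts x))"
  let ?f = "vimg (\<lambda>u. pair u (h u)) ?n"
  have hx: "h u \<in> elts x" if "u \<in> elts ?n" for u using h that unfolding bij_betw_def by blast
  have "?f \<in> M"
    unfolding vimg_def
    by (rule finite_M) (use hx mem_M[OF _ assms(1)] mem_M[OF _ nat_code_M] in auto)
  then have "Fn (vapp ?f)" by (intro dfn_intros)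
  moreover have "elts x \<subseteq> vapp ?f ` elts omega"
  proof
    fix y assume "y \<in> elts x"
    then obtain u where u: "u \<in> elts ?n" "y = h u" using h unfolding bij_betw_def by blast
    then have "vapp ?f u = y" by simp
    moreover have "u \<in> elts omega" using u(1) by (auto simp: elts_nat_code)
    ultimately show "y \<in> vapp ?f ` elts omega" by blast
  qed
  ultimately show ?thesis unfolding ctbl_def by blast
qed

text \<open>For infinite \<open>b\<close>, the least ordinal up to \<open>b\<close> that is
  equipotent to \<open>b\<close> in M is an infinite cardinal below \<open>k\<close>, and the only
  such cardinal is \<omega>.\<close>

lemma ctbl_below_aleph1:
  assumes k: "aleph1_in M k" and b: "b \<in> elts k" shows "ctbl b"
proof (cases "finite (elts b)")
  case True
  have "b \<in> M" using k b mem_M unfolding aleph1_in_def infinite_cardinal_in_def cardinal_in_def by blast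
  then show ?thesis by (rule ctbl_finite[OF _ True])
next
  case False
  have kM: "k \<in> M" "ordinal k"
    using k unfolding aleph1_in_def infinite_cardinal_in_def cardinal_in_def by blast+
  have bM: "b \<in> M" using b kM mem_M by blast
  define Q where "Q = {m \<in> insert b (elts b). equipotent_in M (elts m) (elts b)}"
  have "b \<in> Q" unfolding Q_def using equipotent_refl[OF bM] by simp
  obtain m where m: "m \<in> Q" "\<And>y. y \<in> elts m \<Longrightarrow> y \<notin> Q"
    by (rule wfE_min[OF wf_elts \<open>b \<in> Q\<close>]) simp
  have mk: "m \<in> elts k" using m(1) b ordinal_trans1[OF kM(2)] unfolding Q_def by blast
  have mM: "m \<in> M" using mk kM mem_M by blast
  have "infinite_cardinal_in M m"
    unfolding infinite_cardinal_in_def cardinal_in_def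
  proof (intro conjI ballI)
    show "m \<in> M" by fact
    show "ordinal m" using kM(2) mk unfolding ordinal_def by blast
    show "infinite (elts m)"
      using m(1) False unfolding Q_def equipotent_in_def by (auto dest: bij_betw_finite)
    fix a assume a: "a \<in> elts m"
    show "\<not> equipotent_in M (elts a) (elts m)"
    proof
      assume "equipotent_in M (elts a) (elts m)"
      then have "equipotent_in M (elts a) (elts b)"
        using m(1) equipotent_trans[OF _ _ mem_M[OF a mM]] unfolding Q_def by blast
      moreover have "a \<in> elts b"
        using m(1) a ordinal_trans[OF kM(2) a _ b] unfolding Q_def by blast
      ultimately have "a \<in> Q" unfolding Q_def by blast
      with m(2) a show False by blast
    qed
  qed
  then have "m = omega" using k mk unfolding aleph1_in_def by blast
  then show ?thesis using m(1) unfolding Q_def by (intro ctbl_equipotent) simp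
qed

text \<open>An infinite ordinal with a largest element \<open>b\<close> is equipotent to \<open>b\<close>.\<close>

lemma infinite_cardinal_limit:
  assumes k: "infinite_cardinal_in M k" and om: "omega \<in> elts k" and b: "b \<in> elts k"
  shows "\<exists>c\<in>elts k. b \<in> elts c"
proof (rule ccontr)
  assume n: "\<not> (\<exists>c\<in>elts k. b \<in> elts c)"
  have kM: "k \<in> M" "ordinal k" using k unfolding infinite_cardinal_in_def cardinal_in_def by blast+
  have bM: "b \<in> M" using mem_M[OF b kM(1)] .
  have eqk: "elts k = insert b (elts b)"
    using ordinal_linear[OF kM(2) _ b] n ordinal_trans1[OF kM(2) _ b] b by blast
  have ob: "elts omega \<subseteq> elts b"
    using om eqk ordinal_trans[OF kM(2) _ _ b] by auto
  have nb: "b \<notin> elts omega" using ob mem_irrefl[of b] by blast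
  \<comment> \<open>Hilbert's hotel: 0 is sent to the extra element \<open>b\<close>, each successor
    to its predecessor, and everything beyond \<omega> stays put.\<close>
  define F where "F x = (if x = vempty then b else if x \<in> elts omega then vUn x else x)" for x
  have F: "F (nat_code 0) = b" "F (nat_code (Suc n)) = nat_code n" "x \<notin> elts omega \<Longrightarrow> F x = x" for n x
    using vempty_omega nat_code_omega[of "Suc n"] by (auto simp: F_def vUn_nat_code_Suc)
  have "inj_on F (elts b)"
  proof (rule inj_onI)
    fix x y assume xy: "x \<in> elts b" "y \<in> elts b" "F x = F y"
    have *: "x \<in> elts omega \<Longrightarrow> (x = nat_code 0 \<and> F x = b) \<or> (\<exists>m. x = nat_code (Suc m) \<and> F x = nat_code m)" for x
      using F(1,2) unfolding elts_omega by (metis not0_implies_Suc rangeE)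
    show "x = y"
      using *[of x] *[of y] F(3)[of x] F(3)[of y] xy nb nat_code_omega mem_irrefl[of b]
      by (cases "x \<in> elts omega"; cases "y \<in> elts omega") (metis nat_code_eq_iff)+
  qed
  moreover have "F ` elts b = elts k"
  proof
    show "F ` elts b \<subseteq> elts k"
    proof
      fix y assume "y \<in> F ` elts b"
      then obtain x where x: "x \<in> elts b" "y = F x" by blast
      show "y \<in> elts k"
      proof (cases "x \<in> elts omega")
        case True
        then obtain m where "x = nat_code m" unfolding elts_omega by blast
        then show ?thesis using x F(1,2) b eqk subsetD[OF ob nat_code_omega] by (cases m) (simp_all del: nat_code.simps)
      qed (use x F(3) eqk in simp)
    qed
    show "elts k \<subseteq> F ` elts b"
    proof
      fix y assume y: "y \<in> elts k"
      show "y \<in> F ` elts b"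
      proof (cases "y \<in> elts omega")
        case True
        then obtain m where "y = nat_code m" unfolding elts_omega by blast
        then show ?thesis using F(2)[of m] subsetD[OF ob nat_code_omega] by (metis imageI)
      next
        case False
        then show ?thesis
          using F(1) F(3)[of y] y eqk subsetD[OF ob nat_code_omega] by (metis imageI insertE)
      qed
    qed
  qed
  moreover have "Fn F" unfolding F_def by (intro dfn_intros vempty_M omega_M bM)
  ultimately have "equipotent_in M (elts b) (elts k)"
    unfolding equipotent_in_def bij_betw_def using Fn_fun_in[OF _ bM] by blast
  then show False using k b unfolding infinite_cardinal_in_def cardinal_in_def by blast
qed

text \<open>This is the interface between the construction in M and the extensions. The last clause
  treats a whole sequence at once, because one set of an extension will be replaced by countably
  many supersets in M.\<close>

definition catching :: "V \<Rightarrow> (V \<Rightarrow> V) \<Rightarrow> bool" where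
  "catching k A \<longleftrightarrow> k \<in> M \<and> ordinal k \<and> infinite (elts k) \<and> (\<forall>b\<in>elts k. ctbl b) \<and>
    (\<forall>b\<in>elts k. \<exists>c\<in>elts k. b \<in> elts c) \<and> Fn A \<and>
    (\<forall>b\<in>elts k. elts (A b) \<subseteq> elts omega \<and> (\<forall>d\<in>elts b. finite (elts (A b) \<inter> elts (A d))) \<and>
       catch (vFin (Bs (vimg A b))) T0 (A b)) \<and>
    (\<forall>Y. Fn Y \<and> (\<forall>i. elts (Y i) \<subseteq> elts T0) \<longrightarrow> (\<exists>g\<in>elts k. \<forall>b\<in>elts k. g \<in> elts (vins b b) \<longrightarrow>
       (\<forall>i\<in>elts omega. catch (vFin (Bs (vimg A b))) (Y i) (A b))))"

theorem catching_family:
  assumes "CH_in M" shows "\<exists>k A. catching k A"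
proof -
  obtain k h where k: "aleph1_in M k" and h: "fun_in M (elts k) h" "bij_betw h (elts k) {x \<in> M. elts x \<subseteq> elts omega}"
    using assms unfolding CH_in_def equipotent_in_def by blast
  have kM: "k \<in> M" "ordinal k" "infinite (elts k)"
    using k unfolding aleph1_in_def infinite_cardinal_in_def cardinal_in_def by blast+
  have bM: "b \<in> M" if "b \<in> elts k" for b using that kM mem_M by blast
  have lim: "\<forall>b\<in>elts k. \<exists>c\<in>elts k. b \<in> elts c"
    using infinite_cardinal_limit[of k] k unfolding aleph1_in_def by blast
  obtain H where H: "Fn H" "\<forall>x\<in>elts k. H x = h x" using fun_in_Fn[OF h(1)] by blast
  have "ctbl (vtimes omega T0)" by (intro ctbl_times ctbl_omega ctbl_T0)
  then obtain e where e: "Fn e" "elts (vtimes omega T0) \<subseteq> e ` elts omega" unfolding ctbl_def by blast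
  \<comment> \<open>CH lists the subsets of \<omega>. Through the enumeration \<open>e\<close> of
    \<omega> times \<open>T0\<close>, such a subset codes a sequence of subsets of
    \<open>T0\<close>, and \<open>Yx x\<close> decodes the one listed at \<open>x\<close>.\<close>
  define Yx where "Yx x i = vsep T0 (\<lambda>t. \<exists>n\<in>elts omega. n \<in> elts (H x) \<and> e n = pair i t)" for x i
  \<comment> \<open>The set \<open>T0\<close> is a task at every stage; this will make each
    \<open>A b\<close> infinite. Otherwise only sequences listed up to \<open>b\<close> occur, so
    the tasks are countably many in M.\<close>
  define YY where "YY b = vins T0 (vimg (\<lambda>u. Yx (vfst u) (vsnd u)) (vtimes (vins b b) omega))" for b
  have FYx: "Fn (\<lambda>u. Yx (vfst u) (vsnd u))"
    unfolding Yx_def by (intro dfn_intros omega_M T0_M Fn_comp[OF H(1)] Fn_comp[OF e(1)])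
  have FYY: "Fn YY"
    unfolding YY_def
    by (intro dfn_intros omega_M T0_M Fn_comp[OF FYx, of "\<lambda>p. pair (vfst (vsnd p)) (vsnd (vsnd p))", simplified])
  define stage where "stage b AA x \<longleftrightarrow> elts x \<subseteq> elts omega \<and> (\<forall>a\<in>elts AA. finite (elts (vsep x (\<lambda>y. y \<in> elts a)))) \<and>
     (\<forall>Y\<in>elts (YY b). catch (vFin (Bs AA)) Y x)" for b AA x
  obtain c where c: "c \<in> M" "\<forall>z\<in>elts (vPow (vPow omega)). elts z \<noteq> {} \<longrightarrow> vapp c z \<in> elts z"
    using choice[of "vPow (vPow omega)"] by blast
  \<comment> \<open>The earlier sets enter only as a collection, here the second components of the
    pairs in \<open>F\<close>. A choice function fixed in advance keeps the recursion step
    definable.\<close>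
  define J where "J b F = vapp c (vsep (vPow omega) (stage b (vimg vsnd F)))" for b F
  have FJ: "Fn (\<lambda>p. J (vfst p) (vsnd p))"
    unfolding J_def stage_def by (intro dfn_intros c vPow_M omega_M Fn_comp[OF FYY])
  define A where "A = vrec (\<lambda>x. x) J"
  have FA: "Fn A" unfolding A_def by (intro Fn_vrec wf_elts Fn_id FJ)
  have A: "A b = vapp c (vsep (vPow omega) (stage b (vimg A b)))" for b
  proof -
    have "vimg vsnd (vimg (\<lambda>z. pair z (A z)) b) = vimg A b" by (rule V_eqI) (auto simp: image_iff)
    then show ?thesis
      unfolding A_def by (subst vrec[of "\<lambda>x. x", OF wf_elts]) (simp add: J_def)
  qed
  have st: "b \<in> elts k \<longrightarrow> stage b (vimg A b) (A b)" for b
  proof (induction b rule: V_induct)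
    case (elts b)
    show ?case
    proof
      assume b: "b \<in> elts k"
      let ?AA = "vimg A b"
      have AA: "?AA \<in> M" using FA bM[OF b] by blast
      have cb: "ctbl b" using ctbl_below_aleph1[OF k b] .
      have cA: "ctbl ?AA" by (rule ctblI[OF FA cb]) simp
      have sA: "elts a \<subseteq> elts omega" if "a \<in> elts ?AA" for a
        using that elts.IH ordinal_trans1[OF kM(2) _ b] unfolding stage_def by auto
      have YM: "YY b \<in> M" using FnD[OF FYY bM[OF b]] .
      have "ctbl (vins b b)"
        by (rule ctbl_Un[OF cb ctbl_finite[of "vins b vempty"]]) (use bM[OF b] in auto)
      then have "ctbl (vimg (\<lambda>u. Yx (vfst u) (vsnd u)) (vtimes (vins b b) omega))"
        by (rule ctblI[OF FYx ctbl_times[OF _ ctbl_omega]]) simp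
      then have cY: "ctbl (YY b)"
        by (rule ctbl_Un[OF _ ctbl_finite[of "vins T0 vempty"]]) (auto simp: YY_def)
      have sY: "elts Y \<subseteq> elts T0" if "Y \<in> elts (YY b)" for Y
        using that unfolding YY_def Yx_def by auto
      obtain x where x: "x \<in> M" "stage b ?AA x"
        using catch_exists[OF AA cA sA YM cY sY] unfolding stage_def by blast
      let ?Z = "vsep (vPow omega) (stage b ?AA)"
      have "dfn (stage b ?AA)"
        unfolding stage_def by (intro dfn_intros omega_M AA YM)
      then have "?Z \<in> M" by (intro vsep_M vPow_M omega_M)
      then have "?Z \<in> elts (vPow (vPow omega))" by auto
      moreover have "x \<in> elts ?Z" using x unfolding stage_def by auto
      ultimately have "vapp c ?Z \<in> elts ?Z" using c(2) by blast
      then show "stage b ?AA (A b)" unfolding A[of b] by simp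
    qed
  qed
  have "\<exists>g\<in>elts k. \<forall>b\<in>elts k. g \<in> elts (vins b b) \<longrightarrow> (\<forall>i\<in>elts omega. catch (vFin (Bs (vimg A b))) (Y i) (A b))"
    if Y: "Fn Y" "\<forall>i. elts (Y i) \<subseteq> elts T0" for Y
  proof -
    \<comment> \<open>The code of the sequence \<open>Y\<close>. The place where CH lists it is the
      index from which on every \<open>Y i\<close> is caught.\<close>
    define y where "y = vsep omega (\<lambda>n. \<exists>i\<in>elts omega. \<exists>t\<in>elts (Y i). e n = pair i t)"
    have "y \<in> M" unfolding y_def by (intro vsep_M dfn_intros omega_M Fn_comp[OF Y(1)] Fn_comp[OF e(1)])
    then have "y \<in> h ` elts k" using h(2) unfolding bij_betw_def y_def by auto
    then obtain g where g: "g \<in> elts k" "H g = y" using H(2) by auto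
    have YxY: "Yx g i = Y i" if i: "i \<in> elts omega" for i
    proof (rule V_eqI)
      fix t
      show "t \<in> elts (Yx g i) \<longleftrightarrow> t \<in> elts (Y i)"
      proof
        assume "t \<in> elts (Yx g i)"
        then show "t \<in> elts (Y i)" unfolding Yx_def g(2) y_def by auto
      next
        assume t: "t \<in> elts (Y i)"
        then have tT: "t \<in> elts T0" using Y(2) by blast
        then have "pair i t \<in> elts (vtimes omega T0)" using i by simp
        then obtain n where "n \<in> elts omega" "e n = pair i t" using e(2) by (metis imageE subsetD)
        then show "t \<in> elts (Yx g i)" unfolding Yx_def g(2) y_def using i t tT by auto
      qed
    qed
    have "catch (vFin (Bs (vimg A b))) (Y i) (A b)" if b: "b \<in> elts k" "g \<in> elts (vins b b)" "i \<in> elts omega" for b i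
    proof -
      have "Y i \<in> elts (YY b)"
        unfolding YY_def using YxY[OF b(3)] b by (auto intro!: image_eqI[of _ _ "pair g i"])
      then show ?thesis using st[of b] b(1) unfolding stage_def by blast
    qed
    then show ?thesis using g(1) by blast
  qed
  moreover have "elts (A b) \<subseteq> elts omega \<and> (\<forall>d\<in>elts b. finite (elts (A b) \<inter> elts (A d))) \<and>
      catch (vFin (Bs (vimg A b))) T0 (A b)" if "b \<in> elts k" for b
  proof -
    have "T0 \<in> elts (YY b)" unfolding YY_def by simp
    have "elts (vsep (A b) (\<lambda>y. y \<in> elts a)) = elts (A b) \<inter> elts a" for a by auto
    then show ?thesis using st[of b] that \<open>T0 \<in> _\<close> unfolding stage_def by simp
  qed
  ultimately show ?thesis
    unfolding catching_def using kM lim ctbl_below_aleph1[OF k] FA by (intro exI[of _ k] exI[of _ A]) blast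
qed

end

section \<open>The family inside an extension\<close>

text \<open>\<open>A\<close> enumerates the family along \<open>w\<close>. The last assumption says that every subset of \<open>T0\<close> in
  \<open>N\<close> is caught from some index on.\<close>

locale caught = nmodel N for N :: "V set" +
  fixes w :: V and A :: "V \<Rightarrow> V"
  assumes w_ord: "ordinal w" and w_inf: "infinite (elts w)"
    and w_lim: "b \<in> elts w \<Longrightarrow> \<exists>c\<in>elts w. b \<in> elts c"
    and A_sub: "b \<in> elts w \<Longrightarrow> elts (A b) \<subseteq> elts omega"
    and A_ad: "b \<in> elts w \<Longrightarrow> d \<in> elts b \<Longrightarrow> finite (elts (A b) \<inter> elts (A d))"
    and A_N: "vimg A w \<in> N"
    and A_below_N: "b \<in> elts w \<Longrightarrow> vimg A b \<in> N"
    and T0_N: "T0 \<in> N" and Fin_N: "vFin omega \<in> N"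
    and points_N: "\<exists>Pt\<in>N. elts Pt = elts (vimg A w) \<union> elts omega"
    and Bs_N: "b \<in> elts w \<Longrightarrow> Bs (vimg A b) \<in> N \<and> vFin (Bs (vimg A b)) \<in> N"
    and Bs_enum: "b \<in> elts w \<Longrightarrow> \<exists>E\<in>N. elts (Bs (vimg A b)) \<subseteq> vapp E ` elts omega"
    and catch_T0: "b \<in> elts w \<Longrightarrow> catch (vFin (Bs (vimg A b))) T0 (A b)"
    and catch_N: "X \<in> N \<Longrightarrow> elts X \<subseteq> elts T0 \<Longrightarrow> \<exists>g\<in>elts w. \<forall>b\<in>elts w. g \<in> elts (vins b b) \<longrightarrow>
       catch (vFin (Bs (vimg A b))) X (A b)"
begin

abbreviation B :: "V \<Rightarrow> V" where "B b \<equiv> Bs (vimg A b)"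

lemma w_linear: "a \<in> elts w \<Longrightarrow> b \<in> elts w \<Longrightarrow> a \<in> elts b \<or> a = b \<or> b \<in> elts a"
  by (rule ordinal_linear[OF w_ord])

lemma w_subset_iff: "a \<in> elts w \<Longrightarrow> b \<in> elts w \<Longrightarrow> elts a \<subseteq> elts b \<longleftrightarrow> a \<in> elts (vins b b)"
  using w_linear[of a b] ordinal_trans[OF w_ord _ _ , of _ a b] by (auto dest: subsetD)

lemma w_dichotomy: "a \<in> elts w \<Longrightarrow> b \<in> elts w \<Longrightarrow> elts a \<subseteq> elts b \<or> b \<in> elts a"
  using w_linear[of a b] w_subset_iff[of a b] by auto

lemma w_trans: "a \<in> elts b \<Longrightarrow> b \<in> elts w \<Longrightarrow> a \<in> elts w"
  by (rule ordinal_trans1[OF w_ord])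

lemma w_max: assumes "finite I" "I \<noteq> {}" "I \<subseteq> elts w" shows "\<exists>d\<in>I. \<forall>x\<in>I. x \<in> elts (vins d d)"
  using assms
proof (induction rule: finite_ne_induct)
  case (insert x I)
  then obtain d where d: "d \<in> I" "\<forall>y\<in>I. y \<in> elts (vins d d)" by auto
  have dx: "d \<in> elts w" "x \<in> elts w" using d insert.prems by auto
  show ?case
  proof (cases "x \<in> elts (vins d d)")
    case True
    with d show ?thesis by auto
  next
    case False
    then have "d \<in> elts x" using w_linear[OF dx] by auto
    then have "\<forall>y\<in>I. y \<in> elts x" using d(2) ordinal_trans[OF w_ord _ _ dx(2)] by auto
    then show ?thesis by auto
  qed
qed auto

lemma B_iff: "e \<in> elts (B b) \<longleftrightarrow> (\<exists>k. e = vins (nat_code k) vempty) \<or> (\<exists>d\<in>elts b. \<exists>m. e = cut_below (A d) (nat_code m))"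
  by (auto simp: Bs_iff)

lemma vins_B [simp]: "k \<in> elts omega \<Longrightarrow> vins k vempty \<in> elts (B b)"
  by (auto simp: B_iff elts_omega)

lemma B_mono: "elts b \<subseteq> elts c \<Longrightarrow> elts (B b) \<subseteq> elts (B c)"
  unfolding subset_iff[of "elts (B b)"] B_iff by blast

text \<open>Being caught by all \<open>A d\<close> with \<open>d \<ge> g\<close> keeps a pattern realizable, and adds
  the tails of the \<open>A d\<close> to the sets that can be hit.\<close>

lemma persist:
  assumes c: "\<forall>b\<in>elts w. elts g \<subseteq> elts b \<longrightarrow> catch (vFin (B b)) X (A b)"
    and g: "\<forall>d\<in>elts w. elts g \<subseteq> elts d \<or> d \<in> elts g"
    and ab: "finite (elts a)" "elts a \<subseteq> elts (B g)" "finite (elts b)" "elts b \<subseteq> elts (B g)"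
    and bg: "big (vFin (B g)) X a b"
    and z: "elts z \<subseteq> elts w" "elts g \<subseteq> elts z"
    and C: "finite C" "C \<subseteq> {cut_below (A d) (nat_code m) | d m. d \<in> elts z \<and> elts g \<subseteq> elts d}"
  shows "big (vFin (B z)) X (vset (elts a \<union> C)) b"
  using z C
proof (induction z arbitrary: C rule: V_induct)
  case (elts z)
  note IH = elts.IH
  have zw: "elts z \<subseteq> elts w" and gz: "elts g \<subseteq> elts z" and fC: "finite C"
    and C: "C \<subseteq> {cut_below (A d) (nat_code m) | d m. d \<in> elts z \<and> elts g \<subseteq> elts d}"
    using elts.prems by auto
  have eaC: "elts (vset (elts a \<union> C)) = elts a \<union> C" using fC by (simp add: countable_finite)
  show ?case
    unfolding big_def
  proof (intro ballI)
    fix D j assume D: "D \<in> elts (vFin (B z))" and j: "j \<in> elts omega"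
    have fD: "finite (elts D)" using D by simp
    have "\<forall>e\<in>elts D. \<exists>d. (\<exists>k. e = vins (nat_code k) vempty) \<or> (d \<in> elts z \<and> (\<exists>m. e = cut_below (A d) (nat_code m)))"
      using D by (auto simp: B_iff subset_iff)
    then obtain dD where dD: "\<And>e. e \<in> elts D \<Longrightarrow> (\<exists>k. e = vins (nat_code k) vempty) \<or>
        (dD e \<in> elts z \<and> (\<exists>m. e = cut_below (A (dD e)) (nat_code m)))" by metis
    have "\<forall>e\<in>C. \<exists>d m. d \<in> elts z \<and> elts g \<subseteq> elts d \<and> e = cut_below (A d) (nat_code m)" using C by blast
    then obtain dC mC where dC: "\<And>e. e \<in> C \<Longrightarrow> dC e \<in> elts z \<and> elts g \<subseteq> elts (dC e) \<and> e = cut_below (A (dC e)) (nat_code (mC e))"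
      by metis
    \<comment> \<open>Only finitely many indices from \<open>g\<close> on occur in \<open>D\<close>
      or \<open>C\<close>. The induction hypothesis is applied at the largest of them, and catching
      by that one set does the rest; limit stages are therefore no separate case.\<close>
    define I where "I = {d \<in> dD ` elts D \<union> dC ` C. d \<in> elts z \<and> elts g \<subseteq> elts d}"
    have fI: "finite I" unfolding I_def using fD fC by simp
    show "\<exists>t\<in>elts X. elts j \<subseteq> elts (vfst t) \<and> hits (vsnd t) (vset (elts a \<union> C)) \<and> misses (vsnd t) b \<and> natle j (rem (vsnd t) D)"
    proof (cases "I = {}")
      case True
      then have "C = {}" using dC unfolding I_def by blast
      have "elts D \<subseteq> elts (B g)"
      proof
        fix e assume e: "e \<in> elts D"
        have "dD e \<in> elts g" if "dD e \<in> elts z" using that e True g zw unfolding I_def by blast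
        then show "e \<in> elts (B g)" using dD[OF e] unfolding B_iff by blast
      qed
      then have "D \<in> elts (vFin (B g))" using fD by simp
      then show ?thesis using bg j \<open>C = {}\<close> unfolding big_def by simp
    next
      case False
      have "I \<subseteq> elts w" using zw unfolding I_def by blast
      then obtain d where d: "d \<in> I" "\<forall>x\<in>I. x \<in> elts (vins d d)" using w_max[OF fI False] by blast
      have dz: "d \<in> elts z" "elts g \<subseteq> elts d" "d \<in> elts w" using d(1) zw unfolding I_def by auto
      have below: "x \<in> elts d" if "x \<in> elts z" "x \<in> dD ` elts D \<union> dC ` C" "x \<noteq> d" for x
      proof (cases "elts g \<subseteq> elts x")
        case True
        then show ?thesis using d(2) that unfolding I_def by auto
      next
        case False
        then show ?thesis using g zw that dz by blast
      qed
      have dw: "elts d \<subseteq> elts w" using dz w_trans by blast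
      \<comment> \<open>The members of \<open>D\<close> left out here are tails of
        \<open>A d\<close>, so points outside \<open>A d\<close> avoid them automatically.\<close>
      define D1 where "D1 = {e \<in> elts D. e \<in> elts (B d)}"
      define C1 where "C1 = {e \<in> C. dC e \<noteq> d}"
      define m0 where "m0 = Max (insert 0 (mC ` C))"
      \<comment> \<open>The singletons below \<open>m0\<close> force the point in \<open>A d\<close>
        to be at least \<open>m0\<close>, hence to lie in all tails of \<open>A d\<close> that occur
        in \<open>C\<close>.\<close>
      define D2 where "D2 = vset (D1 \<union> (\<lambda>k. vins (nat_code k) vempty) ` {..<m0})"
      have eD2: "elts D2 = D1 \<union> (\<lambda>k. vins (nat_code k) vempty) ` {..<m0}"
        unfolding D2_def D1_def using fD by (simp add: countable_finite)
      have D2: "D2 \<in> elts (vFin (B d))"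
        using fD by (auto simp: eD2 D1_def)
      have C1: "finite C1" "C1 \<subseteq> {cut_below (A x) (nat_code m) | x m. x \<in> elts d \<and> elts g \<subseteq> elts x}"
      proof -
        have "e \<in> {cut_below (A x) (nat_code m) | x m. x \<in> elts d \<and> elts g \<subseteq> elts x}" if "e \<in> C1" for e
        proof -
          have "e \<in> C" "dC e \<noteq> d" using that unfolding C1_def by auto
          then have "dC e \<in> elts d" using below dC by blast
          then show ?thesis using dC[OF \<open>e \<in> C\<close>] by blast
        qed
        then show "C1 \<subseteq> {cut_below (A x) (nat_code m) | x m. x \<in> elts d \<and> elts g \<subseteq> elts x}" by blast
      qed (use fC in \<open>simp add: C1_def\<close>)
      have eaC1: "elts (vset (elts a \<union> C1)) = elts a \<union> C1" using C1(1) by (simp add: countable_finite)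
      have "big (vFin (B d)) X (vset (elts a \<union> C1)) b"
        using IH[OF dz(1) dw dz(2) C1] .
      moreover have "catch (vFin (B d)) X (A d)" using c dz by blast
      moreover have "vset (elts a \<union> C1) \<in> elts (vFin (B d))"
      proof -
        have "C1 \<subseteq> elts (B d)" using C1(2) unfolding subset_iff[of C1] B_iff by blast
        then show ?thesis using ab B_mono[OF dz(2)] C1(1) by (simp add: eaC1 del: elts_vset)
      qed
      moreover have "b \<in> elts (vFin (B d))" using ab B_mono[OF dz(2)] by auto
      ultimately obtain t where t: "t \<in> elts X" "elts j \<subseteq> elts (vfst t)" "hits (vsnd t) (vset (elts a \<union> C1))"
        "misses (vsnd t) b" "\<exists>y\<in>elts (rem (vsnd t) D2). y \<in> elts (A d)"
        "natle j (vsep (rem (vsnd t) D2) (\<lambda>y. y \<notin> elts (A d)))"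
        using D2 j unfolding catch_def by blast
      obtain y where y: "y \<in> elts (vsnd t)" "y \<in> elts (A d)" "\<forall>e\<in>elts D2. y \<notin> elts e"
        using t(5) unfolding rem_def by auto
      obtain n where n: "y = nat_code n" using y(2) A_sub[OF dz(3)] by (auto simp: elts_omega)
      have "m0 \<le> n"
      proof (rule ccontr)
        assume "\<not> m0 \<le> n"
        then have "vins (nat_code n) vempty \<in> elts D2" unfolding eD2 by auto
        then show False using y(3) n by auto
      qed
      have "hits (vsnd t) (vset (elts a \<union> C))"
        unfolding hits_def eaC
      proof
        fix e assume e: "e \<in> elts a \<union> C"
        show "\<exists>x\<in>elts (vsnd t). x \<in> elts e"
        proof (cases "e \<in> elts a \<union> C1")
          case True
          then show ?thesis using t(3) unfolding hits_def eaC1 by blast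
        next
          case False
          then have e: "e \<in> C" "dC e = d" using e unfolding C1_def by auto
          have "mC e \<le> m0" unfolding m0_def using fC e by (intro Max_ge) auto
          then have "y \<in> elts e" using dC[OF e(1)] y(2) n \<open>m0 \<le> n\<close> unfolding e(2) cut_below_def
            by (metis (mono_tags, lifting) elts_vsep le_trans linorder_not_le mem_Collect_eq nat_code_mem_iff)
          with y(1) show ?thesis by blast
        qed
      qed
      moreover have "natle j (rem (vsnd t) D)"
      proof (rule natle_mono[OF t(6)], rule subsetI)
        fix x assume x: "x \<in> elts (vsep (rem (vsnd t) D2) (\<lambda>y. y \<notin> elts (A d)))"
        have "x \<notin> elts e" if e: "e \<in> elts D" for e
        proof (cases "e \<in> elts (B d)")
          case True
          then have "e \<in> elts D2" using e unfolding eD2 D1_def by blast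
          then show ?thesis using x unfolding rem_def by auto
        next
          case False
          then have "dD e \<in> elts z" "\<exists>m. e = cut_below (A (dD e)) (nat_code m)" "dD e \<notin> elts d"
            using dD[OF e] unfolding B_iff by blast+
          then have "dD e = d" using below e by blast
          obtain m where "e = cut_below (A (dD e)) (nat_code m)" using \<open>\<exists>m. _\<close> by blast
          then have "elts e \<subseteq> elts (A d)"
            unfolding \<open>dD e = d\<close> by (metis (no_types, lifting) cut_below_def elts_vsep mem_Collect_eq subsetI)
          then show ?thesis using x by auto
        qed
        then show "x \<in> elts (rem (vsnd t) D)" using x unfolding rem_def by auto
      qed
      ultimately show ?thesis using t by blast
    qed
  qed
qed

section \<open>Infinite members, coverings and maximality\<close>

lemma big_T0: assumes "b \<in> elts w" shows "big (vFin (B b)) T0 vempty vempty"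
proof -
  have "big (vFin (B vempty)) T0 vempty vempty"
    unfolding big_def
  proof (intro ballI)
    fix D j assume D: "D \<in> elts (vFin (B vempty))" "j \<in> elts omega"
    then have "finite (\<Union> (elts ` elts D))" by (force simp: B_iff)
    moreover have "infinite (elts omega)"
      unfolding elts_omega using range_inj_infinite[OF inj_nat_code] .
    ultimately have inf: "infinite (elts omega - \<Union> (elts ` elts D))" by (rule Diff_infinite_finite)
    obtain n where n: "j = nat_code n" using D(2) by (auto simp: elts_omega)
    obtain S where S: "finite S" "card S = n" "S \<subseteq> elts omega - \<Union> (elts ` elts D)"
      using infinite_arbitrarily_large[OF inf, of n] by blast
    have eS: "elts (vset S) = S" using S by (simp add: countable_finite)
    have "rem (vset S) D = vset S"
      unfolding rem_def by (rule V_eqI) (use S(3) eS in auto)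
    then have "natle j (rem (vset S) D)" using S eS by (simp add: n natle_iff)
    moreover have "pair j (vset S) \<in> elts T0"
      unfolding T0_def using S eS D(2) by auto
    ultimately show "\<exists>t\<in>elts T0. elts j \<subseteq> elts (vfst t) \<and> hits (vsnd t) vempty \<and> misses (vsnd t) vempty \<and> natle j (rem (vsnd t) D)"
      by (intro bexI[of _ "pair j (vset S)"]) (auto simp: hits_def misses_def)
  qed
  \<comment> \<open>At stage 0 only singletons have to be avoided. Since every \<open>A b\<close>
    catches \<open>T0\<close>, persistence carries the claim up to \<open>b\<close>.\<close>
  from persist[OF _ _ _ _ _ _ this, of b "{}"] show ?thesis
    using catch_T0 assms w_trans by auto
qed

text \<open>The singletons of a finite \<open>A b\<close> could all be put into \<open>D\<close>,
  and then no point would be left in which \<open>A b\<close> can be met.\<close>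

lemma A_inf: assumes b: "b \<in> elts w" shows "infinite (elts (A b))"
proof
  assume fin: "finite (elts (A b))"
  define D where "D = vset ((\<lambda>k. vins k vempty) ` elts (A b))"
  have eD: "elts D = (\<lambda>k. vins k vempty) ` elts (A b)" unfolding D_def by simp
  have "D \<in> elts (vFin (B b))"
    using fin A_sub[OF b] by (auto simp: eD)
  moreover have "vempty \<in> elts (vFin (B b))" by simp
  ultimately obtain t y where "y \<in> elts (rem (vsnd t) D)" "y \<in> elts (A b)"
    using catch_T0[OF b] big_T0[OF b] vempty_omega unfolding catch_def by blast
  then show False unfolding rem_def eD by auto
qed

lemma A_ad2:
  assumes "b \<in> elts w" "d \<in> elts w" "b \<noteq> d" shows "finite (elts (A b) \<inter> elts (A d))"
  using w_linear[OF assms(1,2)] assms A_ad[of b d] A_ad[of d b] by (auto simp: Int_commute)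

lemma A_inj: "inj_on A (elts w)"
  by (rule inj_onI) (metis A_ad2 A_inf Int_absorb)

text \<open>Catching is applied to the pairs of a number j and a finite subset of
  \<open>Y j\<close>. If the empty pattern is big for them, the catching set meets every
  \<open>Y j\<close> beyond any bound. Otherwise some \<open>Y j\<close> has only finitely many
  points outside a finite union, and these are added as singletons. Constant sequences serve for
  single sets, properly decreasing ones for \<open>fin_reduce\<close>.\<close>

lemma two_cases:
  assumes Y: "Fn Y" "\<And>j. elts (Y (nat_code j)) \<subseteq> elts omega"
    and dec: "\<And>i j. i \<le> j \<Longrightarrow> elts (Y (nat_code j)) \<subseteq> elts (Y (nat_code i))" and g0: "g0 \<in> elts w"
  shows "(\<exists>b\<in>elts w. elts g0 \<subseteq> elts b \<and> (\<forall>j m. \<exists>y\<in>elts (Y (nat_code j)). y \<in> elts (A b) \<and> y \<notin> elts (nat_code m))) \<or>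
    (\<exists>b\<in>elts w. \<exists>D j. D \<in> elts (vFin (B b)) \<and> elts (Y (nat_code j)) \<subseteq> \<Union> (elts ` elts D))"
proof -
  define X where "X = vsep T0 (\<lambda>t. elts (vsnd t) \<subseteq> elts (Y (vfst t)))"
  have "X \<in> N" unfolding X_def by (intro vsep_M dfn_intros Fn_comp[OF Y(1)] T0_N)
  moreover have "elts X \<subseteq> elts T0" unfolding X_def by auto
  ultimately obtain g1 where g1: "g1 \<in> elts w" "\<forall>b\<in>elts w. g1 \<in> elts (vins b b) \<longrightarrow> catch (vFin (B b)) X (A b)"
    using catch_N by blast
  have "\<exists>g\<in>elts w. elts g0 \<subseteq> elts g \<and> g1 \<in> elts (vins g g)"
    using w_linear[OF g0 g1(1)] w_subset_iff[OF g0 g1(1)] g0 g1(1) by auto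
  then obtain g where g: "g \<in> elts w" "elts g0 \<subseteq> elts g" "catch (vFin (B g)) X (A g)" using g1(2) by blast
  show ?thesis
  proof (cases "big (vFin (B g)) X vempty vempty")
    case True
    have "\<exists>y\<in>elts (Y (nat_code j)). y \<in> elts (A g) \<and> y \<notin> elts (nat_code m)" for j m
    proof -
      define D where "D = vset ((\<lambda>k. vins k vempty) ` elts (nat_code m))"
      have eD: "elts D = (\<lambda>k. vins k vempty) ` elts (nat_code m)" unfolding D_def by simp
      have "D \<in> elts (vFin (B g))" by (auto simp: eD elts_nat_code)
      moreover have "vempty \<in> elts (vFin (B g))" by simp
      ultimately obtain t y where t: "t \<in> elts X" "elts (nat_code j) \<subseteq> elts (vfst t)"
         "y \<in> elts (rem (vsnd t) D)" "y \<in> elts (A g)"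
        using g(3) True nat_code_omega[of j] unfolding catch_def by blast
      have "t \<in> elts T0" using t(1) unfolding X_def by simp
      then obtain i where i: "vfst t = nat_code i" by (metis T0_E vfst_pair)
      then have "j \<le> i" using t(2) by simp
      have "y \<in> elts (vsnd t)" "y \<notin> elts (nat_code m)" using t(3) unfolding rem_def eD by auto
      moreover have "elts (vsnd t) \<subseteq> elts (Y (nat_code i))" using t(1) i unfolding X_def by simp
      ultimately show ?thesis using dec[OF \<open>j \<le> i\<close>] t(4) by blast
    qed
    then show ?thesis using g by blast
  next
    case False
    then obtain D j where D: "D \<in> elts (vFin (B g))" "j \<in> elts omega"
      and no: "\<forall>t\<in>elts X. \<not> (elts j \<subseteq> elts (vfst t) \<and> natle j (rem (vsnd t) D))"
      unfolding big_def by (auto simp: hits_def misses_def)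
    obtain n where n: "j = nat_code n" using D(2) by (auto simp: elts_omega)
    define Z where "Z = elts (Y j) - \<Union> (elts ` elts D)"
    have "finite Z"
    proof (rule ccontr)
      assume "infinite Z"
      then obtain S where S: "finite S" "card S = n" "S \<subseteq> Z" using infinite_arbitrarily_large by blast
      have eS: "elts (vset S) = S" using S by (simp add: countable_finite)
      have "rem (vset S) D = vset S"
        unfolding rem_def by (rule V_eqI) (use S(3) eS in \<open>auto simp: Z_def\<close>)
      then have "natle j (rem (vset S) D)" using S eS by (simp add: n natle_iff)
      moreover have "S \<subseteq> elts (Y j)" using S(3) unfolding Z_def by blast
      then have "pair j (vset S) \<in> elts X"
        unfolding X_def T0_def using S(1) eS D(2) Y(2)[of n] n by auto
      ultimately show False using no by fastforce
    qed
    define E where "E = vset (elts D \<union> (\<lambda>k. vins k vempty) ` Z)"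
    have eE: "elts E = elts D \<union> (\<lambda>k. vins k vempty) ` Z" unfolding E_def using \<open>finite Z\<close> by (simp add: countable_finite)
    have "(\<lambda>k. vins k vempty) ` Z \<subseteq> elts (B g)"
      using Y(2)[of n] unfolding Z_def n by auto
    then have "E \<in> elts (vFin (B g))" using D(1) \<open>finite Z\<close> by (simp add: eE)
    moreover have "elts (Y (nat_code n)) \<subseteq> \<Union> (elts ` elts E)" unfolding eE by (auto simp: Z_def n)
    ultimately show ?thesis using g(1) by blast
  qed
qed

text \<open>With the constant sequence W, either some \<open>A b\<close> meets W beyond every bound,
  or finitely many sets cover W. In the latter case one of them has infinite intersection with W; it
  is no singleton, hence a tail of a member.\<close>

lemma maximal:
  assumes W: "W \<in> N" "elts W \<subseteq> elts omega" "infinite (elts W)"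
  shows "\<exists>b\<in>elts w. infinite (elts W \<inter> elts (A b))"
proof -
  obtain g0 where g0: "g0 \<in> elts w" using w_inf by (metis ex_in_conv finite.emptyI)
  from two_cases[OF Fn_const[OF W(1)] W(2) order_refl g0] show ?thesis
  proof
    assume "\<exists>b\<in>elts w. elts g0 \<subseteq> elts b \<and> (\<forall>(j::nat) m. \<exists>y\<in>elts W. y \<in> elts (A b) \<and> y \<notin> elts (nat_code m))"
    then obtain b where b: "b \<in> elts w" "\<And>m. \<exists>y\<in>elts W. y \<in> elts (A b) \<and> y \<notin> elts (nat_code m)" by blast
    have "infinite (elts W \<inter> elts (A b))"
    proof
      assume "finite (elts W \<inter> elts (A b))"
      then obtain F where F: "finite F" "elts W \<inter> elts (A b) = nat_code ` F"
        using W(2) finite_subset_image[of "elts W \<inter> elts (A b)" nat_code UNIV] by (auto simp: elts_omega)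
      obtain y where y: "y \<in> elts W \<inter> elts (A b)" "y \<notin> elts (nat_code (Suc (Max F)))" using b(2) by blast
      then obtain n where n: "y = nat_code n" "n \<in> F" using F(2) by blast
      then show False using y(2) Max_ge[OF F(1) n(2)] by (simp add: less_Suc_eq_le)
    qed
    with b show ?thesis by blast
  next
    assume "\<exists>b\<in>elts w. \<exists>D (j::nat). D \<in> elts (vFin (B b)) \<and> elts W \<subseteq> \<Union> (elts ` elts D)"
    then obtain b D where D: "b \<in> elts w" "D \<in> elts (vFin (B b))" "elts W \<subseteq> \<Union> (elts ` elts D)" by blast
    have "elts W = (\<Union>e\<in>elts D. elts W \<inter> elts e)" using D(3) by blast
    have "\<exists>e\<in>elts D. infinite (elts W \<inter> elts e)"
    proof (rule ccontr)
      assume "\<not> ?thesis"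
      then have "finite (\<Union>e\<in>elts D. elts W \<inter> elts e)" using D(2) by (intro finite_UN_I) auto
      then show False using W(3) \<open>elts W = _\<close> by simp
    qed
    then obtain e where e: "e \<in> elts D" "infinite (elts W \<inter> elts e)" by blast
    have "e \<in> elts (B b)" using D(2) e(1) by auto
    then consider k where "e = vins (nat_code k) vempty" | d m where "d \<in> elts b" "e = cut_below (A d) (nat_code m)"
      unfolding B_iff by blast
    then show ?thesis
    proof cases
      case 1
      then have "finite (elts W \<inter> elts e)" by simp
      with e show ?thesis by blast
    next
      case 2
      then have "elts W \<inter> elts e \<subseteq> elts W \<inter> elts (A d)" unfolding cut_below_def by auto
      then show ?thesis using e(2) 2(1) w_trans[OF _ D(1)] finite_subset by blast
    qed
  qed
qed

lemma A_almost_disjoint: "almost_disjoint_family (vimg A w)"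
  unfolding almost_disjoint_family_def
proof (intro conjI ballI impI)
  show "infinite (elts (vimg A w))" using w_inf A_inj by (simp add: finite_image_iff)
  show "elts a \<subseteq> elts omega" "infinite (elts a)" if "a \<in> elts (vimg A w)" for a
    using that A_sub A_inf by auto
  show "finite (elts a \<inter> elts b)" if "a \<in> elts (vimg A w)" "b \<in> elts (vimg A w)" "a \<noteq> b" for a b
    using that A_ad2 by (auto simp: image_iff)
qed

lemma A_MAD: "MAD_in N (vimg A w)"
  unfolding MAD_in_def
proof (intro conjI ballI impI A_N A_almost_disjoint)
  fix C assume C: "C \<in> N" "almost_disjoint_family C \<and> elts (vimg A w) \<subseteq> elts C"
  have "x \<in> elts (vimg A w)" if x: "x \<in> elts C" for x
  proof (rule ccontr)
    assume n: "x \<notin> elts (vimg A w)"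
    have "elts x \<subseteq> elts omega" "infinite (elts x)"
      using C(2) x unfolding almost_disjoint_family_def by blast+
    moreover have "x \<in> N" using mem_M[OF x C(1)] .
    ultimately obtain b where b: "b \<in> elts w" "infinite (elts x \<inter> elts (A b))" using maximal by blast
    then have "A b \<in> elts C" "A b \<noteq> x" using C n by auto
    moreover have "\<forall>a\<in>elts C. \<forall>b\<in>elts C. a \<noteq> b \<longrightarrow> finite (elts a \<inter> elts b)"
      using C(2) unfolding almost_disjoint_family_def by simp
    ultimately have "finite (elts x \<inter> elts (A b))" using x by metis
    with b(2) show False ..
  qed
  with C(2) have "elts C = elts (vimg A w)" by blast
  then show "C = vimg A w" by (simp only: V_eq_iff)
qed

end

section \<open>Accumulation points in the hyperspace\<close>

context caught
begin

abbreviation CLp :: "V set" where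
  "CLp \<equiv> CL_points N (Psi_points (vimg A w)) (Psi_opens N (vimg A w))"

abbreviation Vb :: "V set \<Rightarrow> V set" where
  "Vb \<equiv> Vietoris_basic N (Psi_points (vimg A w)) (Psi_opens N (vimg A w))"

definition unb :: "V \<Rightarrow> bool" where
  "unb X \<longleftrightarrow> (\<forall>j. \<exists>t\<in>elts X. elts (nat_code j) \<subseteq> elts (vfst t))"

lemma bounded_omega:
  assumes "finite K" "K \<subseteq> elts omega" shows "\<exists>m. K \<subseteq> elts (nat_code m)"
proof -
  obtain F where F: "finite F" "K = nat_code ` F"
    using assms finite_subset_image[of K nat_code UNIV] by (auto simp: elts_omega)
  have "nat_code i \<in> elts (nat_code (Suc (Max F)))" if "i \<in> F" for i
    using Max_ge[OF F(1) that] by (simp add: less_Suc_eq_le)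
  then show ?thesis using F(2) by blast
qed

text \<open>Natural numbers are isolated, so openness of the complement only has to be checked at
  members of the family outside F: a tail of such a member must miss F.\<close>

lemma closedI:
  assumes F: "F \<in> N" "elts F \<noteq> {}" "elts F \<subseteq> Psi_points (vimg A w)"
    and cl: "\<And>d. d \<in> elts w \<Longrightarrow> A d \<notin> elts F \<Longrightarrow> finite (elts (A d) \<inter> elts F)"
  shows "F \<in> CLp"
proof -
  obtain Pt where Pt: "Pt \<in> N" "elts Pt = Psi_points (vimg A w)"
    using points_N unfolding Psi_points_def by blast
  have "vsep Pt (\<lambda>x. x \<notin> elts F) \<in> N" by (intro vsep_M Pt dfn_intros F)
  moreover have "\<exists>n\<in>elts omega. insert a (elts a - elts n) \<subseteq> elts (vsep Pt (\<lambda>x. x \<notin> elts F))"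
    if a: "a \<in> elts (vimg A w) \<inter> elts (vsep Pt (\<lambda>x. x \<notin> elts F))" for a
  proof -
    obtain d where d: "d \<in> elts w" "a = A d" "A d \<notin> elts F" using a by auto
    obtain m where "elts (A d) \<inter> elts F \<subseteq> elts (nat_code m)"
      using bounded_omega[OF cl[OF d(1,3)]] A_sub[OF d(1)] by blast
    then show ?thesis
      using d A_sub[OF d(1)] Pt(2) unfolding Psi_points_def by (intro bexI[of _ "nat_code m"]) auto
  qed
  ultimately have "vsep Pt (\<lambda>x. x \<notin> elts F) \<in> Psi_opens N (vimg A w)"
    unfolding Psi_opens_def using Pt(2) by auto
  then show ?thesis unfolding CL_points_def using F Pt(2) by (auto intro!: bexI[of _ "vsep Pt (\<lambda>x. x \<notin> elts F)"])
qed

lemma finite_CLp: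
  assumes "s \<in> N" "elts s \<noteq> {}" "finite (elts s)" "elts s \<subseteq> elts omega" shows "s \<in> CLp"
  by (rule closedI) (use assms in \<open>auto simp: Psi_points_def\<close>)

lemma A_not_omega: "d \<in> elts w \<Longrightarrow> A d \<notin> elts omega"
  using A_inf[of d] by (auto simp: elts_omega)

lemma cover_finite:
  assumes "elts z \<subseteq> elts w" "D \<in> elts (vFin (B z))"
  shows "\<exists>I. finite I \<and> I \<subseteq> elts z \<and> finite (\<Union> (elts ` elts D) - (\<Union>d\<in>I. elts (A d)))"
proof -
  have "\<forall>e\<in>elts D. \<exists>d. (\<exists>k. e = vins (nat_code k) vempty) \<or> (d \<in> elts z \<and> (\<exists>m. e = cut_below (A d) (nat_code m)))"
    using assms(2) by (auto simp: B_iff subset_iff)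
  then obtain h where h: "\<And>e. e \<in> elts D \<Longrightarrow> (\<exists>k. e = vins (nat_code k) vempty) \<or>
      (h e \<in> elts z \<and> (\<exists>m. e = cut_below (A (h e)) (nat_code m)))" by metis
  define I where "I = {d \<in> h ` elts D. d \<in> elts z}"
  have fD: "finite (elts D)" using assms(2) by simp
  have fe: "finite (elts e - (\<Union>d\<in>I. elts (A d)))" if e: "e \<in> elts D" for e
    using h[OF e]
  proof
    assume he: "h e \<in> elts z \<and> (\<exists>m. e = cut_below (A (h e)) (nat_code m))"
    then obtain m where "e = cut_below (A (h e)) (nat_code m)" by blast
    then have "elts e \<subseteq> elts (A (h e))"
      by (metis (no_types, lifting) cut_below_def elts_vsep mem_Collect_eq subsetI)
    moreover have "h e \<in> I" unfolding I_def using e he by blast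
    ultimately have "elts e - (\<Union>d\<in>I. elts (A d)) = {}" by blast
    then show ?thesis by (metis finite.emptyI)
  qed auto
  have "\<Union> (elts ` elts D) - (\<Union>d\<in>I. elts (A d)) = (\<Union>e\<in>elts D. elts e - (\<Union>d\<in>I. elts (A d)))" by blast
  then have "finite (\<Union> (elts ` elts D) - (\<Union>d\<in>I. elts (A d)))" by (simp only: finite_UN_I[OF fD fe])
  moreover have "finite I" "I \<subseteq> elts z" unfolding I_def using fD by auto
  ultimately show ?thesis by blast
qed

text \<open>\<open>S\<close> decides which sets of \<open>B g\<close> are to be hit; the decisions are made one after the other,
  hitting whenever this keeps the pattern good. Finite approximations of \<open>S\<close> make it definable.\<close>

lemma greedy:
  assumes g: "g \<in> elts w"
    and good: "dfn (\<lambda>p. good (vfst p) (vsnd p))" and good0: "good vempty vempty"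
    and split: "\<And>a b e. a \<in> elts (vFin (B g)) \<Longrightarrow> b \<in> elts (vFin (B g)) \<Longrightarrow> e \<in> elts (B g) \<Longrightarrow> good a b \<Longrightarrow>
       good (vins e a) b \<or> good a (vins e b)"
    and mono: "\<And>a b a' b'. good a b \<Longrightarrow> elts a' \<subseteq> elts a \<Longrightarrow> elts b' \<subseteq> elts b \<Longrightarrow> good a' b'"
  shows "\<exists>S\<in>N. elts S \<subseteq> elts (B g) \<and> (\<forall>a b. finite (elts a) \<and> elts a \<subseteq> elts S \<and> finite (elts b) \<and>
     elts b \<subseteq> elts (B g) - elts S \<longrightarrow> good a b)"
proof -
  have BN: "B g \<in> N" using Bs_N[OF g] by blast
  obtain E where E: "E \<in> N" "elts (B g) \<subseteq> vapp E ` elts omega" using Bs_enum[OF g] by blast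
  \<comment> \<open>The candidate \<open>l\<close> is already included among the sets to be hit, so
    goodness of the pair \<open>pa S l\<close>, \<open>pb S l\<close> asks whether hitting it agrees
    with the decisions below \<open>l\<close>.\<close>
  define pa where "pa S l = vsep (B g) (\<lambda>x. \<exists>m\<in>elts (vins l l). (m \<in> S \<or> m = l) \<and> x = vapp E m)" for S l
  define pb where "pb S l = vsep (B g) (\<lambda>x. \<exists>m\<in>elts l. m \<notin> S \<and> x = vapp E m)" for S l
  define c where "c = rec_nat {} (\<lambda>n S. S \<union> (if good (pa (nat_code ` S) (nat_code n)) (pb (nat_code ` S) (nat_code n)) then {n} else {}))"
  have cS: "c (Suc n) = c n \<union> (if good (pa (nat_code ` c n) (nat_code n)) (pb (nat_code ` c n) (nat_code n)) then {n} else {})"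
    and c0: "c 0 = {}" for n
    by (simp_all add: c_def)
  define C where "C = (\<Union>n. c n)"
  have cn: "c n \<subseteq> {..<n}" for n
    by (induction n) (auto simp: c0 cS split: if_splits)
  have cmono: "c m \<subseteq> c n" if "m \<le> n" for m n
    by (rule lift_Suc_mono_le[OF _ that]) (simp add: cS)
  have cstay: "i < n \<Longrightarrow> i \<in> c m \<Longrightarrow> i \<in> c n" for i m n
  proof (induction m)
    case (Suc m)
    then show ?case using cn[of m] cmono[of "Suc m" n] by (auto simp: cS split: if_splits)
  qed (simp add: c0)
  have Cc: "C \<inter> {..<n} = c n" for n
    using cn[of n] cstay unfolding C_def by auto
  have pcong: "pa S l = pa S' l" "pb S l = pb S' l" if "S \<inter> elts l = S' \<inter> elts l" for S S' l
  proof -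
    have m: "m \<in> elts l \<Longrightarrow> m \<in> S \<longleftrightarrow> m \<in> S'" for m using that by blast
    have "l \<notin> elts l" by simp
    then have *: "(m \<in> S \<or> m = l) \<longleftrightarrow> (m \<in> S' \<or> m = l)" if "m \<in> elts (vins l l)" for m using m that by auto
    show "pa S l = pa S' l" unfolding pa_def using * by (intro V_eqI) auto
    show "pb S l = pb S' l" unfolding pb_def using m by (intro V_eqI) auto
  qed
  have C: "l \<in> C \<longleftrightarrow> good (pa (nat_code ` C) (nat_code l)) (pb (nat_code ` C) (nat_code l))" for l
  proof -
    have e: "nat_code ` C \<inter> elts (nat_code l) = nat_code ` c l \<inter> elts (nat_code l)"
      using Cc[of l] cn[of l] by (auto simp: elts_nat_code)
    have "l \<in> C \<longleftrightarrow> l \<in> c (Suc l)" using Cc[of "Suc l"] by auto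
    also have "\<dots> \<longleftrightarrow> good (pa (nat_code ` c l) (nat_code l)) (pb (nat_code ` c l) (nat_code l))"
      using cn[of l] by (auto simp: cS)
    finally show ?thesis unfolding pcong[OF e] .
  qed
  define qa where "qa n = vsep (B g) (\<lambda>x. \<exists>m<n. m \<in> C \<and> x = vapp E (nat_code m))" for n
  define qb where "qb n = vsep (B g) (\<lambda>x. \<exists>m<n. m \<notin> C \<and> x = vapp E (nat_code m))" for n
  have pa_q: "pa (nat_code ` C) (nat_code n) = vsep (B g) (\<lambda>x. (\<exists>m<n. m \<in> C \<and> x = vapp E (nat_code m)) \<or> x = vapp E (nat_code n))" for n
    unfolding pa_def by (rule V_eqI) (auto simp: elts_nat_code)
  have pb_q: "pb (nat_code ` C) (nat_code n) = qb n" for n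
    unfolding pb_def qb_def by (rule V_eqI) (auto simp: elts_nat_code)
  have qfin: "finite (elts (qa n))" "finite (elts (qb n))" for n
    unfolding qa_def qb_def elts_vsep
    by (rule finite_subset[of _ "(\<lambda>m. vapp E (nat_code m)) ` {..<n}"]; auto)+
  have inv: "good (qa n) (qb n)" for n
  proof (induction n)
    case 0
    have "qa 0 = vempty" "qb 0 = vempty" unfolding qa_def qb_def by (auto intro: V_eqI)
    then show ?case using good0 by simp
  next
    case (Suc n)
    show ?case
    proof (cases "n \<in> C")
      case True
      then have "good (pa (nat_code ` C) (nat_code n)) (qb n)" using C[of n] unfolding pb_q by blast
      moreover have "elts (qa (Suc n)) \<subseteq> elts (pa (nat_code ` C) (nat_code n))"
        unfolding pa_q qa_def by (auto simp: less_Suc_eq)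
      moreover have "elts (qb (Suc n)) \<subseteq> elts (qb n)"
        unfolding qb_def using True by (auto simp: less_Suc_eq)
      ultimately show ?thesis using mono by blast
    next
      case False
      then have ng: "\<not> good (pa (nat_code ` C) (nat_code n)) (qb n)" using C[of n] unfolding pb_q by blast
      have sub: "elts (qa (Suc n)) \<subseteq> elts (qa n)"
        unfolding qa_def using False by (auto simp: less_Suc_eq)
      show ?thesis
      proof (cases "vapp E (nat_code n) \<in> elts (B g)")
        case True
        \<comment> \<open>The candidate was rejected, which excludes the first alternative and
          leaves the one in which it is missed.\<close>
        have "good (vins (vapp E (nat_code n)) (qa n)) (qb n) \<or> good (qa n) (vins (vapp E (nat_code n)) (qb n))"
          by (rule split[OF _ _ True Suc]) (use qfin in \<open>auto simp: qa_def qb_def\<close>)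
        moreover have "elts (pa (nat_code ` C) (nat_code n)) \<subseteq> elts (vins (vapp E (nat_code n)) (qa n))"
          unfolding pa_q qa_def by auto
        ultimately have "good (qa n) (vins (vapp E (nat_code n)) (qb n))" using ng mono by blast
        moreover have "elts (qb (Suc n)) \<subseteq> elts (vins (vapp E (nat_code n)) (qb n))"
          unfolding qb_def by (auto simp: less_Suc_eq)
        ultimately show ?thesis using mono sub by blast
      next
        case nE: False
        \<comment> \<open>An index that enumerates no member of \<open>B g\<close> adds nothing to
          the pattern, so it cannot have been rejected.\<close>
        then have "elts (pa (nat_code ` C) (nat_code n)) \<subseteq> elts (qa n)"
          unfolding pa_q qa_def by auto
        then show ?thesis using ng mono Suc by blast
      qed
    qed
  qed
  \<comment> \<open>The sets \<open>c n\<close> come from a recursion outside N. For separation in N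
    the decision about \<open>i\<close> is described by a finite set \<open>s\<close> that obeys the
    greedy rule up to \<open>i\<close>; below \<open>i\<close> and at \<open>i\<close> such an
    \<open>s\<close> must agree with \<open>C\<close>.\<close>
  define S where "S = vsep (B g) (\<lambda>x. \<exists>i\<in>elts omega. x = vapp E i \<and> (\<exists>s\<in>elts (vFin omega). i \<in> elts s \<and>
      (\<forall>l\<in>elts (vins i i). l \<in> elts s \<longleftrightarrow> good (pa (elts s) l) (pb (elts s) l))))"
  have Fpa: "Fn (\<lambda>x. pa (elts (f x)) (h x))" "Fn (\<lambda>x. pb (elts (f x)) (h x))" if fh: "Fn f" "Fn h" for f h
    unfolding pa_def pb_def
    by (intro dfn_intros BN E Fn_comp[OF fh(1)] Fn_comp[OF fh(2)])+
  have good2: "dfn (\<lambda>x. good (f x) (h x))" if "Fn f" "Fn h" for f h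
    using dfn_comp[OF good Fn_pair[OF that]] by simp
  have SN: "S \<in> N"
    unfolding S_def by (intro vsep_M BN dfn_intros omega_M E Fin_N good2 Fpa)
  have S: "x \<in> elts S \<longleftrightarrow> x \<in> elts (B g) \<and> (\<exists>i\<in>C. x = vapp E (nat_code i))" for x
  proof
    assume x: "x \<in> elts S"
    then obtain n s where n: "x = vapp E (nat_code n)" "nat_code n \<in> elts s"
      "\<forall>l\<in>elts (vins (nat_code n) (nat_code n)). l \<in> elts s \<longleftrightarrow> good (pa (elts s) l) (pb (elts s) l)"
      unfolding S_def by (auto simp: elts_omega)
    have "m \<le> n \<longrightarrow> (nat_code m \<in> elts s \<longleftrightarrow> m \<in> C)" for m
    proof (induction m rule: less_induct)
      case (less m)
      show ?case
      proof
        assume m: "m \<le> n"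
        have "nat_code i \<in> elts s \<longleftrightarrow> i \<in> C" if "i < m" for i using less[OF that] m that by simp
        then have e1: "elts s \<inter> elts (nat_code m) = nat_code ` C \<inter> elts (nat_code m)"
          unfolding elts_nat_code by auto
        have "nat_code m \<in> elts (vins (nat_code n) (nat_code n))" using m by auto
        then show "nat_code m \<in> elts s \<longleftrightarrow> m \<in> C"
          using n(3) unfolding C[of m] pcong[OF e1, symmetric] by blast
      qed
    qed
    then show "x \<in> elts (B g) \<and> (\<exists>i\<in>C. x = vapp E (nat_code i))" using n x unfolding S_def by auto
  next
    assume x: "x \<in> elts (B g) \<and> (\<exists>i\<in>C. x = vapp E (nat_code i))"
    then obtain i where i: "i \<in> C" "x = vapp E (nat_code i)" by blast
    let ?s = "vset (nat_code ` c (Suc i))"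
    have es: "elts ?s = nat_code ` c (Suc i)" by simp
    have "finite (c (Suc i))" using cn finite_subset by blast
    then have "?s \<in> elts (vFin omega)" using es by auto
    moreover have "i \<in> c (Suc i)" using i(1) Cc[of "Suc i"] by auto
    moreover have "\<forall>l\<in>elts (vins (nat_code i) (nat_code i)). l \<in> elts ?s \<longleftrightarrow> good (pa (elts ?s) l) (pb (elts ?s) l)"
    proof
      fix l assume "l \<in> elts (vins (nat_code i) (nat_code i))"
      then obtain m where m: "l = nat_code m" "m \<le> i" by (auto simp: elts_nat_code)
      then have e1: "elts ?s \<inter> elts l = nat_code ` C \<inter> elts l"
        unfolding es Cc[of "Suc i", symmetric] by (auto simp: elts_nat_code)
      have "good (pa (elts ?s) l) (pb (elts ?s) l) \<longleftrightarrow> m \<in> C"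
        unfolding pcong[OF e1] unfolding m(1) using C[of m] by blast
      moreover have "m \<in> c (Suc i) \<longleftrightarrow> m \<in> C" unfolding Cc[of "Suc i", symmetric] using m(2) by simp
      moreover have "l \<in> elts ?s \<longleftrightarrow> m \<in> c (Suc i)" unfolding es m(1) by (simp only: inj_image_mem_iff[OF inj_nat_code])
      ultimately show "l \<in> elts ?s \<longleftrightarrow> good (pa (elts ?s) l) (pb (elts ?s) l)" by blast
    qed
    moreover have "nat_code i \<in> elts ?s" using \<open>i \<in> c (Suc i)\<close> unfolding es by blast
    ultimately have "\<exists>s\<in>elts (vFin omega). nat_code i \<in> elts s \<and>
      (\<forall>l\<in>elts (vins (nat_code i) (nat_code i)). l \<in> elts s \<longleftrightarrow> good (pa (elts s) l) (pb (elts s) l))"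
      by blast
    then show "x \<in> elts S" unfolding S_def elts_vsep mem_Collect_eq using x i(2) nat_code_omega[of i] by blast
  qed
  have "good a b" if a: "finite (elts a)" "elts a \<subseteq> elts S" and b: "finite (elts b)" "elts b \<subseteq> elts (B g) - elts S" for a b
  proof -
    have "\<forall>x\<in>elts a \<union> elts b. \<exists>m. x = vapp E (nat_code m) \<and> (m \<in> C \<longleftrightarrow> x \<in> elts S)"
    proof
      fix x assume "x \<in> elts a \<union> elts b"
      then consider "x \<in> elts S" | "x \<in> elts (B g)" "x \<notin> elts S" using a b by blast
      then show "\<exists>m. x = vapp E (nat_code m) \<and> (m \<in> C \<longleftrightarrow> x \<in> elts S)"
      proof cases
        case 1
        then show ?thesis using S by blast
      next
        case 2
        then obtain m where "x = vapp E (nat_code m)" using E(2) by (auto simp: elts_omega)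
        then show ?thesis using 2 S by blast
      qed
    qed
    then obtain h where h: "\<And>x. x \<in> elts a \<union> elts b \<Longrightarrow> x = vapp E (nat_code (h x)) \<and> (h x \<in> C \<longleftrightarrow> x \<in> elts S)"
      by metis
    define n where "n = Suc (Max (insert 0 (h ` (elts a \<union> elts b))))"
    have hn: "h x < n" if "x \<in> elts a \<union> elts b" for x
      unfolding n_def less_Suc_eq_le by (rule Max_ge) (use a b that in auto)
    have "elts a \<subseteq> elts (qa n)"
    proof
      fix x assume x: "x \<in> elts a"
      then have "x \<in> elts (B g)" "x \<in> elts S" using a S by blast+
      then show "x \<in> elts (qa n)" unfolding qa_def using h[of x] hn[of x] x by auto
    qed
    moreover have "elts b \<subseteq> elts (qb n)"
    proof
      fix x assume x: "x \<in> elts b"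
      then have "x \<in> elts (B g)" "x \<notin> elts S" using b by blast+
      then show "x \<in> elts (qb n)" unfolding qb_def using h[of x] hn[of x] x by auto
    qed
    ultimately show ?thesis using mono[OF inv] by blast
  qed
  moreover have "elts S \<subseteq> elts (B g)" unfolding S_def by auto
  ultimately show ?thesis using SN by blast
qed

end

section \<open>The accumulation point and its neighbourhoods\<close>

context caught
begin

lemma A_in_vimg: "g \<in> elts w \<Longrightarrow> d \<in> elts w \<Longrightarrow> A d \<in> elts (vimg A g) \<longleftrightarrow> d \<in> elts g"
  using inj_onD[OF A_inj] w_trans by auto

text \<open>F consists of the numbers whose singleton is in S, the \<open>A d\<close> with
  \<open>d\<close> below \<open>g\<close> all of whose tails are in S, and the members in
  \<open>AJ\<close>. Given a neighbourhood of F, the part of \<open>U0\<close> that it leaves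
  uncovered is contained in a finite union of tails and singletons outside S; missing these keeps a
  finite set inside, and hitting a tail or singleton within each open set makes it meet all of them.
  Both cases of the main dichotomy are instances, with different \<open>U0\<close> and
  \<open>AJ\<close>.\<close>

lemma accumulation_core:
  assumes g: "g \<in> elts w" and S: "S \<in> N" "elts S \<subseteq> elts (B g)"
    and AJ: "AJ \<in> N" "elts AJ \<subseteq> elts (vimg A w)"
    and U0: "U0 \<in> N" "elts U0 \<subseteq> elts omega"
    and X1: "\<And>t. t \<in> X1 \<Longrightarrow> vsnd t \<in> N \<and> finite (elts (vsnd t)) \<and> elts (vsnd t) \<noteq> {} \<and> elts (vsnd t) \<subseteq> elts U0"
    and real: "\<And>a b C j. finite a \<Longrightarrow> a \<subseteq> elts S \<Longrightarrow> finite b \<Longrightarrow> b \<subseteq> elts (B g) - elts S \<Longrightarrow> finite C \<Longrightarrow>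
      C \<subseteq> {cut_below e (nat_code m) | e m. e \<in> elts AJ} \<Longrightarrow>
      \<exists>t\<in>X1. elts (nat_code j) \<subseteq> elts (vfst t) \<and> hits (vsnd t) (vset (a \<union> C)) \<and> misses (vsnd t) (vset b)"
    and cov: "\<And>W. W \<in> N \<Longrightarrow> elts W \<subseteq> elts U0 \<Longrightarrow> (\<And>e. e \<in> elts AJ \<Longrightarrow> finite (elts W \<inter> elts e)) \<Longrightarrow>
      \<exists>I. finite I \<and> I \<subseteq> elts g \<and> finite (elts W - (\<Union>d\<in>I. elts (A d)))"
    and out: "\<And>d. d \<in> elts w \<Longrightarrow> d \<notin> elts g \<Longrightarrow> A d \<notin> elts AJ \<Longrightarrow> finite (elts U0 \<inter> elts (A d))"
  shows "\<exists>F\<in>CLp. \<forall>U j. finite U \<and> U \<subseteq> Psi_opens N (vimg A w) \<and> F \<in> Vb U \<longrightarrow>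
    (\<exists>t\<in>X1. elts (nat_code j) \<subseteq> elts (vfst t) \<and> vsnd t \<in> Vb U)"
proof -
  obtain Pt where Pt: "Pt \<in> N" "elts Pt = elts (vimg A w) \<union> elts omega" using points_N by blast
  define F where "F = vsep Pt (\<lambda>x. (x \<in> elts omega \<and> vins x vempty \<in> elts S) \<or>
     (x \<in> elts (vimg A g) \<and> (\<forall>m\<in>elts omega. cut_below x m \<in> elts S)) \<or> x \<in> elts AJ)"
  have FN: "F \<in> N"
    unfolding F_def by (intro vsep_M Pt dfn_intros omega_M S AJ vempty_M A_below_N[OF g])
  have F_nat: "nat_code n \<in> elts F \<longleftrightarrow> vins (nat_code n) vempty \<in> elts S" for n
  proof -
    have "nat_code n \<notin> elts (vimg A w)"
    proof
      assume "nat_code n \<in> elts (vimg A w)"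
      then obtain d where "d \<in> elts w" "nat_code n = A d" by auto
      then show False using A_not_omega[of d] nat_code_omega[of n] by simp
    qed
    moreover have "elts (vimg A g) \<subseteq> elts (vimg A w)" using w_trans[OF _ g] by auto
    ultimately show ?thesis unfolding F_def using Pt(2) AJ(2) by auto
  qed
  have F_A: "A d \<in> elts F \<longleftrightarrow> (d \<in> elts g \<and> (\<forall>m. cut_below (A d) (nat_code m) \<in> elts S)) \<or> A d \<in> elts AJ"
    if d: "d \<in> elts w" for d
    using A_not_omega[OF d] A_in_vimg[OF g d] Pt(2) d unfolding F_def by (auto simp: elts_omega)
  have sub_w: "elts g \<subseteq> elts w" using w_trans[OF _ g] by blast
  have cover: "\<exists>b. finite b \<and> b \<subseteq> elts (B g) - elts S \<and>
      (\<forall>s. elts s \<subseteq> elts U0 \<and> misses s (vset b) \<longrightarrow> elts s \<inter> elts W = {})"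
    if W: "W \<in> N" "elts W \<subseteq> elts omega" "elts W \<inter> elts F = {}"
      "\<And>d. d \<in> elts w \<Longrightarrow> A d \<in> elts F \<Longrightarrow> finite (elts W \<inter> elts (A d))" for W
  proof -
    define W' where "W' = vsep W (\<lambda>x. x \<in> elts U0)"
    have W'N: "W' \<in> N" unfolding W'_def by (intro vsep_M W dfn_intros U0)
    have W'U: "elts W' \<subseteq> elts U0" unfolding W'_def by auto
    have W'f: "finite (elts W' \<inter> elts e)" if e: "e \<in> elts AJ" for e
    proof -
      obtain d where d: "d \<in> elts w" "e = A d" using AJ(2) e by auto
      then have "A d \<in> elts F" using F_A[OF d(1)] e by simp
      then have "finite (elts W \<inter> elts e)" using W(4)[OF d(1)] d(2) by simp
      then show ?thesis by (rule rev_finite_subset) (auto simp: W'_def)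
    qed
    obtain I where I: "finite I" "I \<subseteq> elts g" "finite (elts W' - (\<Union>d\<in>I. elts (A d)))"
      using cov[OF W'N W'U W'f] by blast
    \<comment> \<open>The members in F meet W finitely. For each of the others some tail is outside
      S, and these tails cover W' up to the finite set K, whose singletons are outside S as
      well.\<close>
    define J where "J = {d \<in> I. A d \<notin> elts F}"
    have J: "finite J" "J \<subseteq> elts g" using I unfolding J_def by auto
    have "\<forall>d\<in>J. \<exists>m. cut_below (A d) (nat_code m) \<notin> elts S"
    proof
      fix d assume d: "d \<in> J"
      then have "d \<in> elts g" "d \<in> elts w" "A d \<notin> elts F" using J(2) sub_w unfolding J_def by auto
      then show "\<exists>m. cut_below (A d) (nat_code m) \<notin> elts S" using F_A[of d] by simp
    qed
    then obtain m where m: "\<And>d. d \<in> J \<Longrightarrow> cut_below (A d) (nat_code (m d)) \<notin> elts S" by metis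
    define K where "K = elts W' - (\<Union>d\<in>J. elts (cut_below (A d) (nat_code (m d))))"
    have "K \<subseteq> (elts W' - (\<Union>d\<in>I. elts (A d))) \<union> (\<Union>d\<in>I - J. elts W \<inter> elts (A d)) \<union> (\<Union>d\<in>J. elts (nat_code (m d)))"
      unfolding K_def W'_def cut_below_def by auto
    moreover have "finite (elts W \<inter> elts (A d))" if "d \<in> I - J" for d
      using that W(4) I(2) sub_w unfolding J_def by blast
    then have "finite (\<Union>d\<in>I - J. elts W \<inter> elts (A d))" using I(1) by blast
    ultimately have fK: "finite K" using I J by (meson finite_UN_I finite_UnI finite_nat_code finite_subset)
    have K: "k \<in> elts omega" "vins k vempty \<notin> elts S" if "k \<in> K" for k
    proof -
      have k: "k \<in> elts W" using that unfolding K_def W'_def by auto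
      then show "k \<in> elts omega" using W(2) by blast
      then show "vins k vempty \<notin> elts S" using k W(3) F_nat by (auto simp: elts_omega)
    qed
    define b where "b = (\<lambda>d. cut_below (A d) (nat_code (m d))) ` J \<union> (\<lambda>k. vins k vempty) ` K"
    have fb: "finite b" unfolding b_def using fK J by simp
    then have eb: "elts (vset b) = b" by (simp add: countable_finite)
    have "cut_below (A d) (nat_code (m d)) \<in> elts (B g)" if "d \<in> J" for d
      using J(2) that unfolding B_iff by blast
    then have bsub: "b \<subseteq> elts (B g) - elts S" unfolding b_def using m K by auto
    have dis: "elts s \<inter> elts W = {}" if s: "elts s \<subseteq> elts U0" "misses s (vset b)" for s
    proof (rule ccontr)
      assume "elts s \<inter> elts W \<noteq> {}"
      then obtain x where x: "x \<in> elts s" "x \<in> elts W" by blast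
      then have xW': "x \<in> elts W'" using s(1) unfolding W'_def by auto
      have ms: "x \<notin> elts e" if "e \<in> b" for e using s(2) x(1) that unfolding misses_def eb by blast
      show False
      proof (cases "x \<in> K")
        case True
        then have "vins x vempty \<in> b" unfolding b_def by (intro UnI2 imageI)
        then show ?thesis using ms[of "vins x vempty"] by simp
      next
        case False
        then obtain d where d: "d \<in> J" "x \<in> elts (cut_below (A d) (nat_code (m d)))" using xW' unfolding K_def by blast
        have "cut_below (A d) (nat_code (m d)) \<in> b" unfolding b_def using d(1) by (intro UnI1 imageI)
        then show ?thesis using ms d(2) by metis
      qed
    qed
    show ?thesis
      by (intro exI[of _ b] conjI allI impI fb bsub) (rule dis; simp)
  qed
  have sing: "vset {e} = vins e vempty" for e by (rule V_eqI) (simp add: countable_finite)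
  \<comment> \<open>Some finite set from \<open>X1\<close> realizes the pattern that hits this
    singleton, and all those sets are contained in \<open>U0\<close>.\<close>
  have k_U0: "nat_code n \<in> elts U0" if n: "vins (nat_code n) vempty \<in> elts S" for n
  proof -
    obtain t where t: "t \<in> X1" "hits (vsnd t) (vset {vins (nat_code n) vempty})"
      using real[of "{vins (nat_code n) vempty}" "{}" "{}" 0] n by auto
    then have "nat_code n \<in> elts (vsnd t)" unfolding hits_def sing by simp
    then show ?thesis using X1[OF t(1)] by blast
  qed
  have "F \<in> CLp"
  proof (rule closedI[OF FN])
    show "elts F \<subseteq> Psi_points (vimg A w)" unfolding F_def Psi_points_def using Pt(2) by auto
    show "elts F \<noteq> {}"
    proof
      assume "elts F = {}"
      then obtain b where b: "finite b" "b \<subseteq> elts (B g) - elts S"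
        "\<forall>s. elts s \<subseteq> elts U0 \<and> misses s (vset b) \<longrightarrow> elts s \<inter> elts U0 = {}"
        using cover[OF U0] by auto
      obtain t where "t \<in> X1" "misses (vsnd t) (vset b)" using real[of "{}" b "{}" 0] b by auto
      then show False using b(3) X1[of t] by blast
    qed
    fix d assume d: "d \<in> elts w" "A d \<notin> elts F"
    have Fw: "nat_code n \<in> elts U0" if "nat_code n \<in> elts F" for n using that k_U0 F_nat by blast
    show "finite (elts (A d) \<inter> elts F)"
    proof (cases "d \<in> elts g")
      case True
      then obtain m where m: "cut_below (A d) (nat_code m) \<notin> elts S" using d F_A by blast
      have "elts (A d) \<inter> elts F \<subseteq> elts (nat_code m)"
      proof
        fix x assume x: "x \<in> elts (A d) \<inter> elts F"
        then obtain n where n: "x = nat_code n" using A_sub[OF d(1)] by (auto simp: elts_omega)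
        show "x \<in> elts (nat_code m)"
        proof (rule ccontr)
          assume nx: "x \<notin> elts (nat_code m)"
          have "cut_below (A d) (nat_code m) \<in> elts (B g)" using True by (auto simp: B_iff)
          \<comment> \<open>The singleton is to be hit and the tail to be missed, although
            \<open>x\<close> lies in the tail: a pattern that no set realizes.\<close>
          then obtain t where t: "hits (vsnd t) (vset {vins x vempty})" "misses (vsnd t) (vset {cut_below (A d) (nat_code m)})"
            using real[of "{vins x vempty}" "{cut_below (A d) (nat_code m)}" "{}" 0] m x F_nat n by auto
          then have "x \<in> elts (vsnd t)" unfolding hits_def sing by simp
          then show False using t(2) nx x unfolding misses_def sing cut_below_def by auto
        qed
      qed
      then show ?thesis by (rule finite_subset) simp
    next
      case False
      then have "finite (elts U0 \<inter> elts (A d))" using out d F_A by blast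
      moreover have "elts (A d) \<inter> elts F \<subseteq> elts U0 \<inter> elts (A d)"
        using Fw A_sub[OF d(1)] unfolding elts_omega by blast
      ultimately show ?thesis by (rule rev_finite_subset)
    qed
  qed
  moreover have "\<exists>t\<in>X1. elts (nat_code j) \<subseteq> elts (vfst t) \<and> vsnd t \<in> Vb U"
    if U: "finite U" "U \<subseteq> Psi_opens N (vimg A w)" "F \<in> Vb U" for U j
  proof -
    have UN: "u \<in> N" if "u \<in> U" for u using U(2) that unfolding Psi_opens_def by blast
    then have vU: "vset U \<in> N" using finite_M U(1) by blast
    have eU: "elts (vset U) = U" using U(1) by (simp add: countable_finite)
    have FU: "elts F \<subseteq> (\<Union>u\<in>U. elts u)" "\<forall>u\<in>U. elts F \<inter> elts u \<noteq> {}" using U(3) unfolding Vietoris_basic_def by auto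
    \<comment> \<open>The numbers that the neighbourhood leaves uncovered, to which the covering
      claim is applied.\<close>
    define W where "W = vsep omega (\<lambda>k. \<forall>u\<in>elts (vset U). k \<notin> elts u)"
    have W1: "W \<in> N" unfolding W_def by (intro vsep_M omega_M dfn_intros vU)
    have W2: "elts W \<subseteq> elts omega" unfolding W_def by auto
    have W3: "elts W \<inter> elts F = {}" using FU(1) unfolding W_def elts_vsep eU by blast
    have op: "\<exists>n. elts (cut_below (A d) (nat_code n)) \<subseteq> elts u" if du: "d \<in> elts w" "A d \<in> elts u" "u \<in> U" for d u
    proof -
      have "u \<in> Psi_opens N (vimg A w)" using U(2) du by blast
      moreover have "A d \<in> elts (vimg A w)" using du(1) by simp
      ultimately obtain n where "n \<in> elts omega" "insert (A d) (elts (A d) - elts n) \<subseteq> elts u"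
        using du(2) unfolding Psi_opens_def by blast
      then show ?thesis unfolding cut_below_def by (auto simp: elts_omega)
    qed
    have W4: "finite (elts W \<inter> elts (A d))" if d: "d \<in> elts w" "A d \<in> elts F" for d
    proof -
      obtain u where u: "u \<in> U" "A d \<in> elts u" using FU(1) d(2) by blast
      then obtain n where "elts (cut_below (A d) (nat_code n)) \<subseteq> elts u" using op d(1) by blast
      then have "elts W \<inter> elts (A d) \<subseteq> elts (nat_code n)"
        using u(1) unfolding W_def cut_below_def elts_vsep eU by blast
      then show ?thesis by (rule finite_subset) simp
    qed
    obtain b where b: "finite b" "b \<subseteq> elts (B g) - elts S"
      "\<forall>s. elts s \<subseteq> elts U0 \<and> misses s (vset b) \<longrightarrow> elts s \<inter> elts W = {}" using cover[OF W1 W2 W3 W4] by blast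
    have "\<forall>u\<in>U. \<exists>e. elts e \<subseteq> elts u \<and> (e \<in> elts S \<or> e \<in> {cut_below e (nat_code m) | e m. e \<in> elts AJ})"
    proof
      fix u assume u: "u \<in> U"
      then obtain x where x: "x \<in> elts F" "x \<in> elts u" using FU(2) by blast
      have "x \<in> elts Pt" using x(1) unfolding F_def by simp
      then consider n where "x = nat_code n" | d where "d \<in> elts w" "x = A d"
        unfolding Pt(2) by (auto simp: elts_omega)
      then show "\<exists>e. elts e \<subseteq> elts u \<and> (e \<in> elts S \<or> e \<in> {cut_below e (nat_code m) | e m. e \<in> elts AJ})"
      proof cases
        case 1
        then show ?thesis using x F_nat by (intro exI[of _ "vins x vempty"]) auto
      next
        case 2
        obtain n where "elts (cut_below (A d) (nat_code n)) \<subseteq> elts u" using op 2 x(2) u by blast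
        then show ?thesis using x(1) F_A[OF 2(1)] 2(2) by blast
      qed
    qed
    then have "\<exists>h. \<forall>u\<in>U. elts (h u) \<subseteq> elts u \<and> (h u \<in> elts S \<or> h u \<in> {cut_below e (nat_code m) | e m. e \<in> elts AJ})"
      by (rule bchoice)
    then obtain e where "\<forall>u\<in>U. elts (e u) \<subseteq> elts u \<and> (e u \<in> elts S \<or> e u \<in> {cut_below e (nat_code m) | e m. e \<in> elts AJ})"
      by (rule exE)
    note e = bspec[OF this]
    define a where "a = e ` U \<inter> elts S"
    \<comment> \<open>Chosen sets outside S are tails of members in \<open>AJ\<close>; they form the
      part of the pattern about which \<open>greedy\<close> says nothing.\<close>
    define C where "C = e ` U - elts S"
    have aC: "finite a" "a \<subseteq> elts S" "finite C" "C \<subseteq> {cut_below e (nat_code m) | e m. e \<in> elts AJ}"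
      unfolding a_def C_def using U(1) e by auto
    then obtain t where t: "t \<in> X1" "elts (nat_code j) \<subseteq> elts (vfst t)" "hits (vsnd t) (vset (a \<union> C))" "misses (vsnd t) (vset b)"
      using real[OF aC(1,2) b(1,2) aC(3,4), of j] by blast
    have "a \<union> C = e ` U" unfolding a_def C_def by blast
    then have eaC: "elts (vset (a \<union> C)) = e ` U" using U(1) by (simp add: countable_finite)
    have s: "vsnd t \<in> N" "finite (elts (vsnd t))" "elts (vsnd t) \<noteq> {}" "elts (vsnd t) \<subseteq> elts U0" using X1[OF t(1)] by auto
    then have "vsnd t \<in> CLp" using finite_CLp U0(2) by blast
    moreover have "elts (vsnd t) \<subseteq> (\<Union>u\<in>U. elts u)"
    proof
      fix x assume "x \<in> elts (vsnd t)"
      moreover have "elts (vsnd t) \<inter> elts W = {}" using b(3) s(4) t(4) by blast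
      ultimately have "x \<notin> elts W" "x \<in> elts omega" using s(4) U0(2) by blast+
      then show "x \<in> (\<Union>u\<in>U. elts u)" unfolding W_def elts_vsep eU by blast
    qed
    moreover have "elts (vsnd t) \<inter> elts u \<noteq> {}" if "u \<in> U" for u
      using t(3) e[OF that] that unfolding hits_def eaC by blast
    ultimately show ?thesis using t(1,2) unfolding Vietoris_basic_def by blast
  qed
  ultimately show ?thesis by blast
qed

lemma hits_mono: "hits s a \<Longrightarrow> elts b \<subseteq> elts a \<Longrightarrow> hits s b"
  unfolding hits_def by blast

lemma misses_mono: "misses s a \<Longrightarrow> elts b \<subseteq> elts a \<Longrightarrow> misses s b"
  unfolding misses_def by blast

lemma rem_mono: "elts D \<subseteq> elts E \<Longrightarrow> elts (rem s E) \<subseteq> elts (rem s D)"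
  unfolding rem_def by auto

text \<open>Below \<open>g\<close> the decisions are greedy, with bigness as the invariant. All
  later members go into F, as persistence allows their tails to be hit in addition. A set almost
  disjoint from them is, by \<open>two_cases\<close>, almost covered by finitely many members below
  \<open>g\<close>.\<close>

lemma accumulation_big:
  assumes X: "X \<in> N" "elts X \<subseteq> elts T0" "\<And>t. t \<in> elts X \<Longrightarrow> elts (vsnd t) \<noteq> {}"
    and g: "g \<in> elts w" "\<forall>b\<in>elts w. g \<in> elts (vins b b) \<longrightarrow> catch (vFin (B b)) X (A b)"
    and bg: "big (vFin (B g)) X vempty vempty"
  shows "\<exists>F\<in>CLp. \<forall>U j. finite U \<and> U \<subseteq> Psi_opens N (vimg A w) \<and> F \<in> Vb U \<longrightarrow>
    (\<exists>t\<in>elts X. elts (nat_code j) \<subseteq> elts (vfst t) \<and> vsnd t \<in> Vb U)"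
proof -
  have FN: "vFin (B g) \<in> N" using Bs_N[OF g(1)] by blast
  have mono: "big (vFin (B g)) X a' b'" if "big (vFin (B g)) X a b" "elts a' \<subseteq> elts a" "elts b' \<subseteq> elts b" for a b a' b'
    using that hits_mono[of _ a a'] misses_mono[of _ b b'] unfolding big_def by meson
  have split: "big (vFin (B g)) X (vins e a) b \<or> big (vFin (B g)) X a (vins e b)" if h: "big (vFin (B g)) X a b" for a b e
  proof (rule ccontr)
    assume n: "\<not> ?thesis"
    obtain D1 m where 1: "D1 \<in> elts (vFin (B g))" "\<And>t. t \<in> elts X \<Longrightarrow> elts (nat_code m) \<subseteq> elts (vfst t) \<Longrightarrow>
        misses (vsnd t) b \<Longrightarrow> natle (nat_code m) (rem (vsnd t) D1) \<Longrightarrow> \<not> hits (vsnd t) (vins e a)"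
      using n unfolding big_def elts_omega by blast
    obtain D2 k where 2: "D2 \<in> elts (vFin (B g))" "\<And>t. t \<in> elts X \<Longrightarrow> elts (nat_code k) \<subseteq> elts (vfst t) \<Longrightarrow>
        hits (vsnd t) a \<Longrightarrow> natle (nat_code k) (rem (vsnd t) D2) \<Longrightarrow> \<not> misses (vsnd t) (vins e b)"
      using n unfolding big_def elts_omega by blast
    \<comment> \<open>Every finite set either hits or misses \<open>e\<close>. The two failures,
      joined into one \<open>D\<close> and one bound, therefore contradict bigness of the old
      pattern.\<close>
    define D where "D = vset (elts D1 \<union> elts D2)"
    have eD: "elts D = elts D1 \<union> elts D2" unfolding D_def by simp
    have "D \<in> elts (vFin (B g))" using 1(1) 2(1) by (simp add: eD)
    then obtain t where t: "t \<in> elts X" "elts (nat_code (max m k)) \<subseteq> elts (vfst t)" "hits (vsnd t) a" "misses (vsnd t) b"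
      "natle (nat_code (max m k)) (rem (vsnd t) D)"
      using h nat_code_omega[of "max m k"] unfolding big_def by blast
    have "natle (nat_code m) (rem (vsnd t) D)" "natle (nat_code k) (rem (vsnd t) D)"
      using t(5) by (auto simp: natle_iff)
    then have "natle (nat_code m) (rem (vsnd t) D1)" "natle (nat_code k) (rem (vsnd t) D2)"
      using natle_mono[OF _ rem_mono[of D1 D "vsnd t"]] natle_mono[OF _ rem_mono[of D2 D "vsnd t"]]
      by (auto simp: eD)
    moreover have "elts (nat_code m) \<subseteq> elts (vfst t)" "elts (nat_code k) \<subseteq> elts (vfst t)"
      using t(2) nat_code_subset_iff[of m "max m k"] nat_code_subset_iff[of k "max m k"] by (meson max.cobounded1 max.cobounded2 subset_trans)+
    ultimately have "\<not> hits (vsnd t) (vins e a)" "\<not> misses (vsnd t) (vins e b)" using 1(2) 2(2) t by blast+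
    then show False using t(3,4) unfolding hits_def misses_def by auto
  qed
  obtain S where S: "S \<in> N" "elts S \<subseteq> elts (B g)" and Sgood: "\<And>a b. finite (elts a) \<Longrightarrow> elts a \<subseteq> elts S \<Longrightarrow> finite (elts b) \<Longrightarrow>
     elts b \<subseteq> elts (B g) - elts S \<Longrightarrow> big (vFin (B g)) X a b"
  proof -
    have "\<exists>S\<in>N. elts S \<subseteq> elts (B g) \<and> (\<forall>a b. finite (elts a) \<and> elts a \<subseteq> elts S \<and> finite (elts b) \<and>
       elts b \<subseteq> elts (B g) - elts S \<longrightarrow> big (vFin (B g)) X a b)"
      by (rule greedy[OF g(1) _ bg split mono]) (intro dfn_intros FN X(1))
    then show ?thesis using that by blast
  qed
  define AJ where "AJ = vsep (vimg A w) (\<lambda>x. x \<notin> elts (vimg A g))"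
  have AJN: "AJ \<in> N" unfolding AJ_def by (intro vsep_M A_N dfn_intros A_below_N g)
  have AJ: "e \<in> elts AJ \<longleftrightarrow> (\<exists>d\<in>elts w. d \<notin> elts g \<and> e = A d)" for e
    unfolding AJ_def using A_in_vimg[OF g(1)] by auto
  have ge: "elts g \<subseteq> elts d" if "d \<in> elts w" "d \<notin> elts g" for d using w_dichotomy[OF g(1)] that by blast
  show ?thesis
  proof (rule accumulation_core[OF g(1) S AJN])
    show "elts AJ \<subseteq> elts (vimg A w)" unfolding AJ_def by auto
    show "omega \<in> N" "elts omega \<subseteq> elts omega" by auto
    show "vsnd t \<in> N \<and> finite (elts (vsnd t)) \<and> elts (vsnd t) \<noteq> {} \<and> elts (vsnd t) \<subseteq> elts omega" if t: "t \<in> elts X" for t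
    proof -
      have "t \<in> elts T0" using X(2) t by blast
      then have "finite (elts (vsnd t))" "elts (vsnd t) \<subseteq> elts omega" by (rule T0_E, simp)+
      moreover have "vsnd t \<in> N" using mem_M[OF t X(1)] by blast
      ultimately show ?thesis using X(3)[OF t] by blast
    qed
    show "\<exists>t\<in>elts X. elts (nat_code j) \<subseteq> elts (vfst t) \<and> hits (vsnd t) (vset (a \<union> C)) \<and> misses (vsnd t) (vset b)"
      if a: "finite a" "a \<subseteq> elts S" and b: "finite b" "b \<subseteq> elts (B g) - elts S" and C: "finite C"
        "C \<subseteq> {cut_below e (nat_code m) | e m. e \<in> elts AJ}" for a b C j
    proof -
      have ea: "elts (vset a) = a" "elts (vset b) = b" using a b by (simp_all add: countable_finite)
      have "big (vFin (B g)) X (vset a) (vset b)" using a b by (intro Sgood) (simp_all add: ea)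
      moreover have "C \<subseteq> {cut_below (A d) (nat_code m) | d m. d \<in> elts w \<and> elts g \<subseteq> elts d}"
        using C(2) ge unfolding AJ by blast
      moreover have "\<forall>b\<in>elts w. elts g \<subseteq> elts b \<longrightarrow> catch (vFin (B b)) X (A b)"
        using g w_subset_iff by blast
      moreover have "\<forall>d\<in>elts w. elts g \<subseteq> elts d \<or> d \<in> elts g" using w_dichotomy[OF g(1)] by blast
      moreover have "elts g \<subseteq> elts w" using w_trans[OF _ g(1)] by blast
      \<comment> \<open>Persistence is used at the very top, with \<open>w\<close> itself in place
        of an index, so the tails in \<open>C\<close> may belong to any later members.\<close>
      ultimately have "big (vFin (B w)) X (vset (elts (vset a) \<union> C)) (vset b)"
        using a b S(2) C(1) by (intro persist[where g = g]) (auto simp: ea)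
      moreover have "vempty \<in> elts (vFin (B w))" by simp
      ultimately show ?thesis unfolding big_def ea using nat_code_omega[of j] by blast
    qed
    show "\<exists>I. finite I \<and> I \<subseteq> elts g \<and> finite (elts W - (\<Union>d\<in>I. elts (A d)))"
      if W: "W \<in> N" "elts W \<subseteq> elts omega" "\<And>e. e \<in> elts AJ \<Longrightarrow> finite (elts W \<inter> elts e)" for W
      using two_cases[OF Fn_const[OF W(1)] W(2) order_refl g(1)]
    proof
      assume "\<exists>b\<in>elts w. elts g \<subseteq> elts b \<and> (\<forall>(j::nat) m. \<exists>y\<in>elts W. y \<in> elts (A b) \<and> y \<notin> elts (nat_code m))"
      then obtain b where b: "b \<in> elts w" "elts g \<subseteq> elts b" "\<And>m. \<exists>y\<in>elts W. y \<in> elts (A b) \<and> y \<notin> elts (nat_code m)" by blast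
      have "b \<notin> elts g" using b(2) mem_irrefl by blast
      then have "finite (elts W \<inter> elts (A b))" using W(3) AJ b(1) by blast
      then obtain m where "elts W \<inter> elts (A b) \<subseteq> elts (nat_code m)" using bounded_omega W(2) by blast
      then show ?thesis using b(3)[of m] by blast
    next
      assume "\<exists>b\<in>elts w. \<exists>D (j::nat). D \<in> elts (vFin (B b)) \<and> elts W \<subseteq> \<Union> (elts ` elts D)"
      then obtain b D where D: "b \<in> elts w" "D \<in> elts (vFin (B b))" "elts W \<subseteq> \<Union> (elts ` elts D)" by blast
      have bw: "elts b \<subseteq> elts w" using w_trans[OF _ D(1)] by blast
      obtain I where I: "finite I" "I \<subseteq> elts b" "finite (\<Union> (elts ` elts D) - (\<Union>d\<in>I. elts (A d)))"
        using cover_finite[OF bw D(2)] by blast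
      have "elts W - (\<Union>d\<in>I \<inter> elts g. elts (A d)) \<subseteq> (\<Union> (elts ` elts D) - (\<Union>d\<in>I. elts (A d))) \<union> (\<Union>d\<in>I - elts g. elts W \<inter> elts (A d))"
        using D(3) by blast
      moreover have "finite (elts W \<inter> elts (A d))" if "d \<in> I - elts g" for d
        using that I(2) bw W(3) AJ by blast
      then have "finite (\<Union>d\<in>I - elts g. elts W \<inter> elts (A d))" using I(1) by blast
      ultimately have "finite (elts W - (\<Union>d\<in>I \<inter> elts g. elts (A d)))" using I(3) by (meson finite_UnI finite_subset)
      then show ?thesis using I(1) by (intro exI[of _ "I \<inter> elts g"]) auto
    qed
    show "finite (elts omega \<inter> elts (A d))" if "d \<in> elts w" "d \<notin> elts g" "A d \<notin> elts AJ" for d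
      using that AJ by blast
  qed
qed

end

section \<open>Finite sets with a bounded number of points outside a finite union\<close>

context caught
begin

text \<open>\<open>D\<close> mentions finitely many indices, and these have a common strict upper
  bound because \<open>w\<close> has no largest element.\<close>

lemma vFin_B_bounded: assumes D: "D \<in> elts (vFin (B w))" shows "\<exists>g\<in>elts w. D \<in> elts (vFin (B g))"
proof -
  have "\<forall>e\<in>elts D. \<exists>d. (\<exists>k. e = vins (nat_code k) vempty) \<or> (d \<in> elts w \<and> (\<exists>m. e = cut_below (A d) (nat_code m)))"
    using D by (auto simp: B_iff subset_iff)
  then obtain h where h: "\<And>e. e \<in> elts D \<Longrightarrow> (\<exists>k. e = vins (nat_code k) vempty) \<or>
      (h e \<in> elts w \<and> (\<exists>m. e = cut_below (A (h e)) (nat_code m)))" by metis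
  obtain g0 where g0: "g0 \<in> elts w" using w_inf by (metis ex_in_conv finite.emptyI)
  define I where "I = insert g0 {d \<in> h ` elts D. d \<in> elts w}"
  have "finite I" "I \<noteq> {}" "I \<subseteq> elts w" unfolding I_def using D g0 by auto
  then obtain d where d: "d \<in> I" "\<forall>x\<in>I. x \<in> elts (vins d d)" using w_max by blast
  then obtain g where g: "g \<in> elts w" "d \<in> elts g" using w_lim \<open>I \<subseteq> elts w\<close> by blast
  have Ig: "x \<in> elts g" if "x \<in> I" for x
    using d(2) that g ordinal_trans[OF w_ord _ g(2) g(1)] by auto
  have "e \<in> elts (B g)" if e: "e \<in> elts D" for e
    using h[OF e] Ig[of "h e"] e unfolding I_def B_iff by blast
  then show ?thesis using D g(1) by auto
qed

text \<open>Induction on the number of points outside \<open>D\<close>. Unless the sets without such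
  points are already unbounded, some single \<open>e\<close> meets the remainders of an unbounded
  part of X. Adding \<open>e\<close> to \<open>D\<close> lowers the bound by one on that
  part.\<close>

lemma fin_reduce:
  assumes "X \<in> N" "elts X \<subseteq> elts T0" "unb X" "D \<in> elts (vFin (B w))"
    "\<And>t. t \<in> elts X \<Longrightarrow> \<not> natle (nat_code (Suc n)) (rem (vsnd t) D)"
  shows "\<exists>X'\<in>N. elts X' \<subseteq> elts X \<and> unb X' \<and> (\<exists>D'\<in>elts (vFin (B w)). \<forall>t\<in>elts X'. elts (rem (vsnd t) D') = {})"
  using assms
proof (induction n arbitrary: X D)
  case 0
  have "elts (rem (vsnd t) D) = {}" if "t \<in> elts X" for t
    using "0.prems"(5)[OF that] unfolding natle_iff by (auto simp: not_le)
  then show ?case using "0.prems" by blast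
next
  case (Suc n)
  note XN = Suc.prems(1) and XT = Suc.prems(2) and uX = Suc.prems(3) and D = Suc.prems(4)
  obtain g where g: "g \<in> elts w" "D \<in> elts (vFin (B g))" using vFin_B_bounded[OF D] by blast
  have DN: "D \<in> N" using mem_M[OF g(2)] Bs_N[OF g(1)] by blast
  \<comment> \<open>This says that the remainder is empty, phrased with a bounded quantifier to
    which the definability rules apply.\<close>
  define Xe where "Xe = vsep X (\<lambda>t. \<forall>y\<in>elts (rem (vsnd t) D). y \<notin> elts (rem (vsnd t) D))"
  define Xh where "Xh e = vsep X (\<lambda>t. \<exists>y\<in>elts (rem (vsnd t) D). y \<in> elts e)" for e
  have XeN: "Xe \<in> N" unfolding Xe_def by (intro vsep_M XN dfn_intros DN)
  show ?case
  proof (cases "unb Xe")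
    case True
    have "\<forall>t\<in>elts Xe. elts (rem (vsnd t) D) = {}"
      unfolding Xe_def elts_vsep by blast
    moreover have "elts Xe \<subseteq> elts X" unfolding Xe_def by auto
    ultimately show ?thesis using D True by (intro bexI[OF _ XeN] conjI bexI[OF _ D])
  next
    case False
    then obtain j1 where j1: "\<And>t. t \<in> elts Xe \<Longrightarrow> \<not> elts (nat_code j1) \<subseteq> elts (vfst t)" unfolding unb_def by blast
    have "\<exists>e\<in>elts (B w). unb (Xh e)"
    proof -
      \<comment> \<open>The points left over from \<open>j\<close> on. Either one member of the
        family meets all these sets, and it is the desired \<open>e\<close>, or one of them has a
        finite covering, in which a pigeonhole argument finds \<open>e\<close>.\<close>
      define Y where "Y j = vsep omega (\<lambda>x. \<exists>t\<in>elts X. elts j \<subseteq> elts (vfst t) \<and> x \<in> elts (rem (vsnd t) D))" for j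
      have FY: "Fn Y" unfolding Y_def by (intro dfn_intros omega_M XN DN)
      have Ysub: "elts (Y (nat_code j)) \<subseteq> elts omega" for j unfolding Y_def by auto
      have dec: "elts (Y (nat_code j)) \<subseteq> elts (Y (nat_code i))" if "i \<le> j" for i j
      proof -
        have "elts (nat_code i) \<subseteq> elts (nat_code j)" using that by simp
        then show ?thesis unfolding Y_def elts_vsep by blast
      qed
      from two_cases[OF FY Ysub dec g(1)] show ?thesis
      proof
        assume "\<exists>b\<in>elts w. elts g \<subseteq> elts b \<and> (\<forall>j m. \<exists>y\<in>elts (Y (nat_code j)). y \<in> elts (A b) \<and> y \<notin> elts (nat_code m))"
        then obtain b where b: "b \<in> elts w" "\<And>j m. \<exists>y\<in>elts (Y (nat_code j)). y \<in> elts (A b) \<and> y \<notin> elts (nat_code m)" by blast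
        have "unb (Xh (cut_below (A b) (nat_code 0)))"
          unfolding unb_def
        proof
          fix j
          obtain y where "y \<in> elts (Y (nat_code j))" "y \<in> elts (A b)" using b(2) by blast
          then show "\<exists>t\<in>elts (Xh (cut_below (A b) (nat_code 0))). elts (nat_code j) \<subseteq> elts (vfst t)"
            unfolding Y_def Xh_def cut_below_def by auto
        qed
        moreover have "cut_below (A b) (nat_code 0) \<in> elts (B w)" using b(1) unfolding B_iff by blast
        ultimately show ?thesis by (rule bexI)
      next
        assume "\<exists>b\<in>elts w. \<exists>D' j. D' \<in> elts (vFin (B b)) \<and> elts (Y (nat_code j)) \<subseteq> \<Union> (elts ` elts D')"
        then obtain b D' j where D': "b \<in> elts w" "D' \<in> elts (vFin (B b))" "elts (Y (nat_code j)) \<subseteq> \<Union> (elts ` elts D')" by blast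
        show ?thesis
        proof (rule ccontr)
          assume n: "\<not> ?thesis"
          have "D' \<in> elts (vFin (B w))" using D'(1,2) B_mono[of b w] w_trans by auto
          then have "\<forall>e\<in>elts D'. \<exists>k. \<forall>t\<in>elts (Xh e). \<not> elts (nat_code k) \<subseteq> elts (vfst t)"
            using n unfolding unb_def by auto
          then obtain k where k: "\<And>e t. e \<in> elts D' \<Longrightarrow> t \<in> elts (Xh e) \<Longrightarrow> \<not> elts (nat_code (k e)) \<subseteq> elts (vfst t)"
            by metis
          \<comment> \<open>An element of X beyond all these bounds has a nonempty remainder, whose
            points are covered by \<open>D'\<close>; yet it is beyond the bound of the covering set
            it meets.\<close>
          define m where "m = Max (insert j (insert j1 (k ` elts D')))"
          have fin: "finite (insert j (insert j1 (k ` elts D')))" using D'(2) by simp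
          have "j \<le> m" "j1 \<le> m" unfolding m_def by (rule Max_ge[OF fin]; simp)+
          have ke: "k e \<le> m" if "e \<in> elts D'" for e unfolding m_def by (rule Max_ge[OF fin]) (simp add: that)
          have le: "elts (nat_code i) \<subseteq> elts (vfst t)" if "i \<le> m" "elts (nat_code m) \<subseteq> elts (vfst t)" for i t
            by (rule subset_trans[OF _ that(2)]) (simp add: that(1))
          obtain t where t: "t \<in> elts X" "elts (nat_code m) \<subseteq> elts (vfst t)" using uX unfolding unb_def by blast
          have "t \<notin> elts Xe" using j1 le[OF \<open>j1 \<le> m\<close> t(2)] by blast
          then obtain y where y: "y \<in> elts (rem (vsnd t) D)" using t(1) unfolding Xe_def by auto
          have "t \<in> elts T0" using t(1) XT by blast
          then have "elts (vsnd t) \<subseteq> elts omega" by (rule T0_E) simp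
          then have "y \<in> elts omega" using y unfolding rem_def by auto
          then have "y \<in> elts (Y (nat_code j))" unfolding Y_def using t(1) y le[OF \<open>j \<le> m\<close> t(2)] by auto
          then obtain e where e: "e \<in> elts D'" "y \<in> elts e" using D'(3) by blast
          then have "t \<in> elts (Xh e)" unfolding Xh_def using t(1) y by auto
          then show False using k[OF e(1)] le[OF ke[OF e(1)] t(2)] by blast
        qed
      qed
    qed
    then obtain e where e: "e \<in> elts (B w)" "unb (Xh e)" by blast
    have De: "vins e D \<in> elts (vFin (B w))" using D e(1) by simp
    obtain g' where g': "g' \<in> elts w" "vins e D \<in> elts (vFin (B g'))" using vFin_B_bounded[OF De] by blast
    have "vins e D \<in> N" using mem_M[OF g'(2)] Bs_N[OF g'(1)] by blast
    then have eN: "e \<in> N" using mem_M[of e "vins e D"] by simp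
    have XhN: "Xh e \<in> N" unfolding Xh_def by (intro vsep_M XN dfn_intros DN eN)
    have sub: "elts (Xh e) \<subseteq> elts X" unfolding Xh_def by auto
    have "\<not> natle (nat_code (Suc n)) (rem (vsnd t) (vins e D))" if t: "t \<in> elts (Xh e)" for t
    proof -
      have f: "finite (elts (rem (vsnd t) D))" "card (elts (rem (vsnd t) D)) < Suc (Suc n)"
        using Suc.prems(5)[of t] t sub unfolding natle_iff by auto
      obtain y where "y \<in> elts (rem (vsnd t) D)" "y \<in> elts e" using t unfolding Xh_def by auto
      then have "elts (rem (vsnd t) (vins e D)) \<subset> elts (rem (vsnd t) D)" unfolding rem_def by auto
      then have "card (elts (rem (vsnd t) (vins e D))) < card (elts (rem (vsnd t) D))" "finite (elts (rem (vsnd t) (vins e D)))"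
        using f(1) by (auto intro: psubset_card_mono finite_subset)
      with f(2) show ?thesis unfolding natle_iff by simp
    qed
    from Suc.IH[OF XhN subset_trans[OF sub XT] e(2) De this] show ?thesis
      using sub by (meson subset_trans)
  qed
qed

text \<open>All finite sets lie in the union \<open>U0\<close> of \<open>D\<close>, which is almost
  covered by finitely many members below \<open>g\<close>. These serve for every W at once, and the
  later members meet \<open>U0\<close> finitely, so F gets no members beyond \<open>g\<close>.
  Realizability at arbitrarily large first coordinates is the only invariant of the greedy choice
  here.\<close>

lemma accumulation_fin:
  assumes X: "X \<in> N" "elts X \<subseteq> elts T0" "\<And>t. t \<in> elts X \<Longrightarrow> elts (vsnd t) \<noteq> {}"
    and u: "unb X" and D: "D \<in> elts (vFin (B w))" "\<And>t. t \<in> elts X \<Longrightarrow> elts (rem (vsnd t) D) = {}"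
  shows "\<exists>F\<in>CLp. \<forall>U j. finite U \<and> U \<subseteq> Psi_opens N (vimg A w) \<and> F \<in> Vb U \<longrightarrow>
    (\<exists>t\<in>elts X. elts (nat_code j) \<subseteq> elts (vfst t) \<and> vsnd t \<in> Vb U)"
proof -
  obtain g where g: "g \<in> elts w" "D \<in> elts (vFin (B g))" using vFin_B_bounded[OF D(1)] by blast
  have DN: "D \<in> N" using mem_M[OF g(2)] Bs_N[OF g(1)] by blast
  define good where "good a b \<longleftrightarrow> (\<forall>j\<in>elts omega. \<exists>t\<in>elts X. elts j \<subseteq> elts (vfst t) \<and> hits (vsnd t) a \<and> misses (vsnd t) b)" for a b
  have dgood: "dfn (\<lambda>p. good (vfst p) (vsnd p))" unfolding good_def by (intro dfn_intros omega_M X)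
  have good0: "good vempty vempty"
    using u unfolding good_def unb_def hits_def misses_def elts_omega by auto
  have mono: "good a' b'" if "good a b" "elts a' \<subseteq> elts a" "elts b' \<subseteq> elts b" for a b a' b'
    using that hits_mono[of _ a a'] misses_mono[of _ b b'] unfolding good_def by meson
  have split: "good (vins e a) b \<or> good a (vins e b)" if h: "good a b" for a b e
  proof (rule ccontr)
    assume n: "\<not> ?thesis"
    obtain m where 1: "\<And>t. t \<in> elts X \<Longrightarrow> elts (nat_code m) \<subseteq> elts (vfst t) \<Longrightarrow> misses (vsnd t) b \<Longrightarrow> \<not> hits (vsnd t) (vins e a)"
      using n unfolding good_def elts_omega by blast
    obtain k where 2: "\<And>t. t \<in> elts X \<Longrightarrow> elts (nat_code k) \<subseteq> elts (vfst t) \<Longrightarrow> hits (vsnd t) a \<Longrightarrow> \<not> misses (vsnd t) (vins e b)"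
      using n unfolding good_def elts_omega by blast
    obtain t where t: "t \<in> elts X" "elts (nat_code (max m k)) \<subseteq> elts (vfst t)" "hits (vsnd t) a" "misses (vsnd t) b"
      using h nat_code_omega[of "max m k"] unfolding good_def by blast
    have "elts (nat_code m) \<subseteq> elts (vfst t)" "elts (nat_code k) \<subseteq> elts (vfst t)"
      using t(2) nat_code_subset_iff[of m "max m k"] nat_code_subset_iff[of k "max m k"] by (meson max.cobounded1 max.cobounded2 subset_trans)+
    then have "\<not> hits (vsnd t) (vins e a)" "\<not> misses (vsnd t) (vins e b)" using 1 2 t by blast+
    then show False using t(3,4) unfolding hits_def misses_def by auto
  qed
  obtain S where S: "S \<in> N" "elts S \<subseteq> elts (B g)" and Sgood: "\<And>a b. finite (elts a) \<Longrightarrow> elts a \<subseteq> elts S \<Longrightarrow> finite (elts b) \<Longrightarrow>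
     elts b \<subseteq> elts (B g) - elts S \<Longrightarrow> good a b"
  proof -
    have "\<exists>S\<in>N. elts S \<subseteq> elts (B g) \<and> (\<forall>a b. finite (elts a) \<and> elts a \<subseteq> elts S \<and> finite (elts b) \<and>
       elts b \<subseteq> elts (B g) - elts S \<longrightarrow> good a b)"
      by (rule greedy[OF g(1) dgood good0 split mono])
    then show ?thesis using that by blast
  qed
  define U0 where "U0 = vsep omega (\<lambda>x. \<exists>e\<in>elts D. x \<in> elts e)"
  have U0N: "U0 \<in> N" unfolding U0_def by (intro vsep_M omega_M dfn_intros DN)
  have gw: "elts g \<subseteq> elts w" using w_trans[OF _ g(1)] by blast
  obtain I where I: "finite I" "I \<subseteq> elts g" "finite (\<Union> (elts ` elts D) - (\<Union>d\<in>I. elts (A d)))"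
    using cover_finite[OF gw g(2)] by blast
  show ?thesis
  proof (rule accumulation_core[OF g(1) S, of vempty U0])
    show "vempty \<in> N" "elts vempty \<subseteq> elts (vimg A w)" by auto
    show "U0 \<in> N" "elts U0 \<subseteq> elts omega" using U0N unfolding U0_def by auto
    show "vsnd t \<in> N \<and> finite (elts (vsnd t)) \<and> elts (vsnd t) \<noteq> {} \<and> elts (vsnd t) \<subseteq> elts U0" if t: "t \<in> elts X" for t
    proof -
      have "t \<in> elts T0" using X(2) t by blast
      then have s: "finite (elts (vsnd t))" "elts (vsnd t) \<subseteq> elts omega" by (rule T0_E, simp)+
      moreover have "vsnd t \<in> N" using mem_M[OF t X(1)] by blast
      moreover have "elts (vsnd t) \<subseteq> elts U0" using D(2)[OF t] s(2) unfolding U0_def rem_def by auto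
      ultimately show ?thesis using X(3)[OF t] by blast
    qed
    show "\<exists>t\<in>elts X. elts (nat_code j) \<subseteq> elts (vfst t) \<and> hits (vsnd t) (vset (a \<union> C)) \<and> misses (vsnd t) (vset b)"
      if a: "finite a" "a \<subseteq> elts S" and b: "finite b" "b \<subseteq> elts (B g) - elts S" and C: "finite C"
        "C \<subseteq> {cut_below e (nat_code m) | e m. e \<in> elts vempty}" for a b C j
    proof -
      have "C = {}" using C(2) by auto
      moreover have ea: "elts (vset a) = a" "elts (vset b) = b" using a b by (simp_all add: countable_finite)
      have "good (vset a) (vset b)" using a b by (intro Sgood) (simp_all add: ea)
      ultimately show ?thesis unfolding good_def using nat_code_omega[of j] by auto
    qed
    show "\<exists>I. finite I \<and> I \<subseteq> elts g \<and> finite (elts W - (\<Union>d\<in>I. elts (A d)))"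
      if "W \<in> N" "elts W \<subseteq> elts U0" "\<And>e. e \<in> elts vempty \<Longrightarrow> finite (elts W \<inter> elts e)" for W
    proof -
      have "elts W \<subseteq> \<Union> (elts ` elts D)" using that(2) unfolding U0_def by auto
      then have "elts W - (\<Union>d\<in>I. elts (A d)) \<subseteq> \<Union> (elts ` elts D) - (\<Union>d\<in>I. elts (A d))" by blast
      from finite_subset[OF this I(3)] show ?thesis using I(1,2) by (intro exI[of _ I] conjI)
    qed
    show "finite (elts U0 \<inter> elts (A d))" if d: "d \<in> elts w" "d \<notin> elts g" "A d \<notin> elts vempty" for d
    proof -
      have "elts U0 \<inter> elts (A d) \<subseteq> (\<Union> (elts ` elts D) - (\<Union>d\<in>I. elts (A d))) \<union> (\<Union>i\<in>I. elts (A i) \<inter> elts (A d))"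
        unfolding U0_def by auto
      moreover have "finite (elts (A i) \<inter> elts (A d))" if "i \<in> I" for i
      proof -
        have "i \<in> elts w" "i \<noteq> d" using that I(2) gw d(2) by auto
        then show ?thesis using A_ad2 d(1) by blast
      qed
      then have "finite (\<Union>i\<in>I. elts (A i) \<inter> elts (A d))" using I(1) by blast
      ultimately show ?thesis using I(3) by (meson finite_UnI finite_subset)
    qed
  qed
qed

text \<open>If the empty pattern fails to be big, one \<open>D\<close> and one number bound the
  remainders of all elements far enough out. The initial ones are discarded, which leaves an
  unbounded set for \<open>fin_reduce\<close>.\<close>

theorem accumulation:
  assumes X: "X \<in> N" "elts X \<subseteq> elts T0" "\<And>t. t \<in> elts X \<Longrightarrow> elts (vsnd t) \<noteq> {}" and u: "unb X"
  shows "\<exists>F\<in>CLp. \<forall>U j. finite U \<and> U \<subseteq> Psi_opens N (vimg A w) \<and> F \<in> Vb U \<longrightarrow>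
    (\<exists>t\<in>elts X. elts (nat_code j) \<subseteq> elts (vfst t) \<and> vsnd t \<in> Vb U)"
proof -
  obtain g where g: "g \<in> elts w" "\<forall>b\<in>elts w. g \<in> elts (vins b b) \<longrightarrow> catch (vFin (B b)) X (A b)"
    using catch_N[OF X(1,2)] by blast
  show ?thesis
  proof (cases "big (vFin (B g)) X vempty vempty")
    case True
    from accumulation_big[OF X g this] show ?thesis .
  next
    case False
    then have "\<exists>D\<in>elts (vFin (B g)). \<exists>n. \<forall>t\<in>elts X. elts (nat_code n) \<subseteq> elts (vfst t) \<longrightarrow> \<not> natle (nat_code n) (rem (vsnd t) D)"
      unfolding big_def elts_omega by (simp add: hits_def misses_def)
    then obtain D n where D: "D \<in> elts (vFin (B g))"
      and no: "\<And>t. t \<in> elts X \<Longrightarrow> elts (nat_code n) \<subseteq> elts (vfst t) \<Longrightarrow> \<not> natle (nat_code n) (rem (vsnd t) D)"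
      by blast
    define X0 where "X0 = vsep X (\<lambda>t. elts (nat_code n) \<subseteq> elts (vfst t))"
    have X0N: "X0 \<in> N" unfolding X0_def by (intro vsep_M X dfn_intros nat_code_M)
    have X0s: "elts X0 \<subseteq> elts X" unfolding X0_def by auto
    have uX0: "unb X0"
      unfolding unb_def
    proof
      fix j
      obtain t where t: "t \<in> elts X" "elts (nat_code (max j n)) \<subseteq> elts (vfst t)" using u unfolding unb_def by blast
      have "elts (nat_code j) \<subseteq> elts (vfst t)" "elts (nat_code n) \<subseteq> elts (vfst t)"
        using t(2) nat_code_subset_iff[of j "max j n"] nat_code_subset_iff[of n "max j n"] by (meson max.cobounded1 max.cobounded2 subset_trans)+
      then show "\<exists>t\<in>elts X0. elts (nat_code j) \<subseteq> elts (vfst t)" unfolding X0_def using t(1) by auto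
    qed
    have Dw: "D \<in> elts (vFin (B w))" using D B_mono[of g w] w_trans[OF _ g(1)] by auto
    have few: "\<not> natle (nat_code (Suc n)) (rem (vsnd t) D)" if "t \<in> elts X0" for t
      using no[of t] that unfolding X0_def natle_iff by auto
    have "\<exists>X'\<in>N. elts X' \<subseteq> elts X0 \<and> unb X' \<and> (\<exists>D'\<in>elts (vFin (B w)). \<forall>t\<in>elts X'. elts (rem (vsnd t) D') = {})"
      by (rule fin_reduce[OF X0N subset_trans[OF X0s X(2)] uX0 Dw few])
    then obtain X' D' where X': "X' \<in> N" "elts X' \<subseteq> elts X0" "unb X'" "D' \<in> elts (vFin (B w))"
      "\<forall>t\<in>elts X'. elts (rem (vsnd t) D') = {}"
      by blast
    have s: "elts X' \<subseteq> elts X" using X'(2) X0s by blast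
    have "\<exists>F\<in>CLp. \<forall>U j. finite U \<and> U \<subseteq> Psi_opens N (vimg A w) \<and> F \<in> Vb U \<longrightarrow>
        (\<exists>t\<in>elts X'. elts (nat_code j) \<subseteq> elts (vfst t) \<and> vsnd t \<in> Vb U)"
      by (rule accumulation_fin[OF X'(1) _ _ X'(3,4)]) (use s X X'(5) in auto)
    then obtain F where F: "F \<in> CLp" "\<forall>U j. finite U \<and> U \<subseteq> Psi_opens N (vimg A w) \<and> F \<in> Vb U \<longrightarrow>
        (\<exists>t\<in>elts X'. elts (nat_code j) \<subseteq> elts (vfst t) \<and> vsnd t \<in> Vb U)" by (rule bexE)
    show ?thesis
    proof (intro bexI[OF _ F(1)] allI impI)
      fix U j assume "finite U \<and> U \<subseteq> Psi_opens N (vimg A w) \<and> F \<in> Vb U"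
      with F(2) have "\<exists>t\<in>elts X'. elts (nat_code j) \<subseteq> elts (vfst t) \<and> vsnd t \<in> Vb U" by simp
      then show "\<exists>t\<in>elts X. elts (nat_code j) \<subseteq> elts (vfst t) \<and> vsnd t \<in> Vb U" using s by blast
    qed
  qed
qed

end

section \<open>Codes of rationals and reals\<close>

text \<open>For numerals this is the comparison of the products mn and kl. Counting the elements of
  rectangles makes it definable without a recursion for multiplication.\<close>

definition mless :: "V \<Rightarrow> V \<Rightarrow> V \<Rightarrow> V \<Rightarrow> bool" where
  "mless m n k l \<longleftrightarrow> (\<exists>j\<in>elts omega. natle j (vtimes k l) \<and> \<not> natle j (vtimes m n))"

lemma vcard_vtimes: "finite (elts (vtimes (nat_code m) (nat_code n))) \<and> card (elts (vtimes (nat_code m) (nat_code n))) = m * n"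
proof -
  have "inj_on (\<lambda>(x, y). pair x y) (elts (nat_code m) \<times> elts (nat_code n))" by (auto simp: inj_on_def)
  then show ?thesis by (simp add: elts_vtimes card_image card_cartesian_product)
qed

lemma mless_nat: "mless (nat_code m) (nat_code n) (nat_code k) (nat_code l) \<longleftrightarrow> m * n < k * l"
proof -
  have "(\<exists>j. j \<le> k * l \<and> \<not> j \<le> m * n) \<longleftrightarrow> m * n < k * l" by auto
  then show ?thesis unfolding mless_def elts_omega using vcard_vtimes by (simp add: natle_iff)
qed

text \<open>The order of the rationals on codes: cross multiplication, by cases on the sign code,
  where 1 marks a negative number.\<close>

definition rlt :: "V \<Rightarrow> V \<Rightarrow> bool" where
  "rlt u v \<longleftrightarrow> (vfst (vfst u) = nat_code 1 \<and> vfst (vfst v) = nat_code 0) \<or>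
     (vfst (vfst u) = nat_code 0 \<and> vfst (vfst v) = nat_code 0 \<and>
        mless (vsnd (vfst u)) (vsnd (vsnd v)) (vsnd (vfst v)) (vsnd (vsnd u))) \<or>
     (vfst (vfst u) = nat_code 1 \<and> vfst (vfst v) = nat_code 1 \<and>
        mless (vsnd (vfst v)) (vsnd (vsnd u)) (vsnd (vfst u)) (vsnd (vsnd v)))"

lemma rat_code_quotient:
  "quotient_of q = (a, d) \<Longrightarrow> rat_code q =
     pair (pair (nat_code (if a < 0 then 1 else 0)) (nat_code (nat \<bar>a\<bar>))) (pair (nat_code 0) (nat_code (nat d)))"
  using quotient_of_denom_pos[of q a d] by (simp add: rat_code_def int_code_def)

lemma rlt_iff: "rlt (rat_code p) (rat_code q) \<longleftrightarrow> p < q"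
proof -
  obtain a d where p: "quotient_of p = (a, d)" by (cases "quotient_of p")
  obtain b e where q: "quotient_of q = (b, e)" by (cases "quotient_of q")
  have de: "d > 0" "e > 0" using p q quotient_of_denom_pos by auto
  have n: "nat \<bar>a\<bar> * nat e < nat \<bar>b\<bar> * nat d \<longleftrightarrow> \<bar>a\<bar> * e < \<bar>b\<bar> * d"
    "nat \<bar>b\<bar> * nat d < nat \<bar>a\<bar> * nat e \<longleftrightarrow> \<bar>b\<bar> * d < \<bar>a\<bar> * e"
    using de by (auto simp flip: nat_mult_distrib intro: le_less_trans[rotated])
  have "p < q \<longleftrightarrow> a * e < b * d" using p q by (simp add: rat_less_code mult.commute)
  moreover have "a * e < 0" if "a < 0" using that de by (simp add: mult_neg_pos)
  moreover have "0 \<le> b * d" if "0 \<le> b" using that de by simp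
  moreover have "0 \<le> a * e" if "0 \<le> a" using that de by simp
  moreover have "b * d < 0" if "b < 0" using that de by (simp add: mult_neg_pos)
  ultimately show ?thesis
    unfolding rlt_def rat_code_quotient[OF p] rat_code_quotient[OF q] vfst_pair vsnd_pair mless_nat n nat_code_eq_iff
    by (auto simp: not_less)
qed

text \<open>Recognizes reduced fractions among pairs of signed numerals: positive denominator, no
  negative zero, and lowest terms, with factorizations again expressed by counting
  rectangles.\<close>

definition isrc :: "V \<Rightarrow> bool" where
  "isrc u \<longleftrightarrow> vfst (vsnd u) = nat_code 0 \<and> vsnd (vsnd u) \<noteq> nat_code 0 \<and>
     (vsnd (vfst u) = nat_code 0 \<longrightarrow> vfst (vfst u) = nat_code 0) \<and>
     (\<forall>k\<in>elts omega. \<forall>m\<in>elts omega. \<forall>l\<in>elts omega.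
        vcard (vsnd (vfst u)) (vtimes k m) \<and> vcard (vsnd (vsnd u)) (vtimes k l) \<longrightarrow> k = nat_code 1)"

definition rshape :: V where
  "rshape = vtimes (vtimes (nat_code 2) omega) (vtimes (nat_code 2) omega)"

lemma coprime_nat_iff: "coprime (m::nat) n \<longleftrightarrow> (\<forall>k a b. m = k * a \<and> n = k * b \<longrightarrow> k = 1)"
proof
  assume "coprime m n"
  then show "\<forall>k a b. m = k * a \<and> n = k * b \<longrightarrow> k = 1"
    by (metis coprime_common_divisor_nat dvd_triv_left)
next
  assume h: "\<forall>k a b. m = k * a \<and> n = k * b \<longrightarrow> k = 1"
  show "coprime m n"
    by (rule coprimeI) (use h in \<open>auto elim!: dvdE\<close>)
qed

lemma isrc_rat_code: "u \<in> elts rshape \<and> isrc u \<longleftrightarrow> (\<exists>q. u = rat_code q)"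
proof
  have vc: "vcard (nat_code n) (vtimes (nat_code k) (nat_code m)) \<longleftrightarrow> n = k * m" for n k m
    using vcard_vtimes[of k m] by (simp add: vcard_def)
  {
    assume u: "u \<in> elts rshape \<and> isrc u"
    then obtain s n t d where sn: "u = pair (pair s (nat_code n)) (pair t (nat_code d))" "s \<in> elts (nat_code 2)"
      unfolding rshape_def by (auto elim!: vtimesE simp: elts_omega)
    then obtain i where i: "s = nat_code i" "i < 2" by (auto simp: elts_nat_code)
    have t: "t = nat_code 0" "d \<noteq> 0" "n = 0 \<Longrightarrow> i = 0" and c: "coprime n d"
      using u unfolding isrc_def sn(1) i(1) vfst_pair vsnd_pair elts_omega coprime_nat_iff nat_code_eq_iff
      by (simp_all add: vc del: nat_code.simps)
    define a where "a = (if i = 0 then int n else - int n)"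
    have "coprime a (int d)" using c unfolding a_def by simp
    then have q: "quotient_of (Fract a (int d)) = (a, int d)"
      using t(2) by (simp add: quotient_of_Fract normalize_stable)
    have "i = 0 \<or> i = 1" using i(2) by auto
    then have "u = rat_code (Fract a (int d))"
      unfolding rat_code_quotient[OF q] unfolding sn(1) i(1) t(1) a_def using t(3) by auto
    then show "\<exists>q. u = rat_code q" by blast
  }
  {
    assume "\<exists>q. u = rat_code q"
    then obtain q where u: "u = rat_code q" by blast
    obtain a d where q: "quotient_of q = (a, d)" by (cases "quotient_of q")
    have d: "d > 0" "coprime a d" using quotient_of_denom_pos[OF q] quotient_of_coprime[OF q] by auto
    have c: "coprime (nat \<bar>a\<bar>) (nat d)"
    proof -
      have "coprime (int (nat \<bar>a\<bar>)) (int (nat d))" using d by simp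
      then show ?thesis unfolding coprime_int_iff .
    qed
    show "u \<in> elts rshape \<and> isrc u"
      unfolding u rat_code_quotient[OF q] isrc_def rshape_def vfst_pair vsnd_pair elts_omega
      using d(1) c unfolding coprime_nat_iff
      by (auto simp: vc simp del: nat_code.simps) 
  }
qed

definition lower_cut :: "V \<Rightarrow> V \<Rightarrow> V \<Rightarrow> bool" where
  "lower_cut Q L x \<longleftrightarrow> elts x \<subseteq> elts Q \<and> x \<noteq> vempty \<and> (\<exists>q\<in>elts Q. q \<notin> elts x) \<and>
     (\<forall>q\<in>elts x. \<forall>p\<in>elts Q. pair p q \<in> elts L \<longrightarrow> p \<in> elts x) \<and>
     (\<forall>q\<in>elts x. \<exists>p\<in>elts x. pair q p \<in> elts L)"

lemma elts_real_code: "elts (real_code r) = rat_code ` {q. real_of_rat q < r}"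
  unfolding real_code_def by (rule elts_vset) (simp add: countable_image)

lemma rat_code_eq_iff [simp]: "rat_code p = rat_code q \<longleftrightarrow> p = q"
  by (metis rlt_iff less_irrefl neq_iff)

lemma rat_code_mem [simp]: "rat_code q \<in> elts (real_code r) \<longleftrightarrow> real_of_rat q < r"
  unfolding elts_real_code by auto

lemma real_code_eq_iff: "real_code r = real_code s \<longleftrightarrow> r = s"
proof
  assume eq: "real_code r = real_code s"
  have "\<not> x < y" if "real_code x = real_code y" for x y
  proof
    assume "x < y"
    then obtain q where "x < real_of_rat q" "real_of_rat q < y" using of_rat_dense by blast
    then show False using that rat_code_mem[of q x] rat_code_mem[of q y] by auto
  qed
  from this[OF eq] this[OF eq[symmetric]] show "r = s" by auto
qed simp

text \<open>A cut has a supremum in the real numbers of the surrounding logic and is the code of it.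
  So codes of reals are recognized inside a model by a definable predicate.\<close>

lemma cut_real_code:
  assumes Q: "elts Q = range rat_code" and L: "\<And>p q. pair (rat_code p) (rat_code q) \<in> elts L \<longleftrightarrow> p < q"
  shows "lower_cut Q L x \<longleftrightarrow> (\<exists>r. x = real_code r)"
proof
  assume x: "lower_cut Q L x"
  define C where "C = {q. rat_code q \<in> elts x}"
  have xC: "elts x = rat_code ` C" using x Q unfolding lower_cut_def C_def by auto
  have down: "p \<in> C" if "q \<in> C" "p < q" for p q
    using x that L[of p q] Q unfolding lower_cut_def C_def by blast
  have up: "\<exists>p\<in>C. q < p" if q: "q \<in> C" for q
  proof -
    obtain y where y: "y \<in> elts x" "pair (rat_code q) y \<in> elts L" using x q unfolding lower_cut_def C_def by blast
    then obtain p where "p \<in> C" "y = rat_code p" using xC by blast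
    then show ?thesis using y L by auto
  qed
  have "C \<noteq> {}"
  proof
    assume "C = {}"
    then have "x = vempty" using xC by (simp add: V_eq_iff)
    then show False using x unfolding lower_cut_def by blast
  qed
  obtain b where b: "b \<notin> C" using x Q unfolding lower_cut_def C_def by auto
  have le: "q \<le> b" if "q \<in> C" for q using down[OF that, of b] b that by (meson not_le)
  have bdd: "bdd_above (real_of_rat ` C)"
    by (rule bdd_aboveI[of _ "real_of_rat b"]) (use le in \<open>auto simp: of_rat_less_eq\<close>)
  define r where "r = Sup (real_of_rat ` C)"
  have "q \<in> C \<longleftrightarrow> real_of_rat q < r" for q
  proof
    assume "q \<in> C"
    then obtain p where p: "p \<in> C" "q < p" using up by blast
    then have "real_of_rat p \<le> r" unfolding r_def using bdd by (intro cSup_upper) auto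
    then show "real_of_rat q < r" using p(2) by (meson less_le_trans of_rat_less)
  next
    assume "real_of_rat q < r"
    then obtain y where "y \<in> real_of_rat ` C" "real_of_rat q < y"
      unfolding r_def using less_cSup_iff[OF _ bdd] \<open>C \<noteq> {}\<close> by auto
    then show "q \<in> C" using down by (auto simp: of_rat_less)
  qed
  then have "x = real_code r" unfolding V_eq_iff xC elts_real_code by auto
  then show "\<exists>r. x = real_code r" ..
next
  assume "\<exists>r. x = real_code r"
  then obtain r where r: "x = real_code r" by blast
  obtain q1 q2 where q: "real_of_rat q1 < r" "r < real_of_rat q2"
    using of_rat_dense[of "r - 1" r] of_rat_dense[of r "r + 1"] by auto
  have "\<exists>p. real_of_rat p < r \<and> a < p" if "real_of_rat a < r" for a
    using of_rat_dense[OF that] by (auto simp: of_rat_less)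
  moreover have "x \<noteq> vempty"
  proof -
    have "rat_code q1 \<in> elts x" using q(1) unfolding r by simp
    then show ?thesis by auto
  qed
  moreover have "rat_code q2 \<notin> elts x" using q(2) unfolding r by simp
  moreover have "real_of_rat p < r" if "real_of_rat b < r" "p < b" for p b
    using that by (meson less_trans of_rat_less)
  ultimately show "lower_cut Q L x"
    unfolding lower_cut_def Q r by (auto simp: L elts_real_code)
qed

context zmodel
begin

lemma dfn_mless [dfn_intros]:
  assumes "Fn f" "Fn g" "Fn h" "Fn k" shows "dfn (\<lambda>x. mless (f x) (g x) (h x) (k x))"
  unfolding mless_def by (intro dfn_intros omega_M Fn_comp[OF assms(1)] Fn_comp[OF assms(2)] Fn_comp[OF assms(3)] Fn_comp[OF assms(4)])

lemma rationals: "\<exists>Q\<in>M. \<exists>L\<in>M. elts Q = range rat_code \<and> (\<forall>p q. pair (rat_code p) (rat_code q) \<in> elts L \<longleftrightarrow> p < q)"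
proof -
  have "rshape \<in> M" unfolding rshape_def by (intro vtimes_M omega_M nat_code_M)
  then have Q: "vsep rshape isrc \<in> M"
    unfolding isrc_def by (intro vsep_M dfn_intros omega_M nat_code_M)
  have eQ: "elts (vsep rshape isrc) = range rat_code" unfolding elts_vsep isrc_rat_code by auto
  define L where "L = vsep (vtimes (vsep rshape isrc) (vsep rshape isrc)) (\<lambda>u. rlt (vfst u) (vsnd u))"
  have "L \<in> M" unfolding L_def rlt_def by (intro vsep_M vtimes_M Q dfn_intros nat_code_M)
  moreover have "pair (rat_code p) (rat_code q) \<in> elts L \<longleftrightarrow> p < q" for p q
  proof -
    have "rat_code p \<in> elts (vsep rshape isrc)" "rat_code q \<in> elts (vsep rshape isrc)" unfolding eQ by simp_all
    then show ?thesis unfolding L_def by (simp add: rlt_iff del: elts_vsep add: elts_vsep[of "vtimes _ _"])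
  qed
  ultimately show ?thesis using Q eQ by blast
qed

lemma real_code_rat_M: "real_code (real_of_rat q) \<in> M"
proof -
  obtain Q L where Q: "Q \<in> M" "L \<in> M" "elts Q = range rat_code" "\<forall>p q. pair (rat_code p) (rat_code q) \<in> elts L \<longleftrightarrow> p < q"
    using rationals by blast
  have "rat_code q \<in> M" using mem_M[of "rat_code q" Q] Q by simp
  then have "vsep Q (\<lambda>p. pair p (rat_code q) \<in> elts L) \<in> M" using Q by (intro vsep_M dfn_intros)
  moreover have "vsep Q (\<lambda>p. pair p (rat_code q) \<in> elts L) = real_code (real_of_rat q)"
    unfolding V_eq_iff elts_vsep Q(3) elts_real_code using Q(4) by (auto simp: of_rat_less)
  ultimately show ?thesis by simp
qed

end

text \<open>Cuts are subsets of a countable set of M, so \<open>Pow_bounded\<close> bounds them by a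
  set of N, from which separation picks the cuts.\<close>

lemma (in forcing) reals_set: "\<exists>R\<in>N. elts R = real_code ` reals_in N"
proof -
  obtain Q L where Q: "Q \<in> M" "L \<in> M" "elts Q = range rat_code" "\<forall>p q. pair (rat_code p) (rat_code q) \<in> elts L \<longleftrightarrow> p < q"
    using rationals by blast
  obtain Bd where Bd: "Bd \<in> N" "\<forall>x\<in>N. elts x \<subseteq> elts Q \<longrightarrow> x \<in> elts Bd" using Pow_bounded[OF Q(1)] by blast
  have QN: "Q \<in> N" "L \<in> N" using Q M_sub_N by auto
  have "vsep Bd (lower_cut Q L) \<in> N"
    unfolding lower_cut_def by (intro ext.vsep_M ext.dfn_intros Bd QN ext.vempty_M)
  moreover have "elts (vsep Bd (lower_cut Q L)) = real_code ` reals_in N"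
  proof -
    have c: "lower_cut Q L x \<longleftrightarrow> (\<exists>r. x = real_code r)" for x
      using cut_real_code[OF Q(3)] Q(4) by blast
    have "x \<in> elts Bd" if "x \<in> N" "lower_cut Q L x" for x
      using Bd(2)[THEN bspec, OF that(1), THEN mp, OF that(2)[unfolded lower_cut_def, THEN conjunct1]] .
    then have "x \<in> elts (vsep Bd (lower_cut Q L)) \<longleftrightarrow> x \<in> N \<and> (\<exists>r. x = real_code r)" for x
      using c[of x] ext.mem_M[of x Bd] Bd(1) by auto
    then have "elts (vsep Bd (lower_cut Q L)) = {x \<in> N. \<exists>r. x = real_code r}" by blast
    also have "{x \<in> S. \<exists>r. x = real_code r} = real_code ` reals_in S" for S
      unfolding reals_in_def by blast
    finally show ?thesis .
  qed
  ultimately show ?thesis by blast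
qed

section \<open>Pseudocompactness of the hyperspace\<close>

definition poscode :: "V \<Rightarrow> V" where
  "poscode j = pair (pair (nat_code 0) j) (pair (nat_code 0) (nat_code 1))"

text \<open>The code of -(j+1) rather than of -j, since a negative zero is no code of a
  rational.\<close>

definition negcode :: "V \<Rightarrow> V" where
  "negcode j = pair (pair (nat_code 1) (vins j j)) (pair (nat_code 0) (nat_code 1))"

lemma quotient_of_of_int: "quotient_of (of_int k) = (k, 1)"
  using quotient_of_Fract[of k 1] by (simp add: Fract_of_int_eq normalize_stable)

lemma poscode: "poscode (nat_code j) = rat_code (of_nat j)"
  using rat_code_quotient[OF quotient_of_of_int[of "int j"]] by (simp add: poscode_def)

lemma negcode: "negcode (nat_code j) = rat_code (- of_nat (Suc j))"
  using rat_code_quotient[OF quotient_of_of_int[of "- int (Suc j)"]]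
  by (simp add: negcode_def del: nat_code.simps flip: nat_code_Suc_vins)

context caught
begin

abbreviation VO :: "V set" where
  "VO \<equiv> Vietoris_opens N (Psi_points (vimg A w)) (Psi_opens N (vimg A w))"

lemma real_open_inI:
  assumes R: "R \<in> N" "elts R = real_code ` reals_in N" and S: "open S" and Q: "dfn Q"
    and eq: "\<And>r. r \<in> reals_in N \<Longrightarrow> Q (real_code r) \<longleftrightarrow> r \<in> S"
  shows "real_open_in N (S \<inter> reals_in N)"
  unfolding real_open_in_def
proof (intro conjI exI[of _ S] bexI[of _ "vsep R Q"])
  show "vsep R Q \<in> N" using R(1) Q by blast
  show "elts (vsep R Q) = real_code ` (S \<inter> reals_in N)" unfolding elts_vsep R(2) using eq by auto
qed (use S in auto)

text \<open>A nonempty open set of the Isbell-Mrowka space contains a natural number because the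
  members of the family are infinite. One number from each of the finitely many open sets forms the
  required finite set.\<close>

lemma finite_sets_dense:
  assumes W: "W \<in> VO" "F \<in> elts W"
  shows "\<exists>s\<in>elts W. finite (elts s) \<and> elts s \<noteq> {} \<and> elts s \<subseteq> elts omega"
proof -
  obtain U where U: "finite U" "U \<noteq> {}" "U \<subseteq> Psi_opens N (vimg A w)" "F \<in> Vb U" "Vb U \<subseteq> elts W"
    using W unfolding Vietoris_opens_def by blast
  have "\<exists>k. k \<in> elts u \<inter> elts omega" if u: "u \<in> U" for u
  proof -
    have uo: "u \<in> Psi_opens N (vimg A w)" using u U(3) by blast
    obtain x where x: "x \<in> elts u" using U(4) u unfolding Vietoris_basic_def by blast
    have "x \<in> elts (vimg A w) \<union> elts omega" using uo x unfolding Psi_opens_def Psi_points_def by blast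
    then show ?thesis
    proof
      assume xa: "x \<in> elts (vimg A w)"
      then obtain d where d: "d \<in> elts w" "x = A d" by auto
      obtain n where n: "n \<in> elts omega" "insert x (elts x - elts n) \<subseteq> elts u"
        using uo xa x unfolding Psi_opens_def by blast
      have "finite (elts n)" using n(1) by (auto simp: elts_omega)
      then have "elts x - elts n \<noteq> {}" using A_inf[OF d(1)] d(2) by (metis Diff_eq_empty_iff finite_subset)
      then show ?thesis using n(2) A_sub[OF d(1)] d(2) by blast
    qed (use x in blast)
  qed
  then obtain h where h: "\<And>u. u \<in> U \<Longrightarrow> h u \<in> elts u \<inter> elts omega" by metis
  define s where "s = vset (h ` U)"
  have es: "elts s = h ` U" unfolding s_def using U(1) by (simp add: countable_finite)
  have so: "elts s \<subseteq> elts omega" unfolding es using h by blast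
  have "elts s \<subseteq> N" using so mem_M[OF _ omega_M] by blast
  moreover have "finite (elts s)" unfolding es using U(1) by simp
  ultimately have "s \<in> N" using finite_M[of "elts s"] by simp
  then have "s \<in> CLp" using finite_CLp[of s] so U(1,2) es by simp
  then have "s \<in> Vb U" unfolding Vietoris_basic_def using h es by auto
  then have "s \<in> elts W" using U(5) by blast
  moreover have "elts s \<noteq> {}" unfolding es using U(2) by simp
  ultimately show ?thesis using so \<open>finite (elts s)\<close> by (intro bexI[of _ s] conjI)
qed

theorem CL_pseudocompact:
  assumes R: "R \<in> N" "elts R = real_code ` reals_in N"
    and rat: "\<And>q. real_code (real_of_rat q) \<in> N"
  shows "CL_Psi_pseudocompact_in N (vimg A w)"
  unfolding CL_Psi_pseudocompact_in_def pseudocompact_in_def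
proof (intro allI impI)
  fix g assume g: "continuous_real_in N CLp VO g"
  obtain f where f: "f \<in> N" "elts f = (\<lambda>x. pair x (real_code (g x))) ` CLp"
    using g unfolding continuous_real_in_def fun_in_def by auto
  have app: "vapp f x = real_code (g x)" if "x \<in> CLp" for x
  proof -
    have ex1: "\<exists>!y. pair x y \<in> elts f" using f(2) that by auto
    have "pair x (real_code (g x)) \<in> elts f" using f(2) that by blast
    then show ?thesis unfolding vapp_def if_P[OF ex1] by (rule the1_equality[OF ex1])
  qed
  have gR: "g x \<in> reals_in N" if "x \<in> CLp" for x using g that unfolding continuous_real_in_def by blast
  have preimage: "\<exists>W\<in>VO. elts W = {x \<in> CLp. g x \<in> S}" if "open S" "dfn Q"
    "\<And>r. r \<in> reals_in N \<Longrightarrow> Q (real_code r) \<longleftrightarrow> r \<in> S" for S Q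
  proof -
    have "real_open_in N (S \<inter> reals_in N)" using real_open_inI[OF R that] .
    then obtain W where "W \<in> VO" "elts W = {x \<in> CLp. g x \<in> S \<inter> reals_in N}"
      using g unfolding continuous_real_in_def by blast
    then show ?thesis using gR by auto
  qed
  show "\<exists>b. \<forall>x\<in>CLp. \<bar>g x\<bar> \<le> b"
  proof (rule ccontr)
    assume "\<not> ?thesis"
    then have unbdd: "\<exists>F\<in>CLp. b < \<bar>g F\<bar>" for b by (meson not_le)
    have Fpos: "Fn h \<Longrightarrow> Fn (\<lambda>x. poscode (h x))" and Fneg: "Fn h \<Longrightarrow> Fn (\<lambda>x. negcode (h x))" for h
      unfolding poscode_def negcode_def by (intro dfn_intros nat_code_M; assumption)+
    \<comment> \<open>For a pair of j and s this means \<open>j < g s\<close> or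
      \<open>g s \<le> - (j + 1)\<close>. Such a version of a lower bound on the absolute value
      needs only membership of rational codes in a cut.\<close>
    define X where "X = vsep T0 (\<lambda>t. vsnd t \<noteq> vempty \<and>
       (poscode (vfst t) \<in> elts (vapp f (vsnd t)) \<or> negcode (vfst t) \<notin> elts (vapp f (vsnd t))))"
    have XN: "X \<in> N" unfolding X_def by (intro vsep_M T0_N dfn_intros Fpos Fneg f(1) vempty_M)
    have X_pair: "pair (nat_code j) s \<in> elts X \<longleftrightarrow> finite (elts s) \<and> elts s \<subseteq> elts omega \<and> s \<noteq> vempty \<and>
        (real j < g s \<or> g s \<le> - real (Suc j))" for j s
    proof (cases "finite (elts s) \<and> elts s \<subseteq> elts omega \<and> s \<noteq> vempty")
      case True
      have "s \<in> N" using finite_M[of "elts s"] True elts_M[OF omega_M] by auto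
      then have "s \<in> CLp" using True by (intro finite_CLp) (auto simp: V_eq_iff)
      then have "vapp f s = real_code (g s)" by (rule app)
      then show ?thesis
        unfolding X_def T0_def using True by (simp add: poscode negcode of_rat_minus of_rat_add of_rat_diff not_less)
    qed (auto simp: X_def T0_def)
    have XT: "elts X \<subseteq> elts T0" unfolding X_def by auto
    have Xne: "elts (vsnd t) \<noteq> {}" if "t \<in> elts X" for t using that unfolding X_def by (auto simp: V_eq_iff)
    have "unb X"
      unfolding unb_def
    proof
      fix j
      \<comment> \<open>On the negative side X asks for a value of at most -(j+1), so the open set
        of values starts one further out.\<close>
      define J where "J = Suc j"
      obtain F where F: "F \<in> CLp" "real J < \<bar>g F\<bar>" using unbdd by blast
      define S where "S = {real J <..} \<union> {..< - real J}"
      have "open S" unfolding S_def by (intro open_Un open_greaterThan open_lessThan)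
      \<comment> \<open>A rational outside a lower cut only bounds the real weakly from above. The
        strict inequality that an open set requires is obtained by also excluding the
        endpoint.\<close>
      moreover have "dfn (\<lambda>x. poscode (nat_code J) \<in> elts x \<or> (negcode (nat_code j) \<notin> elts x \<and> x \<noteq> real_code (real_of_rat (- of_nat J))))"
        by (intro dfn_intros Fpos Fneg nat_code_M rat)
      moreover have "(poscode (nat_code J) \<in> elts (real_code r) \<or> (negcode (nat_code j) \<notin> elts (real_code r) \<and>
          real_code r \<noteq> real_code (real_of_rat (- of_nat J)))) \<longleftrightarrow> r \<in> S" for r
        unfolding poscode negcode real_code_eq_iff S_def J_def by (auto simp: of_rat_minus of_rat_add of_rat_diff not_less)
      ultimately obtain W where W: "W \<in> VO" "elts W = {x \<in> CLp. g x \<in> S}" using preimage by blast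
      have "F \<in> elts W" unfolding W(2) S_def using F by auto
      then obtain s where s: "s \<in> elts W" "finite (elts s)" "elts s \<noteq> {}" "elts s \<subseteq> elts omega"
        using finite_sets_dense[OF W(1)] by blast
      then have "g s \<in> S" using W(2) by blast
      then have "pair (nat_code j) s \<in> elts X"
        unfolding X_pair using s unfolding S_def J_def by (auto simp: V_eq_iff)
      then show "\<exists>t\<in>elts X. elts (nat_code j) \<subseteq> elts (vfst t)" by (intro bexI) auto
    qed
    from accumulation[OF XN XT Xne this] obtain F where F: "F \<in> CLp"
      and acc: "\<forall>U j. finite U \<and> U \<subseteq> Psi_opens N (vimg A w) \<and> F \<in> Vb U \<longrightarrow>
        (\<exists>t\<in>elts X. elts (nat_code j) \<subseteq> elts (vfst t) \<and> vsnd t \<in> Vb U)" by (rule bexE)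
    obtain c where c: "\<bar>g F\<bar> < real (Suc c)" using reals_Archimedean2[of "\<bar>g F\<bar>"] by (metis less_trans lessI of_nat_less_iff)
    define S where "S = {- real (Suc c) <..< real (Suc c)}"
    have "open S" unfolding S_def by simp
    moreover have "dfn (\<lambda>x. negcode (nat_code c) \<in> elts x \<and> poscode (nat_code (Suc c)) \<notin> elts x \<and> x \<noteq> real_code (real_of_rat (of_nat (Suc c))))"
      by (intro dfn_intros Fpos Fneg nat_code_M rat)
    moreover have "(negcode (nat_code c) \<in> elts (real_code r) \<and> poscode (nat_code (Suc c)) \<notin> elts (real_code r) \<and>
        real_code r \<noteq> real_code (real_of_rat (of_nat (Suc c)))) \<longleftrightarrow> r \<in> S" for r
      unfolding poscode negcode real_code_eq_iff S_def by (auto simp: of_rat_minus of_rat_add of_rat_diff not_less)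
    ultimately obtain W where W: "W \<in> VO" "elts W = {x \<in> CLp. g x \<in> S}" using preimage by blast
    have "F \<in> elts W" unfolding W(2) S_def using F c by auto
    then obtain U where U: "finite U" "U \<subseteq> Psi_opens N (vimg A w)" "F \<in> Vb U" "Vb U \<subseteq> elts W"
      using W(1) unfolding Vietoris_opens_def by blast
    then obtain t where t: "t \<in> elts X" "elts (nat_code (Suc c)) \<subseteq> elts (vfst t)" "vsnd t \<in> Vb U"
      using acc by blast
    then have "t \<in> elts T0" using XT by blast
    then obtain i s where ts: "t = pair (nat_code i) s" by (rule T0_E)
    have "g s \<in> S" using t(3) U(4) W(2) ts by auto
    moreover have "Suc c \<le> i" using t(2) unfolding ts by (simp del: nat_code.simps)
    moreover have "real i < g s \<or> g s \<le> - real (Suc i)" using t(1) unfolding ts X_pair by blast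
    ultimately show False unfolding S_def by auto
  qed
qed

end

section \<open>Cohen extensions\<close>

text \<open>Everything but catching subsets of \<open>T0\<close> in N concerns sets and functions of
  M and passes to N by inclusion.\<close>

lemma (in zmodel) caughtI:
  assumes c: "catching w A" and N: "nmodel N" "M \<subseteq> N"
    and cat: "\<And>X. X \<in> N \<Longrightarrow> elts X \<subseteq> elts T0 \<Longrightarrow> \<exists>g\<in>elts w. \<forall>b\<in>elts w. g \<in> elts (vins b b) \<longrightarrow>
       catch (vFin (Bs (vimg A b))) X (A b)"
  shows "caught N w A"
proof -
  interpret N: nmodel N by fact
  have w: "w \<in> M" "ordinal w" "infinite (elts w)" "\<forall>b\<in>elts w. ctbl b" "\<forall>b\<in>elts w. \<exists>c\<in>elts w. b \<in> elts c"
    and FA: "Fn A" and A: "\<forall>b\<in>elts w. elts (A b) \<subseteq> elts omega \<and> (\<forall>d\<in>elts b. finite (elts (A b) \<inter> elts (A d))) \<and>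
       catch (vFin (Bs (vimg A b))) T0 (A b)"
    using c unfolding catching_def by simp_all
  have NI: "x \<in> M \<Longrightarrow> x \<in> N" for x using N(2) by blast
  have bM: "b \<in> M" if "b \<in> elts w" for b using mem_M[OF that w(1)] .
  have AbM: "vimg A b \<in> M" if "b \<in> M" for b using vimg_M[OF FA that] .
  show ?thesis
  proof
    show "ordinal w" "infinite (elts w)" by fact+
    show "\<exists>c\<in>elts w. b \<in> elts c" if "b \<in> elts w" for b using w(5) that by blast
    show "elts (A b) \<subseteq> elts omega" if "b \<in> elts w" for b using A that by blast
    show "finite (elts (A b) \<inter> elts (A d))" if "b \<in> elts w" "d \<in> elts b" for b d using A that by blast
    show "vimg A w \<in> N" by (rule NI[OF AbM[OF w(1)]])
    show "vimg A b \<in> N" if "b \<in> elts w" for b by (rule NI[OF AbM[OF bM[OF that]]])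
    show "T0 \<in> N" "vFin omega \<in> N" by (intro NI T0_M vFin_M omega_M)+
    show "\<exists>Pt\<in>N. elts Pt = elts (vimg A w) \<union> elts omega"
    proof
      show "vUn (vins (vimg A w) (vins omega vempty)) \<in> N"
        using AbM[OF w(1)] by (intro NI vUn_M vins_M omega_M vempty_M)
      show "elts (vUn (vins (vimg A w) (vins omega vempty))) = elts (vimg A w) \<union> elts omega"
        unfolding elts_vUn elts_vins by auto
    qed
    show "Bs (vimg A b) \<in> N \<and> vFin (Bs (vimg A b)) \<in> N" if "b \<in> elts w" for b
      using AbM[OF bM[OF that]] by (intro conjI NI vFin_M Bs_M)
    show "\<exists>E\<in>N. elts (Bs (vimg A b)) \<subseteq> vapp E ` elts omega" if b: "b \<in> elts w" for b
    proof -
      have "ctbl b" using w(4) b by blast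
      then have "ctbl (vimg A b)" by (rule ctblI[OF FA]) simp
      then have "ctbl (Bs (vimg A b))" by (rule ctbl_Bs)
      then obtain e where e: "Fn e" "elts (Bs (vimg A b)) \<subseteq> e ` elts omega" unfolding ctbl_def by blast
      have "vimg (\<lambda>z. pair z (e z)) omega \<in> M" by (intro vimg_M dfn_intros Fn_comp[OF e(1)] omega_M)
      moreover have "vapp (vimg (\<lambda>z. pair z (e z)) omega) ` elts omega = e ` elts omega" by (intro image_cong) auto
      ultimately show ?thesis using e(2) NI by (intro bexI[of _ "vimg (\<lambda>z. pair z (e z)) omega"]) auto
    qed
    show "catch (vFin (Bs (vimg A b))) T0 (A b)" if "b \<in> elts w" for b using A that by blast
  qed (rule cat)
qed

text \<open>Almost disjointness of the family is asserted without reference to an extension, so the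
  development for N is also instantiated with M, where constant sequences give catching.\<close>

lemma (in zmodel) caught_ground: assumes "catching w A" shows "caught M w A"
proof (rule caughtI[OF assms nmodel_axioms order_refl])
  fix X assume X: "X \<in> M" "elts X \<subseteq> elts T0"
  have "Fn (\<lambda>i. X) \<and> (\<forall>i::V. elts X \<subseteq> elts T0)" using X Fn_const by blast
  then obtain g where "g \<in> elts w" "\<forall>b\<in>elts w. g \<in> elts (vins b b) \<longrightarrow> (\<forall>i\<in>elts omega. catch (vFin (Bs (vimg A b))) X (A b))"
    using assms unfolding catching_def by meson
  then show "\<exists>g\<in>elts w. \<forall>b\<in>elts w. g \<in> elts (vins b b) \<longrightarrow> catch (vFin (Bs (vimg A b))) X (A b)"
    using vempty_omega by blast
qed

text \<open>For a fixed pattern the witnesses of catching form a set of M. A superset of X in M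
  inherits bigness from X, is caught, and so meets that set; by \<open>countable_approx\<close> X
  meets it too. The index \<open>g\<close> works for all patterns at once because the approximating
  sequence depends only on X.\<close>

lemma (in cohen) caught_extension: assumes c: "catching w A" shows "caught N w A"
proof (rule caughtI[OF c ext.nmodel_axioms M_sub_N])
  fix X assume X: "X \<in> N" "elts X \<subseteq> elts T0"
  have w: "w \<in> M" and FA: "Fn A" using c unfolding catching_def by simp_all
  have bM: "b \<in> M" if "b \<in> elts w" for b using mem_M[OF that w] .
  have AbM: "vimg A b \<in> M" if "b \<in> M" for b using vimg_M[OF FA that] .
  obtain Y where Y: "Fn Y" "\<forall>i. elts (Y i) \<subseteq> elts T0"
    "\<forall>C\<in>M. (\<forall>i\<in>elts omega. elts X \<subseteq> elts (Y i) \<longrightarrow> elts (Y i) \<inter> elts C \<noteq> {}) \<longrightarrow> elts X \<inter> elts C \<noteq> {}"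
    using countable_approx[OF X T0_M ctbl_T0] by blast
  obtain g where g: "g \<in> elts w" "\<forall>b\<in>elts w. g \<in> elts (vins b b) \<longrightarrow>
     (\<forall>i\<in>elts omega. catch (vFin (Bs (vimg A b))) (Y i) (A b))"
    using c Y(1,2) unfolding catching_def by meson
  have "catch (vFin (Bs (vimg A b))) X (A b)" if b: "b \<in> elts w" "g \<in> elts (vins b b)" for b
    unfolding catch_def
  proof (intro ballI impI)
    let ?FB = "vFin (Bs (vimg A b))"
    fix a0 b0 D j
    assume h: "a0 \<in> elts ?FB" "b0 \<in> elts ?FB" "D \<in> elts ?FB" "j \<in> elts omega" and bg: "big ?FB X a0 b0"
    have FM: "?FB \<in> M" using AbM[OF bM[OF b(1)]] by (intro vFin_M Bs_M)
    have hM: "a0 \<in> M" "b0 \<in> M" "D \<in> M" "j \<in> M"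
      using mem_M[OF h(1) FM] mem_M[OF h(2) FM] mem_M[OF h(3) FM] mem_M[OF h(4) omega_M] by simp_all
    have AM: "A b \<in> M" using FnD[OF FA bM[OF b(1)]] .
    define Q where "Q t \<longleftrightarrow> elts j \<subseteq> elts (vfst t) \<and> hits (vsnd t) a0 \<and> misses (vsnd t) b0 \<and>
      (\<exists>y\<in>elts (rem (vsnd t) D). y \<in> elts (A b)) \<and> natle j (vsep (rem (vsnd t) D) (\<lambda>y. y \<notin> elts (A b)))" for t
    have "vsep T0 Q \<in> M" unfolding Q_def by (intro vsep_M T0_M dfn_intros hM AM)
    moreover have "\<forall>i\<in>elts omega. elts X \<subseteq> elts (Y i) \<longrightarrow> elts (Y i) \<inter> elts (vsep T0 Q) \<noteq> {}"
    proof (intro ballI impI)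
      fix i assume i: "i \<in> elts omega" "elts X \<subseteq> elts (Y i)"
      have "big ?FB (Y i) a0 b0" using bg i(2) unfolding big_def by (meson subsetD)
      moreover have "catch ?FB (Y i) (A b)" using g(2) b i(1) by blast
      ultimately have "\<exists>t\<in>elts (Y i). Q t"
        using h unfolding catch_def Q_def by simp
      then show "elts (Y i) \<inter> elts (vsep T0 Q) \<noteq> {}" using Y(2) by auto
    qed
    ultimately have "elts X \<inter> elts (vsep T0 Q) \<noteq> {}" using Y(3) by blast
    then show "\<exists>t\<in>elts X. elts j \<subseteq> elts (vfst t) \<and> hits (vsnd t) a0 \<and> misses (vsnd t) b0 \<and>
      (\<exists>y\<in>elts (rem (vsnd t) D). y \<in> elts (A b)) \<and> natle j (vsep (rem (vsnd t) D) (\<lambda>y. y \<notin> elts (A b)))"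
      unfolding Q_def by auto
  qed
  then show "\<exists>g\<in>elts w. \<forall>b\<in>elts w. g \<in> elts (vins b b) \<longrightarrow> catch (vFin (Bs (vimg A b))) X (A b)"
    using g(1) by blast
qed

theorem theorem5p3:
  fixes M :: "V set"
  assumes "ctm_ZFC_CH M"
  shows "\<exists>A\<in>M. almost_disjoint_family A \<and> Cohen_indestructible_MAD M A \<and>
           (\<forall>N. Cohen_extension M N \<longrightarrow> CL_Psi_pseudocompact_in N A)"
proof -
  interpret zmodel M
    by unfold_locales (use assms in \<open>auto simp: ctm_ZFC_CH_def\<close>)
  have "CH_in M" using assms unfolding ctm_ZFC_CH_def by blast
  then obtain w A where c: "catching w A" using catching_family by blast
  have ext: "MAD_in N (vimg A w) \<and> CL_Psi_pseudocompact_in N (vimg A w)" if N: "Cohen_extension M N" for N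
  proof -
    obtain k G where k: "infinite_cardinal_in M k" "generic_over M (Fn2 k) rev_incl G" "N = gen_ext M (Fn2 k) G"
      using N unfolding Cohen_extension_def by blast
    have kM: "k \<in> M" "ordinal k" using k(1) unfolding infinite_cardinal_in_def cardinal_in_def by blast+
    obtain P where P: "P \<in> M" "elts P = Fn2 k" using Fn2_M[OF kM(1)] by blast
    interpret cohen M P G k
      by unfold_locales (use P k kM in auto)
    have NG: "N = val G ` M" using gen_ext_eq k(3) P(2) by simp
    interpret C: caught "val G ` M" w A
      by (rule caught_extension[OF c])
    obtain R where R: "R \<in> val G ` M" "elts R = real_code ` reals_in (val G ` M)" using reals_set by blast
    have "real_code (real_of_rat q) \<in> val G ` M" for q using real_code_rat_M M_sub_N by blast
    then show ?thesis unfolding NG using C.CL_pseudocompact[OF R] C.A_MAD by blast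
  qed
  have "vimg A w \<in> M" using c unfolding catching_def by blast
  moreover have "almost_disjoint_family (vimg A w)"
    by (rule caught.A_almost_disjoint[OF caught_ground[OF c]])
  ultimately show ?thesis using ext unfolding Cohen_indestructible_MAD_def by blast
qed


end
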